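(* Let $\mathcal{E}$ be an ellipse in $\mathbb{R}^2$. Then for any $K>0$ there exists $\varepsilon>0$ such that for any domain $\Omega\subseteq\mathbb{R}^2$ that is $C^{127}$ $K$-close to $\mathcal{E}$ and $C^1$ $\varepsilon$-close to $\mathcal{E}$, if the symplectic billiard dynamics in $\Omega$ is rationally integrable, then $\Omega$ is an ellipse.
   Context: Deformations of ellipses. Let $\mathcal{E}$ be an ellipse with semiaxes $a,b$, and let $A=\alpha(\mathcal{E})=\sqrt[3]{\mathrm{area}(\mathcal{E})/\pi}=(ab)^{1/3}$. Choose Euclidean coordinates centered at the center of $\mathcal{E}$ with coordinate axes along the axes of $\mathcal{E}$, and parametrize $\mathcal{E}$ by $e_{a,b}(t)=(a\cos\frac{t}{A},b\sin\frac{t}{A})$, $t\in[0,2\pi A]$. For a (real-valued, $2\pi A$-periodic) function $n$, write $\partial\Omega=\mathcal{E}+n$ if $\partial\Omega=\{\gamma(t)=(1+n(t))e_{a,b}(t)\mid t\in[0,2\pi A]\}$. The norm is $\|n\|_{C^k}=\sum_{j=0}^k\max_{t\in[0,2\pi A]}|n^{(j)}(t)|$. For $c>0$, $\Omega$ is $C^k$ $c$-close to $\mathcal{E}$ if $\partial\Omega=\mathcal{E}+n$ with $\|n\|_{C^k}\le c$ (the same function $n$ is used for the $C^{127}$ and the $C^1$ closeness). The domains considered are convex with smooth boundary (for $n$ small enough the curve $\gamma$ is convex). Symplectic billiards. Let $\gamma$ be a smooth closed convex planar curve, positively oriented and bounding $\Omega$, and let $\omega$ be the standard area form on $\mathbb{R}^2$.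 For each $t$ let $t^*$ denote the other parameter at which the tangent line is parallel to $\dot\gamma(t)$. The phase space (a cylinder) consists of pairs $(t,t')$ with $t<t'<t^*$ (in the cyclic order), equivalently $\omega(\dot\gamma(t),\dot\gamma(t'))>0$. The symplectic billiard map sends $(t_1,t_2)$ to $(t_2,t_3)$, where $t_3$ is determined by the requirement that $\gamma(t_3)-\gamma(t_1)$ is positively parallel to the tangent vector $\dot\gamma(t_2)$. It is a twist map of the cylinder with generating function $H(t,t')=\omega(\gamma(t),\gamma(t'))$. Rational integrability. The symplectic billiard map $T$ of a planar convex domain, viewed as a self map of the phase cylinder, is rationally integrable if for every integer $q\ge 3$ there exists an invariant curve for $T$ (a closed non-contractible curve in the phase cylinder, invariant under $T$) whose rotation number is $\frac1q$ and which consists entirely of $q$-periodic orbits. *)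

theory Defs
  imports "HOL-Analysis.Analysis"
begin

definition nderiv :: "nat \<Rightarrow> (real \<Rightarrow> 'a::real_normed_vector) \<Rightarrow> real \<Rightarrow> 'a" where
  "nderiv k f = ((\<lambda>g t. vector_derivative g (at t)) ^^ k) f"

definition is_Ck :: "nat \<Rightarrow> (real \<Rightarrow> 'a::real_normed_vector) \<Rightarrow> bool" where
  "is_Ck k f \<longleftrightarrow>
     (\<forall>j<k. \<forall>t. nderiv j f differentiable (at t)) \<and> continuous_on UNIV (nderiv k f)"

definition smooth :: "(real \<Rightarrow> 'a::real_normed_vector) \<Rightarrow> bool" where
  "smooth f \<longleftrightarrow> (\<forall>k. is_Ck k f)"

text \<open>For \<open>n\<close> of class \<open>C\<close>-\<open>k\<close> every supremum below is a maximum.\<close>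

definition Ck_norm :: "real \<Rightarrow> nat \<Rightarrow> (real \<Rightarrow> real) \<Rightarrow> real" where
  "Ck_norm L k n = (\<Sum>j\<le>k. SUP t\<in>{0..L}. \<bar>nderiv j n t\<bar>)"

text \<open>An ellipse is a curve, not the region it encloses. The Euclidean coordinates adapted to it
  are given by the centre \<open>p\<close> and the orthonormal axis directions \<open>u\<close>, \<open>v\<close>. They are determined
  by the ellipse only up to the symmetries of the ellipse.\<close>

text \<open>The cube root of the enclosed area \<open>\<pi> a b\<close> divided by \<open>\<pi>\<close>.\<close>

definition ellipse_scale :: "real \<Rightarrow> real \<Rightarrow> real" where
  "ellipse_scale a b = root 3 (a * b)"

definition ellipse_param :: "real^2 \<Rightarrow> real^2 \<Rightarrow> real \<Rightarrow> real \<Rightarrow> real \<Rightarrow> real^2" where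
  "ellipse_param u v a b t =
     (a * cos (t / ellipse_scale a b)) *\<^sub>R u + (b * sin (t / ellipse_scale a b)) *\<^sub>R v"

definition ellipse_plus ::
  "real^2 \<Rightarrow> real^2 \<Rightarrow> real^2 \<Rightarrow> real \<Rightarrow> real \<Rightarrow> (real \<Rightarrow> real) \<Rightarrow> (real^2) set" where
  "ellipse_plus p u v a b n =
     (\<lambda>t. p + (1 + n t) *\<^sub>R ellipse_param u v a b t) ` {0..2 * pi * ellipse_scale a b}"

definition ellipse_with_axes ::
  "(real^2) set \<Rightarrow> real^2 \<Rightarrow> real^2 \<Rightarrow> real^2 \<Rightarrow> real \<Rightarrow> real \<Rightarrow> bool" where
  "ellipse_with_axes E p u v a b \<longleftrightarrow>
     norm u = 1 \<and> norm v = 1 \<and> u \<bullet> v = 0 \<and> a > 0 \<and> b > 0 \<and>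
     E = ellipse_plus p u v a b (\<lambda>_. 0)"

definition is_ellipse :: "(real^2) set \<Rightarrow> bool" where
  "is_ellipse E \<longleftrightarrow> (\<exists>p u v a b. ellipse_with_axes E p u v a b)"

text \<open>The deformation \<open>n\<close> is an explicit argument so that closeness in two different norms
  can be required of one and the same \<open>n\<close>.\<close>

definition Ck_close_via ::
  "nat \<Rightarrow> real \<Rightarrow> real^2 \<Rightarrow> real^2 \<Rightarrow> real^2 \<Rightarrow> real \<Rightarrow> real \<Rightarrow> (real \<Rightarrow> real) \<Rightarrow> (real^2) set \<Rightarrow> bool"
  where
  "Ck_close_via k c p u v a b n \<Omega> \<longleftrightarrow>
     (\<forall>t. n (t + 2 * pi * ellipse_scale a b) = n t) \<and>
     is_Ck k n \<and>
     frontier \<Omega> = ellipse_plus p u v a b n \<and>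
     Ck_norm (2 * pi * ellipse_scale a b) k n \<le> c"

definition area_form :: "real^2 \<Rightarrow> real^2 \<Rightarrow> real" where
  "area_form x y = x $ 1 * y $ 2 - x $ 2 * y $ 1"

text \<open>The last clause says that \<open>\<Omega>\<close> lies to the left of each tangent line, that is, \<open>\<gamma>\<close> is
  positively oriented.\<close>

definition boundary_param :: "(real^2) set \<Rightarrow> (real \<Rightarrow> real^2) \<Rightarrow> bool" where
  "boundary_param \<Omega> \<gamma> \<longleftrightarrow>
     smooth \<gamma> \<and>
     (\<forall>t. \<gamma> (t + 1) = \<gamma> t) \<and>
     inj_on \<gamma> {0..<1} \<and>
     range \<gamma> = frontier \<Omega> \<and>
     (\<forall>t. nderiv 1 \<gamma> t \<noteq> 0) \<and>
     (\<forall>t. \<forall>x\<in>\<Omega>. area_form (nderiv 1 \<gamma> t) (x - \<gamma> t) > 0)"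

definition smooth_convex_domain :: "(real^2) set \<Rightarrow> bool" where
  "smooth_convex_domain \<Omega> \<longleftrightarrow>
     open \<Omega> \<and> convex \<Omega> \<and> bounded \<Omega> \<and> \<Omega> \<noteq> {} \<and> (\<exists>\<gamma>. boundary_param \<Omega> \<gamma>)"

text \<open>A parameter modulo 1 is identified with the boundary point it parametrizes, so the phase
  cylinder is a subspace of the product of the boundary curve with itself.\<close>

definition phase_cylinder :: "(real \<Rightarrow> real^2) \<Rightarrow> ((real^2) \<times> (real^2)) set" where
  "phase_cylinder \<gamma> =
     {(\<gamma> t, \<gamma> t') | t t'. area_form (nderiv 1 \<gamma> t) (nderiv 1 \<gamma> t') > 0}"

text \<open>For a boundary parametrization \<open>\<gamma>\<close> of a smooth convex domain and \<open>(x, y)\<close> in the phase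
  cylinder, the direction of \<open>\<gamma>\<close> at \<open>y\<close> points from \<open>x\<close> into the domain, so the ray leaves the
  domain at exactly one boundary point \<open>z\<close>. Outside the phase cylinder the value is
  irrelevant.\<close>

definition symplectic_billiard ::
  "(real \<Rightarrow> real^2) \<Rightarrow> (real^2) \<times> (real^2) \<Rightarrow> (real^2) \<times> (real^2)" where
  "symplectic_billiard \<gamma> = (\<lambda>(x, y). (y, THE z. z \<in> range \<gamma> \<and>
     (\<exists>t r. \<gamma> t = y \<and> r > 0 \<and> z - x = r *\<^sub>R nderiv 1 \<gamma> t)))"

text \<open>The sequence \<open>\<tau>\<close> is the lift of the orbit to the universal cover, unique up to an integer
  translation; a point \<open>(t, t')\<close> of the phase cylinder is lifted so that \<open>t < t' < t + 1\<close>.\<close>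

definition has_rotation_number ::
  "(real \<Rightarrow> real^2) \<Rightarrow> (real^2) \<times> (real^2) \<Rightarrow> real \<Rightarrow> bool" where
  "has_rotation_number \<gamma> z \<rho> \<longleftrightarrow>
     (\<exists>\<tau> :: nat \<Rightarrow> real.
        (\<forall>k. \<tau> k < \<tau> (Suc k) \<and> \<tau> (Suc k) < \<tau> k + 1 \<and>
             (\<gamma> (\<tau> k), \<gamma> (\<tau> (Suc k))) = (symplectic_billiard \<gamma> ^^ k) z) \<and>
        (\<lambda>k. \<tau> k / real k) \<longlonglongrightarrow> \<rho>)"

definition essential_loop :: "'a::real_normed_vector set \<Rightarrow> (real \<Rightarrow> 'a) \<Rightarrow> bool" where
  "essential_loop S g \<longleftrightarrow>
     path g \<and> pathfinish g = pathstart g \<and> path_image g \<subseteq> S \<and>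
     \<not> (\<exists>c. homotopic_loops S g (linepath c c))"

definition invariant_curve ::
  "(real \<Rightarrow> real^2) \<Rightarrow> ((real^2) \<times> (real^2)) set \<Rightarrow> bool" where
  "invariant_curve \<gamma> C \<longleftrightarrow>
     (\<exists>g. essential_loop (phase_cylinder \<gamma>) g \<and> C = path_image g) \<and>
     symplectic_billiard \<gamma> ` C = C"

text \<open>Any two parametrizations of the boundary give conjugate billiard maps, so the choice of
  \<open>\<gamma>\<close> does not matter.\<close>

definition rationally_integrable :: "(real^2) set \<Rightarrow> bool" where
  "rationally_integrable \<Omega> \<longleftrightarrow>
     (\<exists>\<gamma>. boundary_param \<Omega> \<gamma> \<and>
       (\<forall>q::nat. q \<ge> 3 \<longrightarrow>
         (\<exists>C. invariant_curve \<gamma> C \<and>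
              (\<forall>z\<in>C. has_rotation_number \<gamma> z (1 / real q)) \<and>
              (\<forall>z\<in>C. (symplectic_billiard \<gamma> ^^ q) z = z))))"

end

theory Submission
  imports Defs
begin

text \<open>
Symplectic billiards commute with affine maps of the plane. In a suitable affine frame the ellipse is
therefore the unit circle, and a nearby domain is bounded by a curve \<open>r = 1 + m(\<psi>)\<close> in polar
coordinates. The proof shows that, in a well chosen frame, a small \<open>m\<close> must vanish.

For every \<open>q \<ge> 3\<close> and every boundary point, the invariant curve of rotation number \<open>1/q\<close> provides an
inscribed \<open>q\<close>-gon with that vertex which winds once around the centre and is critical for the sum of
the areas \<open>\<omega>(\<gamma>(t), \<gamma>(t'))\<close> (\<open>essential_loop_meets\<close>, \<open>periodic_polygon\<close>). Let \<open>\<epsilon>\<close> bound \<open>m\<close> and its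
first two derivatives. The critical equations force the polygon to be regular up to an error
polynomial in \<open>q\<close> times \<open>\<epsilon>\<close> (\<open>nearly_regular_polygon\<close>). The derivative of the action under a common
rotation of all vertices is zero as well, and for a nearly regular polygon this says that the sum of
\<open>m'\<close> over the vertices of a regular \<open>q\<close>-gon is of order \<open>q\<^sup>4 \<epsilon>\<^sup>2\<close> (\<open>polygon_sum_estimate\<close>). Hence
the \<open>q\<close>-th Fourier coefficient of \<open>m\<close> is quadratically small for every \<open>q \<ge> 3\<close>.

The remaining modes \<open>0\<close>, \<open>1\<close>, \<open>2\<close> are the first order effect of affine maps on the circle. They
become quadratically small too if the frame is chosen so that the domain has the centroid and the
inertia of the unit disc (\<open>normalized_deformation\<close>, \<open>low_modes_small\<close>). For large \<open>q\<close> the power of \<open>q\<close>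
spoils the quadratic bound, but there the smoothness of \<open>m\<close> makes the coefficient small. The two
regimes together show that a bound \<open>\<epsilon>\<close> on \<open>m\<close>, \<open>m'\<close>, \<open>m''\<close> improves itself to \<open>\<epsilon>/2\<close>
(\<open>C2_small_halves\<close>), so that \<open>m = 0\<close> and the boundary is an affine image of a circle.
\<close>

section \<open>Affine frames and domains in polar form\<close>

definition frame_vec :: "real^2 \<Rightarrow> real^2 \<Rightarrow> complex \<Rightarrow> real^2" where
  "frame_vec f g z = Re z *\<^sub>R f + Im z *\<^sub>R g"

definition frame_point :: "real^2 \<Rightarrow> real^2 \<Rightarrow> real^2 \<Rightarrow> complex \<Rightarrow> real^2" where
  "frame_point c f g z = c + frame_vec f g z"

definition frame_coord :: "real^2 \<Rightarrow> real^2 \<Rightarrow> real^2 \<Rightarrow> real^2 \<Rightarrow> complex" where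
  "frame_coord c f g x =
     Complex (area_form (x - c) g / area_form f g) (area_form f (x - c) / area_form f g)"

lemma bounded_bilinear_area_form: "bounded_bilinear area_form"
  unfolding bilinear_conv_bounded_bilinear[symmetric]
  by (simp add: bilinear_def linear_iff area_form_def algebra_simps)

interpretation area_form: bounded_bilinear area_form
  by (rule bounded_bilinear_area_form)

lemma area_form_self [simp]: "area_form x x = 0"
  by (simp add: area_form_def)

lemma area_form_commute: "area_form x y = - area_form y x"
  by (simp add: area_form_def)

lemma frame_coord_point [simp]:
  "area_form f g \<noteq> 0 \<Longrightarrow> frame_coord c f g (frame_point c f g z) = z"
  by (simp add: frame_coord_def frame_point_def frame_vec_def area_form.add_left
      area_form.add_right area_form.scaleR_left area_form.scaleR_right complex_eq_iff)

lemma frame_point_coord [simp]: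
  assumes "area_form f g \<noteq> 0"
  shows "frame_point c f g (frame_coord c f g x) = x"
proof -
  have "area_form (x - c) g * f $ i + area_form f (x - c) * g $ i = (x - c) $ i * area_form f g"
    for i :: 2
    using exhaust_2[of i] by (auto simp: area_form_def algebra_simps)
  then have "area_form (x - c) g / area_form f g * f $ i + area_form f (x - c) / area_form f g * g $ i
     = (x - c) $ i" for i
    using assms by (simp add: field_simps)
  then show ?thesis
    by (simp add: vec_eq_iff frame_coord_def frame_point_def frame_vec_def)
qed

lemma area_form_frame_vec:
  "area_form (frame_vec f g z) (frame_vec f g w) = area_form f g * Im (cnj z * w)"
  by (simp add: frame_vec_def area_form.add_left area_form.add_right area_form.scaleR_left
      area_form.scaleR_right area_form_commute[of g f] algebra_simps)

lemma frame_vec_diff: "frame_vec f g (z - w) = frame_vec f g z - frame_vec f g w"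
  by (simp add: frame_vec_def algebra_simps)

lemma frame_point_diff: "frame_point c f g z - frame_point c f g w = frame_vec f g (z - w)"
  by (simp add: frame_point_def frame_vec_diff)

lemma bounded_linear_frame_vec: "bounded_linear (frame_vec f g)"
  unfolding frame_vec_def
  by (intro bounded_linear_add bounded_linear_scaleR_const bounded_linear_Re bounded_linear_Im)

lemma continuous_frame_coord:
  assumes "area_form f g \<noteq> 0" shows "continuous_on S (frame_coord c f g)"
  unfolding frame_coord_def Complex_eq
  by (intro continuous_intros area_form.continuous_on) (use assms in auto)

lemma cis_eq_cis_iff: "cis a = cis b \<longleftrightarrow> (\<exists>j::int. a = b + 2 * pi * j)"
proof -
  have "cis a = cis b \<longleftrightarrow> sin a = sin b \<and> cos a = cos b"
    by (auto simp: complex_eq_iff)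
  then show ?thesis
    by (simp add: sin_cos_eq_iff)
qed

lemma periodic_int:
  assumes per: "\<And>x. f (x + p) = f (x :: real)"
  shows "f (x + p * of_int j) = f x"
proof -
  have nat: "f (x + p * real n) = f x" for n x
    by (induction n) (use per in \<open>simp_all add: algebra_simps\<close>, metis add.assoc add.commute)
  show ?thesis
  proof (cases "j \<ge> 0")
    case True
    then show ?thesis using nat[of x "nat j"] by simp
  next
    case False
    then show ?thesis using nat[of "x + p * of_int j" "nat (- j)"] by simp
  qed
qed

text \<open>A convex domain whose boundary is a radial graph over the unit circle of an affine frame centred at
\<open>c\<close>. The assumption on \<open>\<rho>''\<close> is positivity of the curvature of the radial graph, and the slope
condition keeps the tangent within an eighth of a turn of the circular direction.\<close>

locale polar_table =
  fixes \<Omega> :: "(real^2) set" and c f g :: "real^2" and \<rho> \<rho>' \<rho>'' :: "real \<Rightarrow> real"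
    and \<gamma> :: "real \<Rightarrow> real^2"
  assumes frame: "area_form f g > 0"
    and domain: "open \<Omega>" "convex \<Omega>"
    and frontier: "frontier \<Omega> = range (\<lambda>\<psi>. frame_point c f g (of_real (\<rho> \<psi>) * cis \<psi>))"
    and radius_pos: "\<rho> \<psi> > 0"
    and radius_periodic: "\<rho> (\<psi> + 2 * pi) = \<rho> \<psi>"
    and radius_deriv: "(\<rho> has_real_derivative \<rho>' \<psi>) (at \<psi>)"
    and radius_deriv2: "(\<rho>' has_real_derivative \<rho>'' \<psi>) (at \<psi>)"
    and slope: "\<bar>\<rho>' \<psi>\<bar> < \<rho> \<psi>"
    and strictly_convex: "\<rho>'' \<psi> * \<rho> \<psi> - (\<rho>' \<psi>)\<^sup>2 < (\<rho> \<psi>)\<^sup>2 + (\<rho>' \<psi>)\<^sup>2"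
    and param: "boundary_param \<Omega> \<gamma>"
begin

definition polar :: "real \<Rightarrow> complex" where
  "polar \<psi> = of_real (\<rho> \<psi>) * cis \<psi>"

definition polar_deriv :: "real \<Rightarrow> complex" where
  "polar_deriv \<psi> = Complex (\<rho>' \<psi>) (\<rho> \<psi>) * cis \<psi>"

definition pt :: "real \<Rightarrow> real^2" where "pt \<psi> = frame_point c f g (polar \<psi>)"

definition tang :: "real \<Rightarrow> real^2" where "tang \<psi> = frame_vec f g (polar_deriv \<psi>)"

text \<open>In the frame, the tangent at polar angle \<open>\<psi>\<close> has argument \<open>\<psi> + \<pi>/2 - tilt \<psi>\<close>. Thus
\<open>tangent_angle\<close>, defined next, is the argument of the tangent up to a quarter turn.\<close>

definition tilt :: "real \<Rightarrow> real" where "tilt \<psi> = arctan (\<rho>' \<psi> / \<rho> \<psi>)"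

definition tangent_angle :: "real \<Rightarrow> real" where "tangent_angle \<psi> = \<psi> - tilt \<psi>"

lemma frame_nz [simp]: "area_form f g \<noteq> 0"
  using frame by simp

lemma polar_has_derivative: "(polar has_vector_derivative polar_deriv \<psi>) (at \<psi>)"
proof -
  have "(cis has_vector_derivative \<i> * cis \<psi>) (at \<psi>)"
    unfolding cis.ctr Complex_eq
    by (auto intro!: derivative_eq_intros simp: complex_eq_iff has_vector_derivative_complex_iff)
  moreover have "((\<lambda>x. complex_of_real (\<rho> x)) has_vector_derivative of_real (\<rho>' \<psi>)) (at \<psi>)"
    using radius_deriv by (rule has_vector_derivative_of_real)
  ultimately have "((\<lambda>x. of_real (\<rho> x) * cis x) has_vector_derivative
       (of_real (\<rho> \<psi>) * (\<i> * cis \<psi>) + of_real (\<rho>' \<psi>) * cis \<psi>)) (at \<psi>)"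
    by (intro has_vector_derivative_mult)
  then show ?thesis
    unfolding polar_def[abs_def] polar_deriv_def Complex_eq by (simp add: algebra_simps)
qed

lemma pt_has_derivative: "(pt has_vector_derivative tang \<psi>) (at \<psi>)"
proof -
  have "((\<lambda>x. frame_vec f g (polar x)) has_vector_derivative tang \<psi>) (at \<psi>)"
    unfolding tang_def
    by (rule bounded_linear.has_vector_derivative[OF bounded_linear_frame_vec polar_has_derivative])
  then show ?thesis
    unfolding pt_def[abs_def] frame_point_def by (auto intro!: derivative_eq_intros)
qed

lemma radius_deriv_periodic: "\<rho>' (\<psi> + 2 * pi) = \<rho>' \<psi>"
proof -
  have "((\<lambda>x. \<rho> (x + 2 * pi)) has_real_derivative \<rho>' (\<psi> + 2 * pi)) (at \<psi>)"
    by (rule DERIV_shift[THEN iffD1, OF radius_deriv])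
  then have "(\<rho> has_real_derivative \<rho>' (\<psi> + 2 * pi)) (at \<psi>)"
    by (simp add: radius_periodic)
  then show ?thesis using radius_deriv DERIV_unique by blast
qed

lemma polar_int: "polar (\<psi> + 2 * pi * of_int j) = polar \<psi>"
  by (simp add: polar_def periodic_int[where f = \<rho> and p = "2 * pi", OF radius_periodic] cis_mult[symmetric] cis_multiple_2pi)

lemma polar_deriv_int: "polar_deriv (\<psi> + 2 * pi * of_int j) = polar_deriv \<psi>"
  by (simp add: polar_deriv_def periodic_int[where f = \<rho> and p = "2 * pi", OF radius_periodic] cis_mult[symmetric]
      cis_multiple_2pi periodic_int[where f = \<rho>' and p = "2 * pi", OF radius_deriv_periodic])

lemma pt_int: "pt (\<psi> + 2 * pi * of_int j) = pt \<psi>"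
  by (simp add: pt_def polar_int)

lemma tang_int: "tang (\<psi> + 2 * pi * of_int j) = tang \<psi>"
  by (simp add: tang_def polar_deriv_int)

lemma frontier_pt: "frontier \<Omega> = range pt"
  by (simp add: frontier pt_def polar_def image_def)

lemma coord_pt: "frame_coord c f g (pt \<psi>) = polar \<psi>"
  by (simp add: pt_def)

lemma polar_eq_iff: "polar a = polar b \<longleftrightarrow> (\<exists>j::int. a = b + 2 * pi * j)"
proof
  assume eq: "polar a = polar b"
  then have "cmod (polar a) = cmod (polar b)" by simp
  then have "\<rho> a = \<rho> b" using radius_pos by (simp add: polar_def norm_mult less_imp_le)
  with eq have "cis a = cis b" using radius_pos[of b] by (simp add: polar_def)
  then show "\<exists>j::int. a = b + 2 * pi * j" by (simp only: cis_eq_cis_iff)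
qed (auto simp: polar_int)

lemma pt_eq_iff: "pt a = pt b \<longleftrightarrow> (\<exists>j::int. a = b + 2 * pi * j)"
  using polar_eq_iff coord_pt pt_def by metis

lemma cross_polar_deriv: "Im (cnj (polar \<psi>) * polar_deriv \<psi>) = (\<rho> \<psi>)\<^sup>2"
proof -
  have "cnj (cis \<psi>) * cis \<psi> = 1" by (simp add: cis_cnj cis_mult)
  then have "cnj (polar \<psi>) * polar_deriv \<psi> = of_real (\<rho> \<psi>) * Complex (\<rho>' \<psi>) (\<rho> \<psi>)"
    by (simp add: polar_def polar_deriv_def mult_ac)
  then show ?thesis by (simp add: power2_eq_square)
qed

lemma tilt_cos_pos: "cos (tilt \<psi>) > 0"
  using arctan_lbound arctan_ubound unfolding tilt_def by (intro cos_gt_zero_pi) auto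

lemma polar_deriv_polar_form:
  "polar_deriv \<psi> = of_real (\<rho> \<psi> / cos (tilt \<psi>)) * (\<i> * cis (tangent_angle \<psi>))"
proof -
  have c: "cos (tilt \<psi>) > 0" by (rule tilt_cos_pos)
  have "tan (tilt \<psi>) = \<rho>' \<psi> / \<rho> \<psi>" by (simp add: tilt_def tan_arctan)
  then have "\<rho>' \<psi> * cos (tilt \<psi>) = \<rho> \<psi> * sin (tilt \<psi>)"
    using c radius_pos[of \<psi>] by (simp add: tan_def field_simps)
  then have eq: "Complex (\<rho>' \<psi>) (\<rho> \<psi>) = of_real (\<rho> \<psi> / cos (tilt \<psi>)) * (\<i> * cis (- tilt \<psi>))"
    using c by (simp add: complex_eq_iff field_simps)
  have "cis (tangent_angle \<psi>) = cis (- tilt \<psi>) * cis \<psi>"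
    by (simp add: tangent_angle_def cis_mult)
  then show ?thesis
    unfolding polar_deriv_def eq by (simp only: mult.assoc)
qed

lemma cross_tangents:
  "Im (cnj (polar_deriv a) * polar_deriv b) =
     \<rho> a / cos (tilt a) * (\<rho> b / cos (tilt b)) * sin (tangent_angle b - tangent_angle a)"
proof -
  have "Im (cnj (of_real A * (\<i> * cis x)) * (of_real B * (\<i> * cis y))) = A * B * sin (y - x)"
    for A B x y by (simp add: sin_diff algebra_simps)
  then show ?thesis by (simp only: polar_deriv_polar_form)
qed

text \<open>Turns membership in the phase cylinder into a condition on tangent angles.\<close>

lemma area_tangents_pos_iff:
  "area_form (tang a) (tang b) > 0 \<longleftrightarrow> sin (tangent_angle b - tangent_angle a) > 0"
proof -
  define A where "A = area_form f g * (\<rho> a / cos (tilt a) * (\<rho> b / cos (tilt b)))"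
  have "A > 0" using frame radius_pos tilt_cos_pos by (simp add: A_def)
  moreover have "area_form (tang a) (tang b) = A * sin (tangent_angle b - tangent_angle a)"
    unfolding tang_def area_form_frame_vec cross_tangents A_def by (simp only: mult.assoc)
  ultimately show ?thesis by (simp add: zero_less_mult_iff)
qed

lemma tangent_angle_period: "tangent_angle (\<psi> + 2 * pi) = tangent_angle \<psi> + 2 * pi"
  by (simp add: tangent_angle_def tilt_def radius_periodic radius_deriv_periodic)

text \<open>Its derivative is the curvature up to a positive factor.\<close>

lemma tangent_angle_less:
  assumes "a < b" shows "tangent_angle a < tangent_angle b"
proof (rule DERIV_pos_imp_increasing[OF assms])
  fix x
  have nz: "\<rho> x \<noteq> 0" using radius_pos[of x] by simp
  define s where "s = (\<rho> x)\<^sup>2 + (\<rho>' x)\<^sup>2"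
  have s: "s > 0" using nz by (simp add: s_def sum_power2_gt_zero_iff)
  have "(tangent_angle has_real_derivative
      1 - inverse (1 + (\<rho>' x / \<rho> x)\<^sup>2) * ((\<rho>'' x * \<rho> x - \<rho>' x * \<rho>' x) / (\<rho> x * \<rho> x))) (at x)"
    unfolding tangent_angle_def[abs_def] tilt_def[abs_def] using nz
    by (auto intro!: derivative_eq_intros radius_deriv radius_deriv2)
  moreover have "inverse (1 + (\<rho>' x / \<rho> x)\<^sup>2) * ((\<rho>'' x * \<rho> x - \<rho>' x * \<rho>' x) / (\<rho> x * \<rho> x))
      = (\<rho>'' x * \<rho> x - (\<rho>' x)\<^sup>2) / s"
  proof -
    have "1 + (\<rho>' x / \<rho> x)\<^sup>2 = s / (\<rho> x * \<rho> x)"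
      using nz by (simp add: s_def field_simps power2_eq_square)
    then show ?thesis using nz s by (simp add: power2_eq_square)
  qed
  moreover have "(\<rho>'' x * \<rho> x - (\<rho>' x)\<^sup>2) / s < 1"
    using s strictly_convex[of x] by (simp add: s_def field_simps)
  ultimately show "\<exists>y. (tangent_angle has_real_derivative y) (at x) \<and> 0 < y" by auto
qed


end

section \<open>The billiard map of a convex domain\<close>

lemma area_form_zero_parallel:
  assumes "area_form u v = 0" "u \<noteq> 0"
  shows "\<exists>r. v = r *\<^sub>R u"
proof (cases "u $ 1 = 0")
  case True
  then have "u $ 2 \<noteq> 0" using assms(2) by (auto simp: vec_eq_iff forall_2)
  then show ?thesis using True assms(1)
    by (intro exI[of _ "v $ 2 / u $ 2"]) (auto simp: vec_eq_iff forall_2 area_form_def)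
next
  case False
  then show ?thesis using assms(1)
    by (intro exI[of _ "v $ 1 / u $ 1"]) (auto simp: vec_eq_iff forall_2 area_form_def field_simps)
qed

lemma no_small_multiple_of_period:
  assumes "0 < 2 * pi * of_int j" "2 * pi * of_int j < 2 * pi" shows False
proof -
  have "j \<ge> 1" using assms(1) by (simp add: zero_less_mult_iff)
  then have "2 * pi * 1 \<le> 2 * pi * of_int j" by (intro mult_left_mono) auto
  then show False using assms(2) by simp
qed

context polar_table
begin

lemma polar_nz [simp]: "polar \<psi> \<noteq> 0"
  using radius_pos[of \<psi>] by (simp add: polar_def)

lemma center_notin_frontier: "c \<notin> frontier \<Omega>"
proof
  assume "c \<in> frontier \<Omega>"
  then obtain \<psi> where "c = pt \<psi>" by (auto simp: frontier_pt)
  then have "frame_coord c f g c = polar \<psi>" using coord_pt by metis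
  moreover have "frame_coord c f g c = 0" by (simp add: frame_coord_def area_form.zero_left area_form.zero_right complex_eq_iff)
  ultimately show False by simp
qed

lemma frontier_open: "frontier \<Omega> = closure \<Omega> - \<Omega>"
  using domain(1) by (simp add: frontier_def interior_open)

lemma pt_in_closure: "pt \<psi> \<in> closure \<Omega>"
  using frontier_pt frontier_open by auto

text \<open>The boundary points with polar angles \<open>0\<close> and \<open>\<pi>\<close> lie on opposite sides of \<open>c\<close> on a line, so \<open>c\<close>
is in the closure by convexity, and no boundary point has radius zero.\<close>

lemma center_in: "c \<in> \<Omega>"
proof -
  have "\<rho> 0 > 0" "\<rho> pi > 0" by (rule radius_pos)+
  then have "(\<rho> pi / (\<rho> 0 + \<rho> pi)) *\<^sub>R pt 0 + (\<rho> 0 / (\<rho> 0 + \<rho> pi)) *\<^sub>R pt pi \<in> closure \<Omega>"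
    using pt_in_closure by (intro convexD convex_closure domain) (auto simp: add_divide_distrib[symmetric])
  moreover have "(\<rho> pi / (\<rho> 0 + \<rho> pi)) *\<^sub>R pt 0 + (\<rho> 0 / (\<rho> 0 + \<rho> pi)) *\<^sub>R pt pi = c"
    using \<open>\<rho> 0 > 0\<close> \<open>\<rho> pi > 0\<close>
  proof -
    define s where "s = \<rho> 0 + \<rho> pi"
    have s: "s > 0" using \<open>\<rho> 0 > 0\<close> \<open>\<rho> pi > 0\<close> by (simp add: s_def)
    have "x *\<^sub>R pt 0 + y *\<^sub>R pt pi = (x + y) *\<^sub>R c + (x * \<rho> 0 - y * \<rho> pi) *\<^sub>R f" for x y
      by (simp add: pt_def polar_def frame_point_def frame_vec_def algebra_simps)
    then have "(\<rho> pi / s) *\<^sub>R pt 0 + (\<rho> 0 / s) *\<^sub>R pt pi = (\<rho> pi / s + \<rho> 0 / s) *\<^sub>R c"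
      by (simp add: mult.commute)
    also have "\<rho> pi / s + \<rho> 0 / s = 1" using s by (simp add: s_def add_divide_distrib[symmetric])
    finally show ?thesis by (simp add: s_def)
  qed
  ultimately show ?thesis using center_notin_frontier frontier_open by auto
qed

lemma gamma_has_derivative: "(\<gamma> has_vector_derivative nderiv 1 \<gamma> t) (at t)"
proof -
  have "is_Ck 1 \<gamma>" using param by (simp add: boundary_param_def smooth_def)
  then have "nderiv 0 \<gamma> differentiable (at t)" unfolding is_Ck_def by blast
  then show ?thesis by (simp add: nderiv_def vector_derivative_works)
qed

lemma gamma_range: "range \<gamma> = range pt"
  using param frontier_pt by (simp add: boundary_param_def)

lemma pt_on_gamma: "\<exists>t. \<gamma> t = pt \<psi>"
  using gamma_range by (metis rangeE rangeI)

lemma gamma_on_pt: "\<exists>\<psi>. \<gamma> t = pt \<psi>"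
  using gamma_range by (metis rangeE rangeI)

lemma gamma_support:
  assumes "x \<in> closure \<Omega>" shows "area_form (nderiv 1 \<gamma> t) (x - \<gamma> t) \<ge> 0"
proof -
  have "closed {x. 0 \<le> area_form (nderiv 1 \<gamma> t) (x - \<gamma> t)}"
    by (intro closed_Collect_le continuous_intros area_form.continuous_on)
  moreover have "\<Omega> \<subseteq> {x. 0 \<le> area_form (nderiv 1 \<gamma> t) (x - \<gamma> t)}"
    using param by (auto simp: boundary_param_def less_imp_le)
  ultimately show ?thesis using closure_minimal assms by blast
qed

lemma area_pt_derivative:
  "((\<lambda>s. area_form v (pt s - w)) has_real_derivative area_form v (tang \<psi>)) (at \<psi>)"
proof -
  have "((\<lambda>s. pt s - w) has_vector_derivative tang \<psi>) (at \<psi>)"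
    using pt_has_derivative by (auto intro!: derivative_eq_intros)
  from bounded_linear.has_vector_derivative[OF area_form.bounded_linear_right this]
  show ?thesis by (simp add: has_real_derivative_iff_has_vector_derivative)
qed

lemma area_tang_center: "area_form (tang \<psi>) (c - pt \<psi>) > 0"
proof -
  have "c - pt \<psi> = - frame_vec f g (polar \<psi>)" by (simp add: pt_def frame_point_def)
  then have "area_form (tang \<psi>) (c - pt \<psi>) = area_form (frame_vec f g (polar \<psi>)) (tang \<psi>)"
    by (simp add: area_form.minus_right area_form_commute[of "tang \<psi>"])
  also have "\<dots> = area_form f g * (\<rho> \<psi>)\<^sup>2"
    by (simp only: tang_def area_form_frame_vec cross_polar_deriv)
  finally show ?thesis using frame radius_pos[of \<psi>] by simp
qed

lemma tang_nz [simp]: "tang \<psi> \<noteq> 0"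
  using area_tang_center[of \<psi>] by (auto simp: area_form.zero_left)

text \<open>The radial graph stays on one side of the tangent line to \<open>\<gamma>\<close>, and it touches this line at the
common point. So the two tangents are parallel, and both have the centre on their left.\<close>

lemma gamma_tangent:
  assumes "\<gamma> t = pt \<psi>"
  shows "\<exists>l>0. nderiv 1 \<gamma> t = l *\<^sub>R tang \<psi>"
proof -
  have "area_form (nderiv 1 \<gamma> t) (tang \<psi>) = 0"
    using gamma_support[OF pt_in_closure, of t] assms
    by (intro DERIV_local_min[OF area_pt_derivative[of _ "pt \<psi>"], of 1])
       (auto simp: area_form.zero_right)
  then have "area_form (tang \<psi>) (nderiv 1 \<gamma> t) = 0" by (subst area_form_commute) simp
  then obtain l where l: "nderiv 1 \<gamma> t = l *\<^sub>R tang \<psi>" using area_form_zero_parallel tang_nz by blast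
  have "area_form (nderiv 1 \<gamma> t) (c - \<gamma> t) > 0"
    using param center_in by (simp add: boundary_param_def)
  then have "l > 0" using area_tang_center[of \<psi>] assms l
    by (auto simp: area_form.scaleR_left zero_less_mult_iff)
  then show ?thesis using l by blast
qed

lemma tang_support:
  assumes "x \<in> closure \<Omega>" shows "area_form (tang \<psi>) (x - pt \<psi>) \<ge> 0"
proof -
  obtain t where t: "\<gamma> t = pt \<psi>" using gamma_range by (metis rangeE rangeI)
  then obtain l where "l > 0" "nderiv 1 \<gamma> t = l *\<^sub>R tang \<psi>" using gamma_tangent by blast
  then show ?thesis using gamma_support[OF assms, of t] t
    by (simp add: area_form.scaleR_left zero_le_mult_iff)
qed

text \<open>Allows any choice of polar angles for the two points, so that the parametrization \<open>\<gamma>\<close> can be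
forgotten from here on.\<close>

lemma phase_cylinder_iff:
  "z \<in> phase_cylinder \<gamma> \<longleftrightarrow> (\<exists>a b. z = (pt a, pt b) \<and> area_form (tang a) (tang b) > 0)"
proof -
  have conv: "area_form (nderiv 1 \<gamma> t) (nderiv 1 \<gamma> t') > 0 \<longleftrightarrow> area_form (tang a) (tang b) > 0"
    if "\<gamma> t = pt a" "\<gamma> t' = pt b" for t t' a b
    using gamma_tangent[OF that(1)] gamma_tangent[OF that(2)]
    by (auto simp: area_form.scaleR_left area_form.scaleR_right zero_less_mult_iff)
  show ?thesis
  proof
    assume "z \<in> phase_cylinder \<gamma>"
    then obtain t t' where z: "z = (\<gamma> t, \<gamma> t')" "area_form (nderiv 1 \<gamma> t) (nderiv 1 \<gamma> t') > 0"
      by (auto simp: phase_cylinder_def)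
    obtain a where "\<gamma> t = pt a" using gamma_on_pt by blast
    moreover obtain b where "\<gamma> t' = pt b" using gamma_on_pt by blast
    ultimately show "\<exists>a b. z = (pt a, pt b) \<and> area_form (tang a) (tang b) > 0" using z conv by auto
  next
    assume "\<exists>a b. z = (pt a, pt b) \<and> area_form (tang a) (tang b) > 0"
    then obtain a b where z: "z = (pt a, pt b)" "area_form (tang a) (tang b) > 0" by blast
    obtain t where "\<gamma> t = pt a" using pt_on_gamma by blast
    moreover obtain t' where "\<gamma> t' = pt b" using pt_on_gamma by blast
    ultimately show "z \<in> phase_cylinder \<gamma>" unfolding phase_cylinder_def
      by (intro CollectI exI[of _ t] exI[of _ t']) (use z conv in simp)
  qed
qed

text \<open>The signed distance of the curve from the line through \<open>pt a\<close> along \<open>tang b\<close> decreases when the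
curve leaves \<open>pt a\<close> and again when it returns, hence it vanishes in between. Convexity decides the
direction of the chord.\<close>

lemma chord_exists:
  assumes "area_form (tang a) (tang b) > 0"
  shows "\<exists>s r. r > 0 \<and> pt s - pt a = r *\<^sub>R tang b"
proof -
  define F where "F = (\<lambda>s. area_form (tang b) (pt s - pt a))"
  have neg: "area_form (tang b) (tang a) < 0"
    using assms by (subst area_form_commute) simp
  have tper: "tang (a + 2 * pi) = tang a" and pper: "pt (a + 2 * pi) = pt a"
    using tang_int[of a 1] pt_int[of a 1] by simp_all
  have dF: "(F has_real_derivative area_form (tang b) (tang s)) (at s)" for s
    unfolding F_def by (rule area_pt_derivative)
  have F0: "F a = 0" "F (a + 2 * pi) = 0" by (simp_all add: F_def pper area_form.zero_right)
  obtain d1 where d1: "d1 > 0" "\<And>h. 0 < h \<Longrightarrow> h < d1 \<Longrightarrow> F (a + h) < 0"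
    using DERIV_neg_dec_right[OF dF[of a] neg] F0 by auto
  obtain d2 where d2: "d2 > 0" "\<And>h. 0 < h \<Longrightarrow> h < d2 \<Longrightarrow> F (a + 2 * pi - h) > 0"
    using DERIV_neg_dec_left[OF dF[of "a + 2 * pi"]] neg F0 by (auto simp: tper)
  \<comment> \<open>Steps of length at most \<open>1\<close> keep the two test points in order, since \<open>2 < 2\<pi>\<close>.\<close>
  define h1 where "h1 = min (d1 / 2) 1"
  define h2 where "h2 = min (d2 / 2) 1"
  have h: "0 < h1" "h1 < d1" "h1 \<le> 1" "0 < h2" "h2 < d2" "h2 \<le> 1"
    using d1(1) d2(1) by (auto simp: h1_def h2_def)
  have "\<exists>s\<ge>a + h1. s \<le> a + 2 * pi - h2 \<and> F s = 0"
    using d1(2)[of h1] d2(2)[of h2] h pi_gt3 dF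
    by (intro IVT') (auto intro!: continuous_at_imp_continuous_on intro: DERIV_isCont)
  then obtain s where s: "a + h1 \<le> s" "s \<le> a + 2 * pi - h2" "F s = 0" by blast
  have "pt s \<noteq> pt a"
  proof
    assume "pt s = pt a"
    then obtain j :: int where "s = a + 2 * pi * j" by (auto simp: pt_eq_iff)
    with s h have "0 < 2 * pi * of_int j" "2 * pi * of_int j < 2 * pi" by linarith+
    then show False by (rule no_small_multiple_of_period)
  qed
  moreover obtain r where r: "pt s - pt a = r *\<^sub>R tang b"
    using area_form_zero_parallel[of "tang b" "pt s - pt a"] s(3) by (auto simp: F_def)
  moreover have "r * area_form (tang a) (tang b) \<ge> 0"
    using tang_support[OF pt_in_closure, of a s] r by (simp add: area_form.scaleR_right)
  ultimately show ?thesis using assms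
    by (intro exI[of _ s] exI[of _ r]) (auto simp: zero_le_mult_iff less_le)
qed

text \<open>The tangent at the middle one of three collinear boundary points contains all three of them. It then
supports the domain at \<open>pt a\<close> too, and so it is parallel to \<open>tang a\<close>.\<close>

lemma chord_unique_aux:
  assumes "area_form (tang a) (tang b) > 0"
    and s1: "pt s1 - pt a = r1 *\<^sub>R tang b" and s2: "pt s2 - pt a = r2 *\<^sub>R tang b"
    and r: "0 < r1" "r1 < r2"
  shows False
proof -
  have e1: "pt a - pt s1 = (- r1) *\<^sub>R tang b" using s1 by (metis minus_diff_eq scaleR_minus_left)
  have e2: "pt s2 - pt s1 = (r2 - r1) *\<^sub>R tang b" using s1 s2 by (simp add: algebra_simps)
  have "r1 * area_form (tang s1) (tang b) \<le> 0"
    using tang_support[OF pt_in_closure, of s1 a]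
    by (simp only: e1 area_form.scaleR_right) simp
  moreover have "(r2 - r1) * area_form (tang s1) (tang b) \<ge> 0"
    using tang_support[OF pt_in_closure, of s1 s2] e2 by (simp add: area_form.scaleR_right)
  ultimately have z: "area_form (tang s1) (tang b) = 0"
    using r by (auto simp: mult_le_0_iff zero_le_mult_iff)
  have za: "area_form (tang s1) (pt a - pt s1) = 0" using z by (simp only: e1 area_form.scaleR_right) simp
  have "area_form (tang s1) (tang a) = 0"
    using tang_support[OF pt_in_closure, of s1] za
    by (intro DERIV_local_min[OF area_pt_derivative[of _ "pt s1"], of 1]) auto
  moreover obtain k where k: "tang b = k *\<^sub>R tang s1" using area_form_zero_parallel[OF z tang_nz] by blast
  ultimately have "area_form (tang b) (tang a) = 0" by (simp add: area_form.scaleR_left)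
  then show False using assms(1) by (subst (asm) area_form_commute) simp
qed

text \<open>Existence and uniqueness of the chord justify the definite description in the billiard map.\<close>

lemma symplectic_billiard_step:
  assumes "area_form (tang a) (tang b) > 0"
  shows "\<exists>s r. r > 0 \<and> pt s - pt a = r *\<^sub>R tang b \<and> symplectic_billiard \<gamma> (pt a, pt b) = (pt b, pt s)"
proof -
  obtain s r where s: "r > 0" "pt s - pt a = r *\<^sub>R tang b" using chord_exists[OF assms] by blast
  have "(THE z. z \<in> range \<gamma> \<and> (\<exists>t r. \<gamma> t = pt b \<and> r > 0 \<and> z - pt a = r *\<^sub>R nderiv 1 \<gamma> t)) = pt s"
  proof (rule the_equality)
    obtain t where t: "\<gamma> t = pt b" using gamma_range by (metis rangeE rangeI)
    then obtain l where l: "l > 0" "nderiv 1 \<gamma> t = l *\<^sub>R tang b" using gamma_tangent by blast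
    then have "pt s - pt a = (r / l) *\<^sub>R nderiv 1 \<gamma> t" "r / l > 0" using s by auto
    then show "pt s \<in> range \<gamma> \<and> (\<exists>t r. \<gamma> t = pt b \<and> r > 0 \<and> pt s - pt a = r *\<^sub>R nderiv 1 \<gamma> t)"
      using t gamma_range by blast
  next
    fix z assume z: "z \<in> range \<gamma> \<and> (\<exists>t r. \<gamma> t = pt b \<and> r > 0 \<and> z - pt a = r *\<^sub>R nderiv 1 \<gamma> t)"
    then obtain t r' where t: "\<gamma> t = pt b" "r' > 0" "z - pt a = r' *\<^sub>R nderiv 1 \<gamma> t" by blast
    obtain l where l: "l > 0" "nderiv 1 \<gamma> t = l *\<^sub>R tang b" using gamma_tangent[OF t(1)] by blast
    obtain s' where s': "z = pt s'" using z gamma_range by auto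
    have e: "pt s' - pt a = (r' * l) *\<^sub>R tang b" "r' * l > 0" using t l s' by auto
    have "r' * l = r"
      using chord_unique_aux[OF assms e(1) s(2)] chord_unique_aux[OF assms s(2) e(1)] s(1) e(2)
      by (meson linorder_neqE_linordered_idom)
    then show "z = pt s" using e s s' by (metis diff_add_cancel)
  qed
  then show ?thesis using s by (auto simp: symplectic_billiard_def)
qed

end

section \<open>Invariant curves and periodic polygons\<close>

context polar_table
begin

lemma gamma_deriv_continuous: "continuous_on UNIV (nderiv 1 \<gamma>)"
proof -
  have "is_Ck 1 \<gamma>" using param by (simp add: boundary_param_def smooth_def)
  then show ?thesis by (simp add: is_Ck_def)
qed

lemma gamma_eqD:
  assumes "\<gamma> s = \<gamma> t" shows "\<exists>j::int. s = t + j"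
proof -
  have per: "\<gamma> (x + 1 * of_int j) = \<gamma> x" for x j
    using param by (intro periodic_int) (simp add: boundary_param_def)
  have "\<gamma> (frac x) = \<gamma> x" for x
    using per[of x "- \<lfloor>x\<rfloor>"] by (simp add: frac_def)
  with assms have "\<gamma> (frac s) = \<gamma> (frac t)" by simp
  moreover have "inj_on \<gamma> {0..<1}" using param by (simp add: boundary_param_def)
  ultimately have "frac s = frac t" by (auto dest: inj_onD simp: frac_lt_1)
  then have "s = t + of_int (\<lfloor>s\<rfloor> - \<lfloor>t\<rfloor>)" by (simp add: frac_def)
  then show ?thesis by blast
qed

lemma coord_linear: "bounded_linear (frame_coord 0 f g)"
proof -
  have "linear (frame_coord 0 f g)"
    by (rule linearI) (auto simp: frame_coord_def area_form.add_left area_form.add_right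
        area_form.scaleR_left area_form.scaleR_right complex_eq_iff add_divide_distrib)
  then show ?thesis by (simp add: linear_conv_bounded_linear)
qed

lemma coord_shift: "frame_coord c f g x = frame_coord 0 f g (x - c)"
  by (simp add: frame_coord_def)

lemma frame_vec_coord: "frame_vec f g (frame_coord 0 f g x) = x"
  using frame_point_coord[of f g 0 x] by (simp add: frame_point_def)

text \<open>The polar angle along \<open>\<gamma>\<close> is the imaginary part of a primitive of \<open>Z'/Z\<close>, where \<open>Z\<close> is \<open>\<gamma>\<close> in frame
coordinates. It increases because the centre is on the left of every tangent. Over one period it
gains a positive multiple of \<open>2\<pi>\<close>, and more than one turn would contradict injectivity.\<close>

lemma polar_angle_lift:
  "\<exists>h. (\<forall>t. \<gamma> t = pt (h t)) \<and> strict_mono h \<and> (\<forall>t. h (t + 1) = h t + 2 * pi)"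
proof -
  define Z where "Z = (\<lambda>t. frame_coord c f g (\<gamma> t))"
  define D where "D = (\<lambda>t. frame_coord 0 f g (nderiv 1 \<gamma> t))"
  have dZ: "(Z has_vector_derivative D t) (at t)" for t
    unfolding Z_def D_def coord_shift
    by (rule bounded_linear.has_vector_derivative[OF coord_linear])
       (use gamma_has_derivative in \<open>auto intro!: derivative_eq_intros\<close>)
  have contD: "continuous_on UNIV D"
    unfolding D_def using gamma_deriv_continuous by (rule bounded_linear.continuous_on[OF coord_linear])
  have Z_pt: "Z t = polar a" if "\<gamma> t = pt a" for t a using that coord_pt by (simp add: Z_def)
  have Znz: "Z t \<noteq> 0" for t using gamma_on_pt Z_pt polar_nz by metis
  have cross: "Im (cnj (Z t) * D t) > 0" for t
  proof -
    have "area_form (nderiv 1 \<gamma> t) (c - \<gamma> t) > 0"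
      using param center_in by (simp add: boundary_param_def)
    also have "area_form (nderiv 1 \<gamma> t) (c - \<gamma> t) = area_form (\<gamma> t - c) (nderiv 1 \<gamma> t)"
      by (simp add: area_form_def algebra_simps)
    also have "\<dots> = area_form (frame_vec f g (Z t)) (frame_vec f g (D t))"
      unfolding Z_def D_def coord_shift frame_vec_coord ..
    finally show ?thesis using frame by (simp only: area_form_frame_vec zero_less_mult_iff) auto
  qed
  have "isCont (\<lambda>t. D t / Z t) t" for t
  proof -
    have "isCont Z t" using dZ has_vector_derivative_continuous by blast
    moreover have "isCont D t" using contD by (simp add: continuous_on_eq_continuous_at)
    ultimately show ?thesis using Znz by (intro continuous_intros) auto
  qed
  then obtain G where "\<forall>x :: real. - \<infinity> < ereal x \<longrightarrow> ereal x < \<infinity> \<longrightarrow>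
      (G has_vector_derivative D x / Z x) (at x)"
    using einterval_antiderivative[of "-\<infinity>" "\<infinity>" "\<lambda>t. D t / Z t"] by auto
  then have dG: "(G has_vector_derivative D t / Z t) (at t)" for t by simp
  have "((\<lambda>t. Z t * exp (- G t)) has_vector_derivative 0) (at t)" for t
  proof -
    have "((\<lambda>t. - G t) has_vector_derivative - (D t / Z t)) (at t)"
      using dG by (rule has_vector_derivative_minus)
    from field_vector_diff_chain_at[OF this DERIV_exp]
    have "((\<lambda>t. exp (- G t)) has_vector_derivative - (D t / Z t) * exp (- G t)) (at t)"
      by (simp add: o_def)
    from has_vector_derivative_mult[OF dZ this] show ?thesis
      using Znz[of t] by (simp add: field_simps)
  qed
  then obtain C where C: "\<And>t. Z t * exp (- G t) = C"
    using has_vector_derivative_zero_constant[of UNIV "\<lambda>t. Z t * exp (- G t)"] by auto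
  have "C \<noteq> 0" using C[of 0] Znz[of 0] by auto
  define H where "H = (\<lambda>t. Ln C + G t)"
  have ZH: "Z t = exp (H t)" for t
  proof -
    have "Z t = C * exp (G t)" using C[of t] by (simp add: exp_minus field_simps)
    then show ?thesis using \<open>C \<noteq> 0\<close> by (simp add: H_def exp_add)
  qed
  define h where "h = (\<lambda>t. Im (H t))"
  have gh: "\<gamma> t = pt (h t)" for t
  proof -
    obtain a where a: "\<gamma> t = pt a" using gamma_on_pt by blast
    have e: "of_real (\<rho> a) * cis a = of_real (exp (Re (H t))) * cis (h t)"
      using Z_pt[OF a] ZH[of t] by (simp add: polar_def h_def exp_eq_polar)
    then have "cmod (of_real (\<rho> a) * cis a) = cmod (of_real (exp (Re (H t))) * cis (h t))" by simp
    then have "\<rho> a = exp (Re (H t))" using radius_pos[of a] by (simp add: norm_mult)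
    with e radius_pos[of a] have "cis a = cis (h t)" by simp
    then obtain j :: int where "a = h t + 2 * pi * j" by (auto simp: cis_eq_cis_iff)
    then show ?thesis using a by (simp add: pt_int)
  qed
  have dh: "(h has_real_derivative Im (D t / Z t)) (at t)" for t
  proof -
    have "(H has_vector_derivative D t / Z t) (at t)"
      unfolding H_def using dG by (auto intro!: derivative_eq_intros)
    from bounded_linear.has_vector_derivative[OF bounded_linear_Im this]
    show ?thesis by (simp add: h_def has_real_derivative_iff_has_vector_derivative)
  qed
  have pos: "Im (D t / Z t) > 0" for t
  proof -
    have "D t / Z t = (cnj (Z t) * D t) / of_real ((cmod (Z t))\<^sup>2)"
      using Znz[of t] by (simp add: complex_norm_square field_simps del: of_real_power)
    then have "Im (D t / Z t) = Im (cnj (Z t) * D t) / (cmod (Z t))\<^sup>2"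
      by (simp only: Im_divide_of_real)
    then show ?thesis using cross[of t] Znz[of t] by simp
  qed
  have mono: "strict_mono h"
  proof (rule strict_monoI)
    fix x y :: real assume "x < y"
    then show "h x < h y" by (rule DERIV_pos_imp_increasing) (use dh pos in blast)
  qed
  have "h (t + 1) = h t + 2 * pi" for t
  proof -
    have "\<gamma> (t + 1) = \<gamma> t" using param by (simp add: boundary_param_def)
    then obtain j :: int where j: "h (t + 1) = h t + 2 * pi * j" by (auto simp: gh pt_eq_iff)
    have "h t < h (t + 1)" using mono by (simp add: strict_mono_less)
    with j have "j > 0" by (simp add: zero_less_mult_iff)
    have "\<not> j \<ge> 2"
    proof
      assume "j \<ge> 2"
      then have "2 * pi * 2 \<le> 2 * pi * of_int j" by (intro mult_left_mono) auto
      then have lt: "h t + 2 * pi < h (t + 1)" using j pi_gt_zero by linarith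
      have "\<exists>s\<ge>t. s \<le> t + 1 \<and> h s = h t + 2 * pi"
        using lt dh by (intro IVT') (auto intro!: continuous_at_imp_continuous_on intro: DERIV_isCont)
      then obtain s where s: "t \<le> s" "s \<le> t + 1" "h s = h t + 2 * pi" by blast
      with lt have "t < s" "s < t + 1" by (auto simp: less_le)
      have "\<gamma> s = \<gamma> t" using s(3) pt_int[of "h t" 1] by (simp add: gh)
      then obtain i :: int where "s = t + i" using gamma_eqD by blast
      with \<open>t < s\<close> \<open>s < t + 1\<close> show False by simp
    qed
    with \<open>j > 0\<close> have "j = 1" by simp
    then show ?thesis using j by simp
  qed
  then show ?thesis using gh mono by blast
qed

lemma tang_eq: "pt a = pt b \<Longrightarrow> tang a = tang b"
  by (auto simp: pt_eq_iff tang_int)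

lemma continuous_on_Arg2pi:
  assumes "continuous_on S w" "\<And>s. s \<in> S \<Longrightarrow> w s \<notin> \<real>\<^sub>\<ge>\<^sub>0"
  shows "continuous_on S (\<lambda>s. Arg2pi (w s))"
proof -
  have "continuous_on (- \<real>\<^sub>\<ge>\<^sub>0) Arg2pi"
    by (rule continuous_at_imp_continuous_on) (simp add: continuous_at_Arg2pi)
  then show ?thesis by (rule continuous_on_compose2) (use assms in auto)
qed

text \<open>Chooses the polar angle of a boundary point in the interval from \<open>b0\<close> to \<open>b0 + 2\<pi>\<close>. Away from the
ray at angle \<open>b0\<close> this choice is continuous, since \<open>Arg2pi\<close> jumps on that ray only.\<close>

lemma relative_angle:
  assumes "\<not> (\<exists>j::int. b = b0 + 2 * pi * j)"
  defines "w \<equiv> polar b / cis b0"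
  shows "w \<notin> \<real>\<^sub>\<ge>\<^sub>0" "pt (b0 + Arg2pi w) = pt b" "0 < Arg2pi w" "Arg2pi w < 2 * pi"
proof -
  have w: "w = of_real (\<rho> b) * cis (b - b0)" by (simp add: w_def polar_def flip: cis_divide)
  show nn: "w \<notin> \<real>\<^sub>\<ge>\<^sub>0"
  proof
    assume "w \<in> \<real>\<^sub>\<ge>\<^sub>0"
    then obtain x where x: "x \<ge> 0" "w = of_real x" by (auto simp: nonneg_Reals_def)
    then have "cmod w = x" by simp
    then have "x = \<rho> b" using w radius_pos[of b] by (simp add: norm_mult)
    then have "cis (b - b0) = cis 0" using w x radius_pos[of b] by simp
    then obtain j :: int where "b - b0 = 0 + 2 * pi * j" unfolding cis_eq_cis_iff by blast
    then show False using assms(1) by (auto simp: algebra_simps)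
  qed
  have "w = of_real (cmod w) * exp (\<i> * of_real (Arg2pi w))" by (rule Arg2pi_eq)
  moreover have "cmod w = \<rho> b" using radius_pos[of b] by (simp add: w norm_mult)
  ultimately have "of_real (\<rho> b) * cis (b - b0) = of_real (\<rho> b) * cis (Arg2pi w)"
    using w by (simp add: cis_conv_exp)
  then have "cis (b - b0) = cis (Arg2pi w)" using radius_pos[of b] by simp
  then obtain j :: int where "b - b0 = Arg2pi w + 2 * pi * j" unfolding cis_eq_cis_iff by blast
  then have "b = b0 + Arg2pi w + 2 * pi * j" by simp
  then show "pt (b0 + Arg2pi w) = pt b" by (simp only: pt_int)
  show "0 < Arg2pi w" using nn by (rule Arg2pi_gt_0)
  show "Arg2pi w < 2 * pi" by (rule Arg2pi_lt_2pi)
qed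

lemma tangent_angle_gap:
  assumes "area_form (tang a) (tang b) > 0" "a < b" "b < a + 2 * pi"
  shows "0 < tangent_angle b - tangent_angle a" "tangent_angle b - tangent_angle a < pi"
proof -
  show "0 < tangent_angle b - tangent_angle a" using tangent_angle_less[OF assms(2)] by simp
  have "tangent_angle b - tangent_angle a < 2 * pi"
    using tangent_angle_less[OF assms(3)] tangent_angle_period[of a] by simp
  then show "tangent_angle b - tangent_angle a < pi"
    using assms(1) sin_le_zero[of "tangent_angle b - tangent_angle a"]
    by (force simp: area_tangents_pos_iff)
qed

text \<open>A quarter turn of the polar angle is a continuous section of the phase cylinder, because the tilt
is less than \<open>\<pi>/4\<close>.\<close>

lemma tangent_angle_quarter:
  "0 < tangent_angle (a + pi / 2) - tangent_angle a" "tangent_angle (a + pi / 2) - tangent_angle a < pi"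
proof -
  have "\<bar>tilt x\<bar> < pi / 4" for x
  proof -
    have "\<bar>\<rho>' x / \<rho> x\<bar> < 1" using slope[of x] radius_pos[of x] by (simp add: abs_divide)
    then have "- 1 < \<rho>' x / \<rho> x" "\<rho>' x / \<rho> x < 1" by linarith+
    then have "arctan (- 1) < tilt x" "tilt x < arctan 1" unfolding tilt_def by (simp_all only: arctan_less_iff)
    then show ?thesis by (simp add: arctan_minus arctan_one)
  qed
  from this[of a] this[of "a + pi / 2"]
  show "0 < tangent_angle (a + pi / 2) - tangent_angle a" "tangent_angle (a + pi / 2) - tangent_angle a < pi"
    by (auto simp: tangent_angle_def)
qed

lemma integer_difference_zero:
  assumes "x = of_int i" "\<bar>x\<bar> < (1 :: real)" shows "x = 0"
  using assms by (simp flip: of_int_abs)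

lemma pt_continuous: "continuous_on S pt"
  using pt_has_derivative by (meson continuous_at_imp_continuous_on has_vector_derivative_continuous)

text \<open>A loop in the phase cylinder that avoids the fibre over one boundary point lifts to polar angles
\<open>(A, B)\<close> in the set \<open>W\<close>, whose fibres are intervals since the tangent angle is monotone. There \<open>B\<close> can
be moved to a quarter turn after \<open>A\<close>, and then \<open>A\<close> to a constant, so the loop was not essential.\<close>

lemma essential_loop_meets:
  assumes ess: "essential_loop (phase_cylinder \<gamma>) F"
  shows "\<exists>z\<in>path_image F. fst z = pt a0"
proof (rule ccontr)
  assume avoid: "\<not> ?thesis"
  have F: "path F" "pathfinish F = pathstart F" "path_image F \<subseteq> phase_cylinder \<gamma>"
    and nc: "\<not> (\<exists>c. homotopic_loops (phase_cylinder \<gamma>) F (linepath c c))"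
    using ess by (auto simp: essential_loop_def)
  define W where "W = {(a, b). 0 < tangent_angle b - tangent_angle a \<and> tangent_angle b - tangent_angle a < pi}"
  define u where "u = (\<lambda>s. frame_coord c f g (fst (F s)) / cis a0)"
  define A where "A = (\<lambda>s. a0 + Arg2pi (u s))"
  define v where "v = (\<lambda>s. frame_coord c f g (snd (F s)) / cis (A s))"
  define B where "B = (\<lambda>s. A s + Arg2pi (v s))"
  have props: "u s \<notin> \<real>\<^sub>\<ge>\<^sub>0 \<and> v s \<notin> \<real>\<^sub>\<ge>\<^sub>0 \<and> F s = (pt (A s), pt (B s)) \<and> (A s, B s) \<in> W"
    if s: "s \<in> {0..1}" for s
  proof -
    have "F s \<in> path_image F" using s by (auto simp: path_image_def)
    then have ph: "F s \<in> phase_cylinder \<gamma>" and ne: "fst (F s) \<noteq> pt a0" using F avoid by auto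
    then obtain a b where ab: "F s = (pt a, pt b)" "area_form (tang a) (tang b) > 0"
      by (auto simp: phase_cylinder_iff)
    have "\<not> (\<exists>j::int. a = a0 + 2 * pi * j)" using ne ab pt_int by auto
    from relative_angle[OF this]
    have U: "u s \<notin> \<real>\<^sub>\<ge>\<^sub>0" and A: "pt (A s) = pt a" using ab by (simp_all add: u_def A_def coord_pt)
    have areaA: "area_form (tang (A s)) (tang b) > 0" using ab(2) tang_eq[OF A] by simp
    have "\<not> (\<exists>j::int. b = A s + 2 * pi * j)"
      using areaA by (auto simp: tang_int)
    from relative_angle[OF this]
    have V: "v s \<notin> \<real>\<^sub>\<ge>\<^sub>0" and B: "pt (B s) = pt b" "A s < B s" "B s < A s + 2 * pi"
      using ab by (simp_all add: v_def B_def coord_pt)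
    have "area_form (tang (A s)) (tang (B s)) > 0" using areaA tang_eq[OF B(1)] by simp
    from tangent_angle_gap[OF this B(2,3)] show ?thesis using U V A B ab by (simp add: W_def)
  qed
  have contF: "continuous_on {0..1} F" using F(1) by (simp add: path_def)
  have contA: "continuous_on {0..1} A"
  proof -
    have "continuous_on {0..1} u" unfolding u_def
      by (intro continuous_intros continuous_on_compose2[OF continuous_frame_coord] contF) auto
    then have "continuous_on {0..1} (\<lambda>s. Arg2pi (u s))"
      by (rule continuous_on_Arg2pi) (use props in blast)
    then show ?thesis unfolding A_def by (intro continuous_intros)
  qed
  have contB: "continuous_on {0..1} B"
  proof -
    have "continuous_on {0..1} v" unfolding v_def
      by (intro continuous_intros continuous_on_compose2[OF continuous_frame_coord]
          continuous_on_compose2[where g = cis and t = UNIV] contF contA) auto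
    then have "continuous_on {0..1} (\<lambda>s. Arg2pi (v s))"
      by (rule continuous_on_Arg2pi) (use props in blast)
    then show ?thesis unfolding B_def using contA by (intro continuous_intros)
  qed
  have "F 0 = F 1" using F(2) by (simp add: pathfinish_def pathstart_def)
  then have "A 0 = A 1" by (simp add: A_def u_def)
  then have "B 0 = B 1" using \<open>F 0 = F 1\<close> by (simp add: B_def v_def)
  define H1 where "H1 = (\<lambda>s. (A s, B s))"
  define H2 where "H2 = (\<lambda>s. (A s, A s + pi / 2))"
  define z0 where "z0 = (A 0, A 0 + pi / 2)"
  have p: "path H1" "path H2" "pathfinish H1 = pathstart H1" "pathfinish H2 = pathstart H2"
    using contA contB \<open>A 0 = A 1\<close> \<open>B 0 = B 1\<close>
    by (auto simp: H1_def H2_def path_def pathfinish_def pathstart_def intro!: continuous_intros)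
  have between: "(a, b) \<in> W" if "(a, b1) \<in> W" "(a, b2) \<in> W" "b1 \<le> b" "b \<le> b2" for a b b1 b2
    using that tangent_angle_less[of b1 b] tangent_angle_less[of b b2]
    by (cases "b1 = b"; cases "b = b2") (auto simp: W_def)
  have quarter: "(a, a + pi / 2) \<in> W" for a using tangent_angle_quarter by (simp add: W_def)
  have h12: "homotopic_loops W H1 H2"
  proof (rule homotopic_loops_linear)
    fix t :: real assume t: "t \<in> {0..1}"
    show "closed_segment (H1 t) (H2 t) \<subseteq> W"
    proof
      fix x assume "x \<in> closed_segment (H1 t) (H2 t)"
      then obtain e where e: "0 \<le> e" "e \<le> 1" "x = (1 - e) *\<^sub>R H1 t + e *\<^sub>R H2 t"
        by (auto simp: in_segment)
      then have x: "x = (A t, (1 - e) * B t + e * (A t + pi / 2))"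
        by (simp add: H1_def H2_def algebra_simps)
      have "(1 - e) * B t + e * (A t + pi / 2) \<in> closed_segment (B t) (A t + pi / 2)"
        using e(1,2) by (auto simp: in_segment)
      then show "x \<in> W"
        using between[of "A t" "B t" "A t + pi / 2"] between[of "A t" "A t + pi / 2" "B t"]
          props[OF t] quarter[of "A t"]
        unfolding x closed_segment_eq_real_ivl by (auto split: if_splits)
    qed
  qed (use p in auto)
  have h23: "homotopic_loops W H2 (linepath z0 z0)"
  proof (rule homotopic_loops_linear)
    fix t :: real assume t: "t \<in> {0..1}"
    show "closed_segment (H2 t) (linepath z0 z0 t) \<subseteq> W"
    proof
      fix x assume "x \<in> closed_segment (H2 t) (linepath z0 z0 t)"
      then obtain e where e: "x = (1 - e) *\<^sub>R H2 t + e *\<^sub>R z0"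
        by (auto simp: in_segment)
      define y where "y = (1 - e) * A t + e * A 0"
      have "x = (y, y + pi / 2)"
        by (simp add: e y_def H2_def z0_def field_simps)
      then show "x \<in> W" using quarter by simp
    qed
  qed (use p in auto)
  define P where "P = (\<lambda>(a, b). (pt a, pt b))"
  have contP: "continuous_on W P"
    unfolding P_def case_prod_beta
    by (intro continuous_intros continuous_on_compose2[OF pt_continuous]) auto
  have PW: "P \<in> W \<rightarrow> phase_cylinder \<gamma>"
  proof
    fix x assume "x \<in> W"
    then obtain a b where x: "x = (a, b)" "0 < tangent_angle b - tangent_angle a"
      "tangent_angle b - tangent_angle a < pi" by (auto simp: W_def)
    then have "area_form (tang a) (tang b) > 0"
      unfolding area_tangents_pos_iff by (intro sin_gt_zero)
    then show "P x \<in> phase_cylinder \<gamma>" using x by (auto simp: P_def phase_cylinder_iff)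
  qed
  have "homotopic_loops (phase_cylinder \<gamma>) (P \<circ> H1) (P \<circ> linepath z0 z0)"
    using homotopic_loops_continuous_image[OF homotopic_loops_trans[OF h12 h23] contP PW] .
  moreover have "P \<circ> linepath z0 z0 = linepath (P z0) (P z0)" by (auto simp: linepath_refl fun_eq_iff)
  moreover have "homotopic_loops (phase_cylinder \<gamma>) F (P \<circ> H1)"
    using F props by (intro homotopic_loops_eq) (auto simp: P_def H1_def)
  ultimately show False using nc homotopic_loops_trans by metis
qed


text \<open>Since the orbit closes after \<open>q\<close> steps, the lift advances by a fixed integer over \<open>q\<close> steps, and the
rotation number \<open>1/q\<close> says that this integer is \<open>1\<close>. The polar angle lift turns it into one full
turn, and the reflection law into the vanishing of an area.\<close>

lemma periodic_polygon:
  assumes q: "q > 0"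
    and C: "invariant_curve \<gamma> C"
    and rot: "\<forall>z\<in>C. has_rotation_number \<gamma> z (1 / real q)"
    and per: "\<forall>z\<in>C. (symplectic_billiard \<gamma> ^^ q) z = z"
  shows "\<exists>\<psi>. \<psi> 0 = a \<and> (\<forall>k. \<psi> k < \<psi> (Suc k)) \<and> (\<forall>k. \<psi> (k + q) = \<psi> k + 2 * pi) \<and>
     (\<forall>k. Im (cnj (polar_deriv (\<psi> (Suc k))) * (polar (\<psi> (Suc (Suc k))) - polar (\<psi> k))) = 0) \<and>
     (\<forall>k. tangent_angle (\<psi> (Suc k)) - tangent_angle (\<psi> k) < pi)"
proof -
  obtain F where F: "essential_loop (phase_cylinder \<gamma>) F" "C = path_image F"
    and inv: "symplectic_billiard \<gamma> ` C = C"
    using C by (auto simp: invariant_curve_def)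
  have C_phase: "C \<subseteq> phase_cylinder \<gamma>" using F by (auto simp: essential_loop_def)
  obtain z where z: "z \<in> C" "fst z = pt a" using essential_loop_meets[OF F(1)] F(2) by blast
  have orbit: "(symplectic_billiard \<gamma> ^^ k) z \<in> C" for k
    by (induction k) (use z inv in auto)
  obtain \<tau> where \<tau>: "\<And>k. \<tau> k < \<tau> (Suc k)" "\<And>k. \<tau> (Suc k) < \<tau> k + 1"
    "\<And>k. (\<gamma> (\<tau> k), \<gamma> (\<tau> (Suc k))) = (symplectic_billiard \<gamma> ^^ k) z"
    and lim: "(\<lambda>k. \<tau> k / real k) \<longlonglongrightarrow> 1 / real q"
    using rot z(1) unfolding has_rotation_number_def by blast
  have "\<exists>m::int. \<tau> (k + q) = \<tau> k + m" for k
  proof -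
    have "(symplectic_billiard \<gamma> ^^ (k + q)) z = (symplectic_billiard \<gamma> ^^ k) z"
      using per z(1) by (simp add: funpow_add)
    then have "(\<gamma> (\<tau> (k + q)), \<gamma> (\<tau> (Suc (k + q)))) = (\<gamma> (\<tau> k), \<gamma> (\<tau> (Suc k)))"
      using \<tau>(3)[of "k + q"] \<tau>(3)[of k] by metis
    then have "\<gamma> (\<tau> (k + q)) = \<gamma> (\<tau> k)" by simp
    then show ?thesis by (rule gamma_eqD)
  qed
  then obtain m where m: "\<And>k. \<tau> (k + q) = \<tau> k + of_int (m k)" by metis
  \<comment> \<open>Corresponding steps of the lift are congruent modulo 1 and lie in the open unit interval.\<close>
  have m_const: "m k = m 0" for k
  proof (induction k)
    case (Suc k)
    define x where "x = (\<tau> (Suc (k + q)) - \<tau> (k + q)) - (\<tau> (Suc k) - \<tau> k)"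
    have "x = of_int (m (Suc k) - m k)" using m[of "Suc k"] m[of k] by (simp add: x_def)
    moreover have "\<bar>x\<bar> < 1" using \<tau>(1,2)[of k] \<tau>(1,2)[of "k + q"] by (simp add: x_def abs_less_iff)
    ultimately have "of_int (m (Suc k) - m k) = (0 :: real)" using integer_difference_zero by metis
    then show ?case using Suc by simp
  qed simp
  have mult: "\<tau> (j * q) = \<tau> 0 + real j * of_int (m 0)" for j
  proof (induction j)
    case (Suc j)
    then show ?case using m[of "j * q"] m_const[of "j * q"] by (simp add: algebra_simps)
  qed simp
  have "(\<lambda>j. \<tau> (Suc j * q) / real (Suc j * q)) \<longlonglongrightarrow> 1 / real q"
    by (rule LIMSEQ_subseq_LIMSEQ[OF lim, of "\<lambda>j. Suc j * q", unfolded o_def])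
       (use q in \<open>auto simp: strict_mono_def\<close>)
  moreover have "(\<lambda>j. \<tau> 0 / real q * inverse (real (Suc j)) + of_int (m 0) / real q) \<longlonglongrightarrow> \<tau> 0 / real q * 0 + of_int (m 0) / real q"
    by (intro tendsto_intros LIMSEQ_inverse_real_of_nat)
  moreover have "\<tau> (Suc j * q) / real (Suc j * q) = \<tau> 0 / real q * inverse (real (Suc j)) + of_int (m 0) / real q" for j
  proof -
    have "(t + x * m') / (x * y) = t / y * inverse x + m' / y" if "x \<noteq> 0" "y \<noteq> 0" for t x y m' :: real
      using that by (simp add: field_simps)
    then show ?thesis unfolding mult of_nat_mult using q by simp
  qed
  ultimately have "1 / real q = of_int (m 0) / real q"
    using LIMSEQ_unique by fastforce
  then have "of_int (m 0) = (1 :: real)" using q by simp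
  then have \<tau>_period: "\<tau> (k + q) = \<tau> k + 1" for k using m[of k] m_const[of k] by simp
  obtain h where h: "\<And>t. \<gamma> t = pt (h t)" "strict_mono h" "\<And>t. h (t + 1) = h t + 2 * pi"
    using polar_angle_lift by blast
  have "pt (h (\<tau> 0)) = pt a" using \<tau>(3)[of 0] z(2) h(1) by (metis fst_conv funpow_0)
  then obtain j :: int where j: "h (\<tau> 0) = a + 2 * pi * j" by (auto simp: pt_eq_iff)
  define \<psi> where "\<psi> = (\<lambda>k. h (\<tau> k) - 2 * pi * j)"
  have pt_psi: "pt (\<psi> k) = \<gamma> (\<tau> k)" for k
    using pt_int[of "h (\<tau> k) - 2 * pi * j" j] by (simp add: \<psi>_def h(1))
  have inc: "\<psi> k < \<psi> (Suc k)" for k using \<tau>(1) h(2) by (simp add: \<psi>_def strict_mono_less)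
  have inc2: "\<psi> (Suc k) < \<psi> k + 2 * pi" for k
    using strict_monoD[OF h(2) \<tau>(2)[of k]] h(3)[of "\<tau> k"] by (simp add: \<psi>_def)
  have area: "area_form (tang (\<psi> k)) (tang (\<psi> (Suc k))) > 0" for k
  proof -
    have "(pt (\<psi> k), pt (\<psi> (Suc k))) \<in> phase_cylinder \<gamma>"
      using orbit[of k] \<tau>(3)[of k] C_phase by (auto simp: pt_psi)
    then obtain b1 b2 where "pt (\<psi> k) = pt b1" "pt (\<psi> (Suc k)) = pt b2"
      "area_form (tang b1) (tang b2) > 0" by (auto simp: phase_cylinder_iff)
    then show ?thesis using tang_eq[of "\<psi> k" b1] tang_eq[of "\<psi> (Suc k)" b2] by simp
  qed
  have crit: "Im (cnj (polar_deriv (\<psi> (Suc k))) * (polar (\<psi> (Suc (Suc k))) - polar (\<psi> k))) = 0" for k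
  proof -
    have "symplectic_billiard \<gamma> (pt (\<psi> k), pt (\<psi> (Suc k))) = (pt (\<psi> (Suc k)), pt (\<psi> (Suc (Suc k))))"
      unfolding pt_psi using \<tau>(3)[of k] \<tau>(3)[of "Suc k"] by simp
    then obtain r where "pt (\<psi> (Suc (Suc k))) - pt (\<psi> k) = r *\<^sub>R tang (\<psi> (Suc k))"
      using symplectic_billiard_step[OF area[of k]] by auto
    then have "area_form (tang (\<psi> (Suc k))) (pt (\<psi> (Suc (Suc k))) - pt (\<psi> k)) = 0"
      by (simp add: area_form.scaleR_right)
    then show ?thesis
      unfolding tang_def pt_def frame_point_diff area_form_frame_vec by simp
  qed
  have "\<psi> 0 = a" using j by (simp add: \<psi>_def)
  moreover have "\<psi> (k + q) = \<psi> k + 2 * pi" for k by (simp add: \<psi>_def \<tau>_period h(3))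
  ultimately show ?thesis
    using inc crit tangent_angle_gap(2)[OF area inc inc2] by blast
qed

end

section \<open>Critical polygons in a nearly circular domain\<close>

lemma sin_concave: "concave_on {0..pi} sin"
  by (rule f''_le0_imp_concave[where f' = cos and f'' = "\<lambda>x. - sin x"])
     (auto intro!: derivative_eq_intros sin_ge_zero)

lemma sin_lower_third:
  assumes "0 \<le> x" "x \<le> 2 * pi / 3" shows "x / 3 \<le> sin x"
proof -
  have conc: "concave_on {0..2 * pi / 3} sin"
    using sin_concave unfolding concave_on_def by (rule convex_on_subset) auto
  have s: "sin (2 * pi / 3) = sqrt 3 / 2" using sin_120 by simp
  have "(3 / 2 :: real) \<le> sqrt 3" by (rule real_le_rsqrt) (simp add: power2_eq_square)
  have "pi < 3.2" using pi_less_4 pi_approx by simp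
  have "sin x \<ge> (sin (2 * pi / 3) - sin 0) / (2 * pi / 3 - 0) * (x - 0) + sin 0"
    using assms by (intro concave_onD_Icc'[OF conc]) auto
  also have "(sin (2 * pi / 3) - sin 0) / (2 * pi / 3 - 0) * (x - 0) + sin 0 = (3 * sqrt 3 / (4 * pi)) * x"
    by (simp only: s) (simp add: field_simps)
  finally have "sin x \<ge> (3 * sqrt 3 / (4 * pi)) * x" .
  moreover have "(3 * sqrt 3 / (4 * pi)) \<ge> 1 / 3"
    using \<open>(3 / 2 :: real) \<le> sqrt 3\<close> \<open>pi < 3.2\<close> by (simp add: field_simps)
  ultimately show ?thesis using assms(1) mult_right_mono[of "1 / 3" "3 * sqrt 3 / (4 * pi)" x] by simp
qed

lemma sin_lower_interval:
  fixes q :: nat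
  assumes "q \<ge> 3" "pi / q \<le> x" "x \<le> 11 * pi / 12" shows "1 / (4 * q) \<le> sin x"
proof -
  have "concave_on {pi / q..11 * pi / 12} sin"
    using sin_concave unfolding concave_on_def by (rule convex_on_subset) auto
  then have "min (sin (pi / q)) (sin (11 * pi / 12)) \<le> sin x"
    using assms by (intro concave_on_ge_min) auto
  moreover have "1 / (4 * q) \<le> sin (pi / q)"
  proof -
    have "pi / q \<le> 2 * pi / 3" using assms(1) by (simp add: field_simps)
    then have "(pi / q) / 3 \<le> sin (pi / q)" by (intro sin_lower_third) auto
    moreover have "1 / (4 * q) \<le> (pi / q) / 3" using assms(1) pi_gt3 by (simp add: field_simps)
    ultimately show ?thesis by simp
  qed
  moreover have "1 / (4 * q) \<le> sin (11 * pi / 12)"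
  proof -
    have "sin (11 * pi / 12) = sin (pi - pi / 12)" by simp
    also have "\<dots> = sin (pi / 12)" by (rule sin_pi_minus)
    finally have "sin (11 * pi / 12) = sin (pi / 12)" .
    moreover have "(pi / 12) / 3 \<le> sin (pi / 12)" by (intro sin_lower_third) auto
    moreover have "1 / (4 * q) \<le> (pi / 12) / 3"
    proof -
      have "1 / (4 * real q) \<le> 1 / (4 * 3)" using assms(1) by (intro divide_left_mono) auto
      then show ?thesis using pi_gt3 by simp
    qed
    ultimately show ?thesis by linarith
  qed
  ultimately show ?thesis by linarith
qed

text \<open>On the range of possible steps, the cosine determines the step near the regular one. The factor \<open>q\<close>
is lost because the slope of the cosine at \<open>2\<pi>/q\<close> is of order \<open>1/q\<close>.\<close>

lemma cos_gap:
  fixes q :: nat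
  assumes q: "q \<ge> 3" and d: "0 < d" "d \<le> pi + 1 / 10"
  shows "\<bar>d - 2 * pi / q\<bar> \<le> 12 * real q * \<bar>cos d - cos (2 * pi / q)\<bar>"
proof -
  define b where "b = 2 * pi / q"
  have b: "0 < b" "b \<le> 2 * pi / 3" using q by (auto simp: b_def field_simps)
  have "sin ((d + b) / 2) \<ge> 1 / (4 * q)"
  proof (rule sin_lower_interval[OF q])
    have "pi / q = b / 2" by (simp add: b_def)
    then show "pi / q \<le> (d + b) / 2" using d by simp
    show "(d + b) / 2 \<le> 11 * pi / 12" using d b pi_gt3 by simp
  qed
  moreover have "sin (\<bar>d - b\<bar> / 2) \<ge> (\<bar>d - b\<bar> / 2) / 3"
  proof (rule sin_lower_third)
    have "\<bar>d - b\<bar> \<le> pi + 1 / 10" using d b pi_gt3 by linarith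
    then show "\<bar>d - b\<bar> / 2 \<le> 2 * pi / 3" using pi_gt3 by simp
  qed simp
  ultimately have "1 / (4 * q) * ((\<bar>d - b\<bar> / 2) / 3) \<le> sin ((d + b) / 2) * sin (\<bar>d - b\<bar> / 2)"
    using q by (intro mult_mono') auto
  also have "\<dots> \<le> \<bar>sin ((d + b) / 2) * sin ((d - b) / 2)\<bar>"
    by (cases "d \<ge> b") (auto simp: abs_mult sin_diff abs_if algebra_simps diff_divide_distrib)
  also have "\<dots> = \<bar>cos d - cos b\<bar> / 2"
  proof -
    have "cos d - cos b = 2 * sin ((d + b) / 2) * sin ((b - d) / 2)" by (rule cos_diff_cos)
    moreover have "sin ((b - d) / 2) = - sin ((d - b) / 2)"
      by (metis minus_diff_eq minus_divide_left sin_minus)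
    ultimately show ?thesis by (simp add: abs_mult)
  qed
  finally show ?thesis using q by (simp add: b_def field_simps)
qed

lemma abs_sin_diff_le: "\<bar>sin x - sin y\<bar> \<le> \<bar>x - y :: real\<bar>"
  using field_differentiable_bound[of UNIV sin cos 1 x y] by (auto intro!: derivative_eq_intros)

lemma abs_mult_le: "\<bar>x\<bar> \<le> a \<Longrightarrow> \<bar>y\<bar> \<le> b \<Longrightarrow> \<bar>x * y :: real\<bar> \<le> a * b"
  by (simp add: abs_mult mult_mono')

text \<open>The critical equation at a vertex says that the cosines of the two adjacent steps differ by \<open>O(\<epsilon>)\<close>.
Going around the polygon, all cosines agree up to \<open>O(q \<epsilon>)\<close>. The steps average to \<open>2\<pi>/q\<close>, so some of
them are at most and some at least \<open>2\<pi>/q\<close>, which pins the common cosine.\<close>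

lemma nearly_regular_polygon:
  fixes \<rho> \<rho>' :: "real \<Rightarrow> real" and \<psi> :: "nat \<Rightarrow> real" and q :: nat and \<epsilon> :: real
  assumes q: "q \<ge> 3" and \<epsilon>: "0 \<le> \<epsilon>" "\<epsilon> \<le> 1 / 100"
    and \<rho>: "\<And>x. \<bar>\<rho> x - 1\<bar> \<le> \<epsilon>" and \<rho>': "\<And>x. \<bar>\<rho>' x\<bar> \<le> \<epsilon>"
    and inc: "\<And>k. \<psi> k < \<psi> (Suc k)" and per: "\<And>k. \<psi> (k + q) = \<psi> k + 2 * pi"
    and crit: "\<And>k. \<rho> (\<psi> (Suc (Suc k))) * (\<rho>' (\<psi> (Suc k)) * sin (\<psi> (Suc (Suc k)) - \<psi> (Suc k))
          - \<rho> (\<psi> (Suc k)) * cos (\<psi> (Suc (Suc k)) - \<psi> (Suc k)))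
        + \<rho> (\<psi> k) * (\<rho>' (\<psi> (Suc k)) * sin (\<psi> (Suc k) - \<psi> k)
          + \<rho> (\<psi> (Suc k)) * cos (\<psi> (Suc k) - \<psi> k)) = 0"
    and gap: "\<And>k. \<psi> (Suc k) - \<psi> k \<le> pi + 1 / 10"
  shows "\<bar>\<psi> (Suc k) - \<psi> k - 2 * pi / q\<bar> \<le> 108 * (real q)\<^sup>2 * \<epsilon>"
proof -
  define d where "d = (\<lambda>k. \<psi> (Suc k) - \<psi> k)"
  define \<beta> where "\<beta> = 2 * pi / q"
  have d: "0 < d k" "d k \<le> pi + 1 / 10" for k using inc gap by (auto simp: d_def)
  have dper: "d (k + q) = d k" for k using per[of k] per[of "Suc k"] by (simp add: d_def)
  have step: "\<bar>cos (d (Suc k)) - cos (d k)\<bar> \<le> 9 * \<epsilon>" for k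
  proof -
    define A B C B' where "A = \<rho> (\<psi> k)" and "B = \<rho> (\<psi> (Suc k))" and "C = \<rho> (\<psi> (Suc (Suc k)))"
      and "B' = \<rho>' (\<psi> (Suc k))"
    define s1 c1 s2 c2 where "s1 = sin (d k)" and "c1 = cos (d k)" and "s2 = sin (d (Suc k))"
      and "c2 = cos (d (Suc k))"
    have ABC: "\<bar>A - 1\<bar> \<le> \<epsilon>" "\<bar>B - 1\<bar> \<le> \<epsilon>" "\<bar>C - 1\<bar> \<le> \<epsilon>" "\<bar>B'\<bar> \<le> \<epsilon>"
      using \<rho> \<rho>' by (auto simp: A_def B_def C_def B'_def)
    have "C * (B' * s2 - B * c2) + A * (B' * s1 + B * c1) = 0"
      using crit[of k] by (simp add: A_def B_def C_def B'_def s1_def c1_def s2_def c2_def d_def)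
    then have eq: "c2 - c1 = B' * (C * s2 + A * s1) + (1 - B * C) * c2 - (1 - B * A) * c1"
      by (simp add: algebra_simps)
    have tri: "\<bar>s1\<bar> \<le> 1" "\<bar>c1\<bar> \<le> 1" "\<bar>s2\<bar> \<le> 1" "\<bar>c2\<bar> \<le> 1"
      by (auto simp: s1_def c1_def s2_def c2_def)
    have near: "\<bar>1 - X * Y\<bar> \<le> 3 * \<epsilon>" if "\<bar>X - 1\<bar> \<le> \<epsilon>" "\<bar>Y - 1\<bar> \<le> \<epsilon>" for X Y
    proof -
      have "1 - X * Y = - ((X - 1) + (Y - 1) + (X - 1) * (Y - 1))" by (simp add: algebra_simps)
      moreover have "\<bar>(X - 1) * (Y - 1)\<bar> \<le> \<epsilon> * 1"
        using that \<epsilon> by (intro abs_mult_le) auto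
      ultimately show ?thesis using that by linarith
    qed
    have "\<bar>A\<bar> \<le> 3 / 2" "\<bar>C\<bar> \<le> 3 / 2" using ABC \<epsilon> by linarith+
    then have "\<bar>C * s2\<bar> \<le> (3 / 2) * 1" "\<bar>A * s1\<bar> \<le> (3 / 2) * 1"
      using tri by (simp_all only: abs_mult_le)
    then have "\<bar>C * s2 + A * s1\<bar> \<le> 3" by linarith
    then have "\<bar>B' * (C * s2 + A * s1)\<bar> \<le> \<epsilon> * 3"
      using ABC \<epsilon> by (intro abs_mult_le) auto
    moreover have "\<bar>(1 - B * C) * c2\<bar> \<le> (3 * \<epsilon>) * 1" "\<bar>(1 - B * A) * c1\<bar> \<le> (3 * \<epsilon>) * 1"
      using abs_mult_le[OF near[OF ABC(2,3)] tri(4)] abs_mult_le[OF near[OF ABC(2,1)] tri(2)] by simp_all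
    ultimately have "\<bar>c2 - c1\<bar> \<le> 9 * \<epsilon>" using eq by linarith
    then show ?thesis by (simp add: c1_def c2_def)
  qed
  have chain: "\<bar>cos (d (k + j)) - cos (d k)\<bar> \<le> 9 * real j * \<epsilon>" for k j
  proof (induction j)
    case (Suc j)
    have "\<bar>cos (d (Suc (k + j))) - cos (d (k + j))\<bar> \<le> 9 * \<epsilon>" by (rule step)
    then have "\<bar>cos (d (Suc (k + j))) - cos (d k)\<bar> \<le> 9 * real j * \<epsilon> + 9 * \<epsilon>" using Suc by linarith
    then show ?case by (simp add: algebra_simps)
  qed simp
  have reduce: "d k = d (k mod q)" for k
  proof -
    have "d (j + i * q) = d j" for i j
    proof (induction i)
      case (Suc i)
      then show ?case using dper[of "j + i * q"] by (simp add: algebra_simps)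
    qed simp
    from this[of "k mod q" "k div q"] show ?thesis by (simp add: mult.commute)
  qed
  have close': "\<bar>cos (d i) - cos (d k)\<bar> \<le> 9 * real q * \<epsilon>" if "i < q" "k < q" "k \<le> i" for i k
  proof -
    have "\<bar>cos (d (k + (i - k))) - cos (d k)\<bar> \<le> 9 * real (i - k) * \<epsilon>" using chain[of k "i - k"] by simp
    also have "\<dots> \<le> 9 * real q * \<epsilon>" using that \<epsilon> by (intro mult_right_mono mult_left_mono) auto
    finally show ?thesis using that by simp
  qed
  have close: "\<bar>cos (d i) - cos (d k)\<bar> \<le> 9 * real q * \<epsilon>" for i k
  proof -
    have "i mod q < q" "k mod q < q" using q by auto
    then have "\<bar>cos (d (i mod q)) - cos (d (k mod q))\<bar> \<le> 9 * real q * \<epsilon>"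
      using close'[of "i mod q" "k mod q"] close'[of "k mod q" "i mod q"]
      by (cases "k mod q \<le> i mod q") (auto simp: abs_minus_commute)
    then show ?thesis by (simp flip: reduce)
  qed
  have total: "(\<Sum>k<q. d k) = 2 * pi"
    unfolding d_def using sum_lessThan_telescope[of \<psi> q] per[of 0] by simp
  have totalb: "(\<Sum>k<q. \<beta>) = 2 * pi" using q by (simp add: \<beta>_def)
  have "\<exists>i<q. d i \<le> \<beta>"
  proof (rule ccontr)
    assume "\<not> ?thesis"
    then have "(\<Sum>k<q. \<beta>) < (\<Sum>k<q. d k)" using q by (intro sum_strict_mono) (auto simp: lessThan_empty_iff)
    then show False using total totalb by simp
  qed
  then obtain i where i: "d i \<le> \<beta>" by blast
  have "\<exists>i<q. d i \<ge> \<beta>"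
  proof (rule ccontr)
    assume "\<not> ?thesis"
    then have "(\<Sum>k<q. d k) < (\<Sum>k<q. \<beta>)" using q by (intro sum_strict_mono) (auto simp: lessThan_empty_iff)
    then show False using total totalb by simp
  qed
  then obtain j where j: "d j \<ge> \<beta>" by blast
  have b: "0 < \<beta>" "\<beta> \<le> 2 * pi / 3" using q by (auto simp: \<beta>_def field_simps)
  \<comment> \<open>The cosine decreases only up to \<open>\<pi>\<close>, so a step slightly longer than \<open>\<pi>\<close> is reflected.\<close>
  have mono: "cos y \<le> cos x" if "0 \<le> x" "x \<le> y" "x \<le> 2 * pi / 3" "y \<le> pi + 1 / 10" for x y
  proof (cases "y \<le> pi")
    case True
    then show ?thesis using that by (intro cos_monotone_0_pi_le) auto
  next
    case False
    have "cos (2 * pi - y) \<le> cos x" using that False pi_gt3 by (intro cos_monotone_0_pi_le) auto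
    then show ?thesis by (simp add: cos_diff)
  qed
  have "\<bar>cos (d k) - cos \<beta>\<bar> \<le> 9 * real q * \<epsilon>"
  proof (cases "d k \<ge> \<beta>")
    case True
    have "cos (d k) \<le> cos \<beta>" using True b d[of k] by (intro mono) auto
    moreover have "cos \<beta> \<le> cos (d i)" using i b d[of i] by (intro mono) auto
    ultimately show ?thesis using close[of i k] by linarith
  next
    case False
    have "cos \<beta> \<le> cos (d k)" using False b d[of k] by (intro mono) auto
    moreover have "cos (d j) \<le> cos \<beta>" using j b d[of j] by (intro mono) auto
    ultimately show ?thesis using close[of k j] by linarith
  qed
  then have "12 * real q * \<bar>cos (d k) - cos \<beta>\<bar> \<le> 12 * real q * (9 * real q * \<epsilon>)" by (intro mult_left_mono) auto
  then have "\<bar>d k - \<beta>\<bar> \<le> 12 * real q * (9 * real q * \<epsilon>)"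
    using cos_gap[OF q d] unfolding \<beta>_def by (rule order.trans[rotated])
  then show ?thesis by (simp add: d_def \<beta>_def power2_eq_square mult_ac)
qed

text \<open>When the critical equations are added over all vertices, the terms without \<open>\<rho>'\<close> telescope. What
remains is the derivative of the action under a common rotation of the vertices. It is linear in
\<open>\<rho>'\<close>, so replacing the radii by \<open>1\<close> and the polygon by the regular one costs only \<open>O(\<epsilon>\<^sup>2)\<close>.\<close>

lemma polygon_sum_estimate:
  fixes \<rho> \<rho>' \<rho>'' :: "real \<Rightarrow> real" and \<psi> :: "nat \<Rightarrow> real" and q :: nat and \<epsilon> :: real
  assumes q: "q \<ge> 3" and \<epsilon>: "0 \<le> \<epsilon>" "\<epsilon> \<le> 1 / 100"
    and \<rho>: "\<And>x. \<bar>\<rho> x - 1\<bar> \<le> \<epsilon>" and \<rho>': "\<And>x. \<bar>\<rho>' x\<bar> \<le> \<epsilon>" and \<rho>'': "\<And>x. \<bar>\<rho>'' x\<bar> \<le> \<epsilon>"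
    and deriv: "\<And>x. (\<rho>' has_real_derivative \<rho>'' x) (at x)"
    and \<rho>_per: "\<And>x. \<rho> (x + 2 * pi) = \<rho> x" and \<rho>'_per: "\<And>x. \<rho>' (x + 2 * pi) = \<rho>' x"
    and inc: "\<And>k. \<psi> k < \<psi> (Suc k)" and per: "\<And>k. \<psi> (k + q) = \<psi> k + 2 * pi"
    and crit: "\<And>k. \<rho> (\<psi> (Suc (Suc k))) * (\<rho>' (\<psi> (Suc k)) * sin (\<psi> (Suc (Suc k)) - \<psi> (Suc k))
          - \<rho> (\<psi> (Suc k)) * cos (\<psi> (Suc (Suc k)) - \<psi> (Suc k)))
        + \<rho> (\<psi> k) * (\<rho>' (\<psi> (Suc k)) * sin (\<psi> (Suc k) - \<psi> k)
          + \<rho> (\<psi> (Suc k)) * cos (\<psi> (Suc k) - \<psi> k)) = 0"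
    and gap: "\<And>k. \<psi> (Suc k) - \<psi> k \<le> pi + 1 / 10"
  shows "\<bar>\<Sum>k<q. \<rho>' (\<psi> 0 + 2 * pi * k / q)\<bar> \<le> 200 * real q ^ 4 * \<epsilon>\<^sup>2"
proof -
  define \<beta> where "\<beta> = 2 * pi / q"
  define R where "R = (\<lambda>k. \<rho> (\<psi> k))"
  define D where "D = (\<lambda>k. \<rho>' (\<psi> k))"
  define S where "S = (\<lambda>k. sin (\<psi> (Suc k) - \<psi> k))"
  define T where "T = (\<lambda>k. R k * R (Suc k) * cos (\<psi> (Suc k) - \<psi> k))"
  have reg: "\<bar>\<psi> (Suc k) - \<psi> k - \<beta>\<bar> \<le> 108 * (real q)\<^sup>2 * \<epsilon>" for k
    unfolding \<beta>_def by (rule nearly_regular_polygon[OF q \<epsilon> \<rho> \<rho>' inc per crit gap])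
  have perR: "R (k + q) = R k" and perD: "D (k + q) = D k" and perS: "S (k + q) = S k"
    and perT: "T (k + q) = T k" for k
    using per[of k] per[of "Suc k"] by (simp_all add: R_def D_def S_def T_def \<rho>_per \<rho>'_per)
  have shift: "(\<Sum>k<q. F (Suc k)) = (\<Sum>k<q. F k)" if "\<And>k. F (k + q) = F k" for F :: "nat \<Rightarrow> real"
    using sum_lessThan_telescope[of F q] that[of 0] by (simp add: sum_subtractf)
  have "D (Suc k) * (R (Suc (Suc k)) * S (Suc k)) + D (Suc k) * (R k * S k) = T (Suc k) - T k" for k
    using crit[of k] by (simp add: D_def R_def S_def T_def algebra_simps)
  then have "(\<Sum>k<q. D (Suc k) * (R (Suc (Suc k)) * S (Suc k)) + D (Suc k) * (R k * S k))
      = (\<Sum>k<q. T (Suc k) - T k)" by simp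
  also have "\<dots> = 0" using sum_lessThan_telescope[of T q] perT[of 0] by simp
  finally have "(\<Sum>k<q. D (Suc k) * (R (Suc (Suc k)) * S (Suc k))) + (\<Sum>k<q. D (Suc k) * (R k * S k)) = 0"
    by (simp add: sum.distrib)
  moreover have "(\<Sum>k<q. D (Suc k) * (R (Suc (Suc k)) * S (Suc k))) = (\<Sum>k<q. D k * (R (Suc k) * S k))"
    using perD perR perS perR[of "Suc _"] by (intro shift[of "\<lambda>k. D k * (R (Suc k) * S k)"]) simp
  ultimately have zero: "(\<Sum>k<q. (D k * R (Suc k) + R k * D (Suc k)) * S k) = 0"
    by (simp add: sum.distrib algebra_simps)
  have q1: "1 \<le> real q ^ 2" using q by (simp add: one_le_power)
  have err: "\<bar>(D k * R (Suc k) + R k * D (Suc k)) * S k - (D k + D (Suc k)) * sin \<beta>\<bar> \<le> 218 * (real q)\<^sup>2 * \<epsilon>\<^sup>2" for k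
  proof -
    have bnd: "\<bar>D k\<bar> \<le> \<epsilon>" "\<bar>D (Suc k)\<bar> \<le> \<epsilon>" "\<bar>R k - 1\<bar> \<le> \<epsilon>" "\<bar>R (Suc k) - 1\<bar> \<le> \<epsilon>" "\<bar>S k\<bar> \<le> 1"
      using \<rho> \<rho>' by (auto simp: D_def R_def S_def)
    have "\<bar>S k - sin \<beta>\<bar> \<le> \<bar>(\<psi> (Suc k) - \<psi> k) - \<beta>\<bar>"
      unfolding S_def by (rule abs_sin_diff_le)
    then have sb: "\<bar>S k - sin \<beta>\<bar> \<le> 108 * (real q)\<^sup>2 * \<epsilon>" using reg[of k] by linarith
    have "\<bar>D k * (R (Suc k) - 1)\<bar> \<le> \<epsilon> * \<epsilon>" "\<bar>D (Suc k) * (R k - 1)\<bar> \<le> \<epsilon> * \<epsilon>"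
      using bnd by (auto intro!: abs_mult_le)
    then have "\<bar>D k * (R (Suc k) - 1) + D (Suc k) * (R k - 1)\<bar> \<le> 2 * \<epsilon>\<^sup>2"
      by (simp add: power2_eq_square)
    then have "\<bar>(D k * (R (Suc k) - 1) + D (Suc k) * (R k - 1)) * S k\<bar> \<le> (2 * \<epsilon>\<^sup>2) * 1"
      using bnd by (intro abs_mult_le) auto
    moreover have "\<bar>(D k + D (Suc k)) * (S k - sin \<beta>)\<bar> \<le> (2 * \<epsilon>) * (108 * (real q)\<^sup>2 * \<epsilon>)"
      using bnd sb by (intro abs_mult_le) auto
    moreover have "(D k * R (Suc k) + R k * D (Suc k)) * S k - (D k + D (Suc k)) * sin \<beta>
       = (D k * (R (Suc k) - 1) + D (Suc k) * (R k - 1)) * S k + (D k + D (Suc k)) * (S k - sin \<beta>)"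
      by (simp add: algebra_simps)
    ultimately have "\<bar>(D k * R (Suc k) + R k * D (Suc k)) * S k - (D k + D (Suc k)) * sin \<beta>\<bar>
       \<le> 2 * \<epsilon>\<^sup>2 * 1 + (2 * \<epsilon>) * (108 * (real q)\<^sup>2 * \<epsilon>)" by linarith
    also have "\<dots> \<le> 2 * \<epsilon>\<^sup>2 * (real q)\<^sup>2 + (2 * \<epsilon>) * (108 * (real q)\<^sup>2 * \<epsilon>)"
      using q1 by (intro add_right_mono mult_left_mono) auto
    also have "\<dots> = 218 * (real q)\<^sup>2 * \<epsilon>\<^sup>2" by (simp add: power2_eq_square)
    finally show ?thesis .
  qed
  have "(\<Sum>k<q. D (Suc k)) = (\<Sum>k<q. D k)" using perD by (intro shift[of D])
  then have "(\<Sum>k<q. (D k + D (Suc k)) * sin \<beta>) = 2 * sin \<beta> * (\<Sum>k<q. D k)"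
    by (simp add: sum.distrib flip: sum_distrib_right)
  then have "2 * sin \<beta> * (\<Sum>k<q. D k) =
     - (\<Sum>k<q. (D k * R (Suc k) + R k * D (Suc k)) * S k - (D k + D (Suc k)) * sin \<beta>)"
    using zero by (simp add: sum_subtractf)
  also have "\<bar>\<dots>\<bar> \<le> (\<Sum>k<q. 218 * (real q)\<^sup>2 * \<epsilon>\<^sup>2)"
    unfolding abs_minus_cancel by (intro order.trans[OF sum_abs] sum_mono err)
  finally have main: "\<bar>2 * sin \<beta> * (\<Sum>k<q. D k)\<bar> \<le> 218 * real q ^ 3 * \<epsilon>\<^sup>2"
    by (simp add: power2_eq_square power3_eq_cube mult_ac)
  have sb: "sin \<beta> \<ge> 2 / q"
  proof -
    have "\<beta> / 3 \<le> sin \<beta>" using q by (intro sin_lower_third) (auto simp: \<beta>_def field_simps)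
    moreover have "2 / q \<le> \<beta> / 3" using q pi_gt3 by (simp add: \<beta>_def field_simps)
    ultimately show ?thesis by simp
  qed
  have "(4 / q) * \<bar>\<Sum>k<q. D k\<bar> \<le> (2 * sin \<beta>) * \<bar>\<Sum>k<q. D k\<bar>" using sb by (intro mult_right_mono) auto
  also have "\<dots> = \<bar>2 * sin \<beta> * (\<Sum>k<q. D k)\<bar>"
  proof -
    have "0 \<le> sin \<beta>" using sb q by (intro order.trans[OF _ sb]) auto
    then show ?thesis by (simp add: abs_mult)
  qed
  finally have "(4 / q) * \<bar>\<Sum>k<q. D k\<bar> \<le> 218 * real q ^ 3 * \<epsilon>\<^sup>2" using main by linarith
  then have "4 * \<bar>\<Sum>k<q. D k\<bar> \<le> 218 * real q ^ 3 * \<epsilon>\<^sup>2 * q" using q by (simp add: field_simps)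
  also have "\<dots> = 218 * real q ^ 4 * \<epsilon>\<^sup>2" by (simp add: power_numeral_reduce)
  finally have sumD: "\<bar>\<Sum>k<q. D k\<bar> \<le> 55 * real q ^ 4 * \<epsilon>\<^sup>2" by (simp add: mult_ac) 
  have pos: "\<bar>\<psi> k - (\<psi> 0 + 2 * pi * k / q)\<bar> \<le> real k * (108 * (real q)\<^sup>2 * \<epsilon>)" for k
  proof (induction k)
    case (Suc k)
    have "\<psi> (Suc k) - (\<psi> 0 + 2 * pi * Suc k / q)
       = (\<psi> k - (\<psi> 0 + 2 * pi * k / q)) + (\<psi> (Suc k) - \<psi> k - \<beta>)"
      by (simp add: \<beta>_def add_divide_distrib algebra_simps)
    then show ?case using Suc reg[of k] by (simp add: algebra_simps)
  qed simp
  have lip: "\<bar>\<rho>' x - \<rho>' y\<bar> \<le> \<epsilon> * \<bar>x - y\<bar>" for x y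
    using field_differentiable_bound[of UNIV \<rho>' \<rho>'' \<epsilon> x y] deriv \<rho>''
    by (auto simp: has_field_derivative_at_within)
  have each: "\<bar>\<rho>' (\<psi> 0 + 2 * pi * k / q) - D k\<bar> \<le> 108 * real q ^ 3 * \<epsilon>\<^sup>2" if "k < q" for k
  proof -
    have "\<bar>\<psi> 0 + 2 * pi * k / q - \<psi> k\<bar> \<le> real k * (108 * (real q)\<^sup>2 * \<epsilon>)"
      using pos[of k] by (simp add: abs_minus_commute)
    also have "\<dots> \<le> real q * (108 * (real q)\<^sup>2 * \<epsilon>)" using that \<epsilon> by (intro mult_right_mono) auto
    finally have "\<epsilon> * \<bar>\<psi> 0 + 2 * pi * k / q - \<psi> k\<bar> \<le> \<epsilon> * (real q * (108 * (real q)\<^sup>2 * \<epsilon>))"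
      using \<epsilon> by (intro mult_left_mono) auto
    then show ?thesis
      using lip[of "\<psi> 0 + 2 * pi * k / q" "\<psi> k"] unfolding D_def
      by (simp add: power2_eq_square power3_eq_cube mult_ac)
  qed
  have "\<bar>(\<Sum>k<q. \<rho>' (\<psi> 0 + 2 * pi * k / q)) - (\<Sum>k<q. D k)\<bar> \<le> (\<Sum>k<q. 108 * real q ^ 3 * \<epsilon>\<^sup>2)"
    unfolding sum_subtractf[symmetric] using each by (intro order.trans[OF sum_abs] sum_mono) auto
  also have "\<dots> = 108 * real q ^ 4 * \<epsilon>\<^sup>2" by (simp add: power_numeral_reduce)
  finally have "\<bar>\<Sum>k<q. \<rho>' (\<psi> 0 + 2 * pi * k / q)\<bar> \<le> 163 * (real q ^ 4 * \<epsilon>\<^sup>2)"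
    using sumD by linarith
  also have "\<dots> \<le> 200 * (real q ^ 4 * \<epsilon>\<^sup>2)" by (intro mult_right_mono) auto
  finally show ?thesis by (simp add: mult.assoc)
qed

section \<open>Fourier coefficients of periodic functions\<close>

lemma continuous_antiderivative:
  fixes g :: "real \<Rightarrow> real"
  assumes "continuous_on UNIV g"
  shows "\<exists>G. \<forall>x. (G has_real_derivative g x) (at x)"
proof -
  have "\<exists>G. \<forall>x :: real. - \<infinity> < ereal x \<longrightarrow> ereal x < \<infinity> \<longrightarrow> (G has_vector_derivative g x) (at x)"
    using assms by (intro einterval_antiderivative) (auto simp: continuous_on_eq_continuous_at)
  then show ?thesis by (simp add: has_real_derivative_iff_has_vector_derivative)
qed

lemma integral_real_FTC:
  fixes g :: "real \<Rightarrow> real"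
  assumes "a \<le> b" "\<And>x. (G has_real_derivative g x) (at x)"
  shows "integral {a..b} g = G b - G a"
proof -
  have "(g has_integral (G b - G a)) {a..b}"
    using assms by (intro fundamental_theorem_of_calculus)
      (auto simp: has_real_derivative_iff_has_vector_derivative has_vector_derivative_at_within)
  then show ?thesis by (rule integral_unique)
qed

lemma integral_periodic_shift:
  fixes g :: "real \<Rightarrow> real"
  assumes cont: "continuous_on UNIV g" and per: "\<And>x. g (x + p) = g x" and p: "p \<ge> 0"
  shows "integral {a..a + p} g = integral {0..p} g" "integral {0..p} (\<lambda>x. g (x + c)) = integral {0..p} g"
proof -
  obtain G where G: "\<And>x. (G has_real_derivative g x) (at x)" using continuous_antiderivative[OF cont] by blast
  have shift: "((\<lambda>x. G (x + y)) has_real_derivative g (x + y)) (at x)" for y x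
    using G[of "x + y"] by (simp add: DERIV_shift)
  have "((\<lambda>x. G (x + p) - G x) has_real_derivative 0) (at x)" for x
    using DERIV_diff[OF shift[of p x] G[of x]] by (simp add: per)
  then have const: "G (x + p) - G x = G (0 + p) - G 0" for x
    by (rule DERIV_isconst_all[rule_format])
  have "integral {a..a + p} g = G (a + p) - G a" by (rule integral_real_FTC[OF _ G]) (use p in simp)
  moreover have "integral {0..p} g = G p - G 0" by (rule integral_real_FTC[OF p G])
  moreover have "integral {0..p} (\<lambda>x. g (x + c)) = G (p + c) - G (0 + c)"
    by (rule integral_real_FTC[OF p shift])
  ultimately show "integral {a..a + p} g = integral {0..p} g"
    "integral {0..p} (\<lambda>x. g (x + c)) = integral {0..p} g"
    using const[of a] const[of c] by (simp_all add: add.commute)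
qed

lemma cont_integrable: "continuous_on UNIV (g :: real \<Rightarrow> real) \<Longrightarrow> g integrable_on {a..b}"
  by (rule integrable_continuous_interval) (rule continuous_on_subset, auto)

lemma abs_integral_le:
  fixes g :: "real \<Rightarrow> real"
  assumes "continuous_on UNIV g" "a \<le> b" "\<And>x. x \<in> {a..b} \<Longrightarrow> \<bar>g x\<bar> \<le> B"
  shows "\<bar>integral {a..b} g\<bar> \<le> B * (b - a)"
proof -
  have "norm (integral {a..b} g) \<le> B * (b - a)"
    using assms by (intro integral_bound) (auto intro: continuous_on_subset)
  then show ?thesis by simp
qed

text \<open>The kernel with weights \<open>1 - \<bar>k\<bar>/N\<close>, written out as a double sum. In this form it is a square
(\<open>fejer_cis\<close>), and its integral against \<open>f\<close> is a sum of Fourier coefficients of \<open>f\<close>.\<close>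

definition fejer :: "nat \<Rightarrow> real \<Rightarrow> real" where
  "fejer N u = (\<Sum>j<N. \<Sum>l<N. cos ((real j - real l) * u)) / N"

lemma fejer_cis: "fejer N u = (cmod (\<Sum>j<N. cis u ^ j))\<^sup>2 / N"
proof -
  have "cis u ^ j = cis (real j * u)" for j by (rule Complex.DeMoivre)
  then have "(cmod (\<Sum>j<N. cis u ^ j))\<^sup>2 = (\<Sum>j<N. cos (real j * u))\<^sup>2 + (\<Sum>j<N. sin (real j * u))\<^sup>2"
    by (simp add: cmod_power2)
  also have "\<dots> = (\<Sum>j<N. \<Sum>l<N. cos (real j * u) * cos (real l * u) + sin (real j * u) * sin (real l * u))"
    by (simp add: power2_eq_square sum_product sum.distrib)
  also have "\<dots> = (\<Sum>j<N. \<Sum>l<N. cos ((real j - real l) * u))"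
    by (simp add: left_diff_distrib cos_diff)
  finally show ?thesis by (simp add: fejer_def)
qed

lemma fejer_nonneg: "0 \<le> fejer N u"
  by (simp add: fejer_cis)

lemma fejer_decay:
  assumes u: "0 < \<bar>u\<bar>" "\<bar>u\<bar> \<le> pi" shows "fejer N u \<le> 36 / (N * u\<^sup>2)"
proof -
  have "\<bar>u\<bar> / 6 \<le> sin (\<bar>u\<bar> / 2)" using sin_lower_third[of "\<bar>u\<bar> / 2"] u by simp
  also have "\<dots> \<le> \<bar>sin (u / 2)\<bar>" by (cases "u \<ge> 0") auto
  finally have s: "\<bar>u\<bar> / 6 \<le> \<bar>sin (u / 2)\<bar>" .
  have "(cmod (cis u - 1))\<^sup>2 = 2 - 2 * cos u"
    using sin_cos_squared_add[of u] unfolding cmod_power2 by (simp add: power2_eq_square algebra_simps)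
  also have "cos u = 1 - 2 * (sin (u / 2))\<^sup>2" using cos_double_sin[of "u / 2"] by simp
  finally have "(cmod (cis u - 1))\<^sup>2 = (2 * \<bar>sin (u / 2)\<bar>)\<^sup>2" by (simp add: power_mult_distrib)
  then have z1: "cmod (cis u - 1) = 2 * \<bar>sin (u / 2)\<bar>"
    by (rule power2_eq_imp_eq) auto
  have "(cis u - 1) * (\<Sum>j<N. cis u ^ j) = cis u ^ N - 1"
    by (simp add: power_diff_1_eq)
  then have "cmod (cis u - 1) * cmod (\<Sum>j<N. cis u ^ j) = cmod (cis u ^ N - 1)" by (metis norm_mult)
  also have "\<dots> \<le> cmod (cis u ^ N) + cmod 1" by (rule norm_triangle_ineq4)
  also have "\<dots> = 2" by (simp add: norm_power)
  finally have "2 * \<bar>sin (u / 2)\<bar> * cmod (\<Sum>j<N. cis u ^ j) \<le> 2" by (simp add: z1)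
  moreover have "2 * (\<bar>u\<bar> / 6) * cmod (\<Sum>j<N. cis u ^ j) \<le> 2 * \<bar>sin (u / 2)\<bar> * cmod (\<Sum>j<N. cis u ^ j)"
    using s by (intro mult_right_mono) auto
  ultimately have "\<bar>u\<bar> * cmod (\<Sum>j<N. cis u ^ j) \<le> 6" by simp
  then have "(\<bar>u\<bar> * cmod (\<Sum>j<N. cis u ^ j))\<^sup>2 \<le> 6\<^sup>2" by (intro power_mono) auto
  then have "(cmod (\<Sum>j<N. cis u ^ j))\<^sup>2 \<le> 36 / u\<^sup>2"
    using u by (simp add: power_mult_distrib field_simps)
  then have "(cmod (\<Sum>j<N. cis u ^ j))\<^sup>2 / N \<le> 36 / u\<^sup>2 / N" by (rule divide_right_mono) simp
  then show ?thesis by (simp add: fejer_cis mult.commute)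
qed

lemma fejer_continuous: "continuous_on S (\<lambda>t. fejer N (t - x))"
  unfolding fejer_def by (cases "N = 0") (auto intro!: continuous_intros)

lemma fejer_integral:
  assumes "N > 0" shows "integral {x - pi..x + pi} (\<lambda>t. fejer N (t - x)) = 2 * pi"
proof -
  have c: "integral {x - pi..x + pi} (\<lambda>t. cos ((real j - real l) * (t - x))) = (if j = l then 2 * pi else 0)" for j l
  proof (cases "j = l")
    case False
    define m where "m = real j - real l"
    have m: "m \<noteq> 0" using False by (simp add: m_def)
    have "m = of_int (int j - int l)" by (simp add: m_def)
    then have "sin (m * pi) = 0" using sin_integer_2pi sin_int_times_real by (metis sin_npi_int mult.commute)
    moreover have "((\<lambda>t. sin (m * (t - x)) / m) has_real_derivative cos (m * (t - x))) (at t)" for t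
      using m by (auto intro!: derivative_eq_intros)
    ultimately show ?thesis
      using integral_real_FTC[of "x - pi" "x + pi" "\<lambda>t. sin (m * (t - x)) / m" "\<lambda>t. cos (m * (t - x))"] False
      by (simp add: m_def[symmetric])
  qed simp
  have "integral {x - pi..x + pi} (\<lambda>t. \<Sum>j<N. \<Sum>l<N. cos ((real j - real l) * (t - x)))
      = (\<Sum>j<N. \<Sum>l<N. integral {x - pi..x + pi} (\<lambda>t. cos ((real j - real l) * (t - x))))"
    by (subst integral_sum | rule sum.cong refl cont_integrable continuous_intros finite_lessThan)+
  also have "\<dots> = N * (2 * pi)" by (simp add: c)
  finally show ?thesis using assms by (simp add: fejer_def)
qed

text \<open>The Fejer means of \<open>f\<close> are bounded by the sum of its Fourier coefficients, and they converge to \<open>f\<close>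
because the kernel is a positive approximate identity. The Lipschitz condition makes the convergence
elementary: \<open>\<bar>u\<bar> * fejer N u\<close> is at most \<open>d * fejer N u\<close> for \<open>\<bar>u\<bar> \<le> d\<close> and is uniformly small elsewhere.\<close>

lemma sup_le_sum_fourier_coefficients:
  fixes f :: "real \<Rightarrow> real" and s :: "nat \<Rightarrow> real"
  assumes per: "\<And>x. f (x + 2 * pi) = f x"
    and lip: "\<And>x y. \<bar>f x - f y\<bar> \<le> \<Lambda> * \<bar>x - y\<bar>"
    and coeff: "\<And>k :: nat. \<bar>integral {0..2 * pi} (\<lambda>t. f t * cos (k * t))\<bar> \<le> s k"
      "\<And>k :: nat. \<bar>integral {0..2 * pi} (\<lambda>t. f t * sin (k * t))\<bar> \<le> s k"
    and S: "\<And>N. (\<Sum>k<N. s k) \<le> S"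
  shows "\<bar>f x\<bar> \<le> S"
proof -
  have \<Lambda>: "\<Lambda> \<ge> 0" using lip[of 0 1] by simp
  have cont: "continuous_on UNIV f"
    by (rule lipschitz_on_continuous_on[of \<Lambda>]) (use lip \<Lambda> in \<open>auto simp: lipschitz_on_def dist_real_def\<close>)
  define I where "I = {x - pi..x + pi}"
  have s0: "0 \<le> s k" for k using coeff(1)[of k] by linarith
  have cosk: "\<bar>integral I (\<lambda>t. f t * cos ((real j - real l) * (t - x)))\<bar> \<le> 2 * s (nat \<bar>int j - int l\<bar>)" for j l
  proof -
    define k where "k = nat \<bar>int j - int l\<bar>"
    have "\<bar>real j - real l\<bar> = real k" by (simp add: k_def)
    then have c: "cos ((real j - real l) * (t - x)) = cos (real k * t) * cos (real k * x) + sin (real k * t) * sin (real k * x)" for t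
      by (metis abs_eq_iff cos_diff cos_minus minus_mult_left right_diff_distrib' abs_of_nat)
    have trig_per: "sin (real k * (t + 2 * pi)) = sin (real k * t) \<and> cos (real k * (t + 2 * pi)) = cos (real k * t)" for t
      unfolding sin_cos_eq_iff by (rule exI[of _ "int k"]) (simp add: algebra_simps)
    have ic: "integral I (\<lambda>t. f t * cos (real k * t)) = integral {0..2 * pi} (\<lambda>t. f t * cos (real k * t))"
    proof -
      have "continuous_on UNIV (\<lambda>t. f t * cos (real k * t))" by (intro continuous_intros cont)
      moreover have "f (t + 2 * pi) * cos (real k * (t + 2 * pi)) = f t * cos (real k * t)" for t
        using trig_per per by simp
      ultimately show ?thesis
        using integral_periodic_shift(1)[of "\<lambda>t. f t * cos (real k * t)" "2 * pi" "x - pi"]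
        by (simp add: I_def add.commute)
    qed
    have iss: "integral I (\<lambda>t. f t * sin (real k * t)) = integral {0..2 * pi} (\<lambda>t. f t * sin (real k * t))"
    proof -
      have "continuous_on UNIV (\<lambda>t. f t * sin (real k * t))" by (intro continuous_intros cont)
      moreover have "f (t + 2 * pi) * sin (real k * (t + 2 * pi)) = f t * sin (real k * t)" for t
        using trig_per per by simp
      ultimately show ?thesis
        using integral_periodic_shift(1)[of "\<lambda>t. f t * sin (real k * t)" "2 * pi" "x - pi"]
        by (simp add: I_def add.commute)
    qed
    have "integral I (\<lambda>t. f t * cos ((real j - real l) * (t - x)))
       = integral I (\<lambda>t. cos (real k * x) * (f t * cos (real k * t)) + sin (real k * x) * (f t * sin (real k * t)))"
      by (rule integral_cong) (subst c, simp add: algebra_simps)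
    also have "\<dots> = cos (real k * x) * integral I (\<lambda>t. f t * cos (real k * t))
        + sin (real k * x) * integral I (\<lambda>t. f t * sin (real k * t))"
      unfolding I_def by (subst integral_add) (auto intro!: cont_integrable continuous_intros cont)
    also have "\<bar>\<dots>\<bar> \<le> 1 * s k + 1 * s k"
      unfolding ic iss
      by (intro order.trans[OF abs_triangle_ineq] add_mono abs_mult_le coeff) auto
    finally show ?thesis by (simp add: k_def)
  qed
  have half: "(\<Sum>l<N. s (nat \<bar>int j - int l\<bar>)) \<le> 2 * S" if "j < N" for j N
  proof -
    have "(\<Sum>l<N. s (nat \<bar>int j - int l\<bar>)) = (\<Sum>l\<in>{..<N} \<inter> {..j}. s (nat \<bar>int j - int l\<bar>)) + (\<Sum>l\<in>{..<N} - {..j}. s (nat \<bar>int j - int l\<bar>))"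
      by (rule sum.Int_Diff) simp
    also have "(\<Sum>l\<in>{..<N} \<inter> {..j}. s (nat \<bar>int j - int l\<bar>)) = (\<Sum>k\<in>(\<lambda>l. nat \<bar>int j - int l\<bar>) ` ({..<N} \<inter> {..j}). s k)"
      by (subst sum.reindex) (auto simp: inj_on_def)
    also have "\<dots> \<le> (\<Sum>k<N. s k)" using that by (intro sum_mono2) (auto simp: s0)
    also have "(\<Sum>l\<in>{..<N} - {..j}. s (nat \<bar>int j - int l\<bar>)) = (\<Sum>k\<in>(\<lambda>l. nat \<bar>int j - int l\<bar>) ` ({..<N} - {..j}). s k)"
      by (subst sum.reindex) (auto simp: inj_on_def)
    also have "\<dots> \<le> (\<Sum>k<N. s k)" by (intro sum_mono2) (auto simp: s0)
    finally show ?thesis using S[of N] by linarith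
  qed
  have smooth: "\<bar>integral I (\<lambda>t. f t * fejer N (t - x))\<bar> \<le> 4 * S" if N: "N > 0" for N :: nat
  proof -
    have "integral I (\<lambda>t. f t * fejer N (t - x)) =
      integral I (\<lambda>t. (1 / N) * (\<Sum>j<N. \<Sum>l<N. f t * cos ((real j - real l) * (t - x))))"
      by (rule integral_cong) (simp add: fejer_def sum_distrib_left sum_divide_distrib)
    also have "\<dots> = (1 / N) * (\<Sum>j<N. \<Sum>l<N. integral I (\<lambda>t. f t * cos ((real j - real l) * (t - x))))"
      unfolding I_def integral_mult_right
      by (subst integral_sum | rule sum.cong refl cont_integrable continuous_intros finite_lessThan cont arg_cong[where f = "\<lambda>y. 1 / real N * y"])+
    also have "\<bar>\<dots>\<bar> \<le> (1 / N) * (\<Sum>j<N. 4 * S)"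
    proof -
      have "\<bar>\<Sum>j<N. \<Sum>l<N. integral I (\<lambda>t. f t * cos ((real j - real l) * (t - x)))\<bar> \<le> (\<Sum>j<N. 4 * S)"
      proof (rule order.trans[OF sum_abs], rule sum_mono)
        fix j assume "j \<in> {..<N}"
        have "\<bar>\<Sum>l<N. integral I (\<lambda>t. f t * cos ((real j - real l) * (t - x)))\<bar> \<le> (\<Sum>l<N. 2 * s (nat \<bar>int j - int l\<bar>))"
          by (intro order.trans[OF sum_abs] sum_mono cosk)
        also have "\<dots> = 2 * (\<Sum>l<N. s (nat \<bar>int j - int l\<bar>))" by (simp add: sum_distrib_left)
        also have "\<dots> \<le> 4 * S" using half[of j N] \<open>j \<in> {..<N}\<close> by simp
        finally show "\<bar>\<Sum>l<N. integral I (\<lambda>t. f t * cos ((real j - real l) * (t - x)))\<bar> \<le> 4 * S" .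
      qed
      moreover have "\<bar>1 / real N\<bar> = 1 / real N" by simp
      ultimately show ?thesis by (simp only: abs_mult mult_left_mono zero_le_divide_1_iff of_nat_0_le_iff)
    qed
    also have "\<dots> = 4 * S" using N by simp
    finally show ?thesis .
  qed
  have approx: "\<bar>2 * pi * f x\<bar> \<le> 4 * S + \<Lambda> * (2 * pi * d + 36 / (N * d) * (2 * pi))" if N: "N > 0" and d: "d > 0" for N :: nat and d :: real
  proof -
    have cf: "continuous_on UNIV (\<lambda>t. fejer N (t - x))" by (rule fejer_continuous)
    have "2 * pi * f x - integral I (\<lambda>t. f t * fejer N (t - x))
       = integral I (\<lambda>t. f x * fejer N (t - x)) - integral I (\<lambda>t. f t * fejer N (t - x))"
      unfolding I_def using fejer_integral[OF N, of x] by simp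
    also have "\<dots> = integral I (\<lambda>t. f x * fejer N (t - x) - f t * fejer N (t - x))"
      unfolding I_def by (intro integral_diff[symmetric] cont_integrable continuous_intros cf cont)
    also have "\<bar>\<dots>\<bar> \<le> integral I (\<lambda>t. \<Lambda> * (d * fejer N (t - x) + 36 / (N * d)))"
    proof -
      have "norm (integral I (\<lambda>t. f x * fejer N (t - x) - f t * fejer N (t - x)))
          \<le> integral I (\<lambda>t. \<Lambda> * (d * fejer N (t - x) + 36 / (N * d)))"
        unfolding I_def
      proof (intro integral_norm_bound_integral cont_integrable continuous_intros cf cont)
        fix t assume t: "t \<in> {x - pi..x + pi}"
        define u where "u = t - x"
        have u: "\<bar>u\<bar> \<le> pi" using t by (auto simp: u_def)
        have "\<bar>u\<bar> * fejer N u \<le> d * fejer N u + 36 / (N * d)"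
        proof (cases "\<bar>u\<bar> \<le> d")
          case True
          then have "\<bar>u\<bar> * fejer N u \<le> d * fejer N u" by (intro mult_right_mono fejer_nonneg)
          then show ?thesis using N d by (simp add: add_increasing2)
        next
          case False
          then have "\<bar>u\<bar> * fejer N u \<le> \<bar>u\<bar> * (36 / (N * u\<^sup>2))"
            using d u by (intro mult_left_mono fejer_decay) auto
          also have "\<dots> = 36 / (N * \<bar>u\<bar>)" 
          proof -
            have gen: "v * (36 / (real N * (v * v))) = 36 / (real N * v)" if "v \<noteq> 0" for v
              using that by simp
            have sq: "u\<^sup>2 = \<bar>u\<bar> * \<bar>u\<bar>" by (simp add: power2_eq_square)
            have "\<bar>u\<bar> \<noteq> 0" using False d by auto
            from gen[OF this] show ?thesis unfolding sq .
          qed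
          also have "\<dots> \<le> 36 / (N * d)" using False d N by (intro divide_left_mono mult_left_mono) auto
          finally show ?thesis using fejer_nonneg[of N u] d by (simp add: add_increasing)
        qed
        then have "\<Lambda> * (\<bar>u\<bar> * fejer N u) \<le> \<Lambda> * (d * fejer N u + 36 / (N * d))"
          using \<Lambda> by (rule mult_left_mono)
        moreover have "\<bar>f x - f t\<bar> * fejer N u \<le> (\<Lambda> * \<bar>u\<bar>) * fejer N u"
          using lip[of x t] by (intro mult_right_mono fejer_nonneg) (simp add: u_def abs_minus_commute)
        ultimately show "norm (f x * fejer N (t - x) - f t * fejer N (t - x)) \<le> \<Lambda> * (d * fejer N (t - x) + 36 / (N * d))"
          using fejer_nonneg[of N u] by (simp add: u_def abs_mult mult_ac flip: left_diff_distrib)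
      qed
      then show ?thesis by simp
    qed
    also have "\<dots> = \<Lambda> * (2 * pi * d + 36 / (N * d) * (2 * pi))"
    proof -
      have "integral I (\<lambda>t. d * fejer N (t - x) + 36 / (N * d)) = d * (2 * pi) + 36 / (N * d) * (2 * pi)"
        unfolding I_def by (subst integral_add) (auto intro!: cont_integrable continuous_intros cf simp: fejer_integral[OF N])
      then show ?thesis unfolding I_def by (simp add: mult_ac)
    qed
    finally show ?thesis using smooth[OF N] by linarith
  qed
  have "\<bar>2 * pi * f x\<bar> \<le> 4 * S + e" if "e > 0" for e :: real
  proof -
    \<comment> \<open>The width \<open>d\<close> makes the part near \<open>x\<close> small, and then a large \<open>N\<close> the part away from \<open>x\<close>.\<close>
    define d where "d = e / (4 * pi * (\<Lambda> + 1))"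
    have d: "d > 0" using that \<Lambda> by (simp add: d_def)
    have d1: "\<Lambda> * (2 * pi * d) \<le> e / 2"
    proof -
      have "\<Lambda> * (2 * pi * d) \<le> (\<Lambda> + 1) * (2 * pi * d)" using d by (intro mult_right_mono) auto
      also have "\<dots> = e / 2"
      proof -
        have "L * (2 * pi * (e / (4 * pi * L))) = e / 2" if "L \<noteq> 0" for L using that by simp
        then show ?thesis unfolding d_def by this (use \<Lambda> in simp)
      qed
      finally show ?thesis .
    qed
    obtain N :: nat where N: "real N > \<Lambda> * 36 * (2 * pi) / d * (2 / e)" using reals_Archimedean2 by blast
    have "0 \<le> \<Lambda> * 36 * (2 * pi) / d * (2 / e)" using \<Lambda> d that by simp
    then have N0: "N > 0" using N by (simp flip: of_nat_0_less_iff)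
    have gen: "Y / n \<le> e / 2" if "Y * (2 / e) < n" "0 < n" for Y n :: real
    proof -
      have "Y * (2 / e) * (e / 2) \<le> n * (e / 2)" using that \<open>e > 0\<close> by (intro mult_right_mono) auto
      then have "Y \<le> n * (e / 2)" using \<open>e > 0\<close> by simp
      then show ?thesis using \<open>0 < n\<close> by (simp add: field_simps)
    qed
    have "\<Lambda> * (36 / (N * d) * (2 * pi)) = (\<Lambda> * 36 * (2 * pi) / d) / N" by (simp add: field_simps)
    also have "\<dots> \<le> e / 2" using N N0 by (intro gen) auto
    finally show ?thesis using approx[OF N0 d] d1 by (simp add: distrib_left)
  qed
  then have "\<bar>2 * pi * f x\<bar> \<le> 4 * S" by (rule field_le_epsilon)
  then have "2 * pi * \<bar>f x\<bar> \<le> 4 * S" by (simp add: abs_mult)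
  moreover have "6 * \<bar>f x\<bar> \<le> 2 * pi * \<bar>f x\<bar>" using pi_gt3 by (intro mult_right_mono) auto
  ultimately show ?thesis by simp
qed

text \<open>A weight of period \<open>2\<pi>/q\<close> does not distinguish the vertices of a regular \<open>q\<close>-gon, so integrating \<open>h\<close>
against it is the same as integrating the average of \<open>h\<close> over these vertices.\<close>

lemma integral_le_orbit_sum:
  fixes h w :: "real \<Rightarrow> real" and q :: nat
  assumes q: "q > 0" and cont: "continuous_on UNIV h" "continuous_on UNIV w"
    and per: "\<And>x. h (x + 2 * pi) = h x" "\<And>x. w (x + 2 * pi / q) = w x"
    and w: "\<And>x. \<bar>w x\<bar> \<le> 1"
    and E: "\<And>x. \<bar>\<Sum>k<q. h (x + 2 * pi * k / q)\<bar> \<le> E"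
  shows "q * \<bar>integral {0..2 * pi} (\<lambda>x. h x * w x)\<bar> \<le> 2 * pi * E"
proof -
  have wk: "w (x + 2 * pi * k / q) = w x" for x and k :: nat
  proof (induction k)
    case (Suc k)
    then show ?case using per(2)[of "x + 2 * pi * k / q"] by (simp add: add_divide_distrib algebra_simps)
  qed simp
  have wper: "w (x + 2 * pi) = w x" for x using wk[of x q] q by simp
  have c: "continuous_on UNIV (\<lambda>x. h x * w x)" by (intro continuous_intros cont)
  have ck: "continuous_on UNIV (\<lambda>x. h (x + a) * w x)" for a
    by (intro continuous_intros cont continuous_on_compose2[OF cont(1)]) auto
  have "integral {0..2 * pi} (\<lambda>x. h (x + 2 * pi * k / q) * w x) = integral {0..2 * pi} (\<lambda>x. h x * w x)" for k :: nat
    using integral_periodic_shift(2)[OF c, of "2 * pi" "2 * pi * k / q"] per wper by (simp add: wk)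
  then have "q * integral {0..2 * pi} (\<lambda>x. h x * w x) = (\<Sum>k<q. integral {0..2 * pi} (\<lambda>x. h (x + 2 * pi * k / q) * w x))"
    by simp
  also have "\<dots> = integral {0..2 * pi} (\<lambda>x. \<Sum>k<q. h (x + 2 * pi * k / q) * w x)"
    by (intro integral_sum[symmetric] cont_integrable ck) auto
  also have "\<dots> = integral {0..2 * pi} (\<lambda>x. (\<Sum>k<q. h (x + 2 * pi * k / q)) * w x)"
    by (simp add: sum_distrib_right)
  also have "\<bar>\<dots>\<bar> \<le> (E * 1) * (2 * pi - 0)"
    by (intro abs_integral_le abs_mult_le E w continuous_intros cont continuous_on_compose2[OF cont(1)]) auto
  finally show ?thesis by (simp add: abs_mult mult_ac)
qed

section \<open>Uniform bounds on derivatives\<close>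

text \<open>Bounds all derivatives up to order \<open>k\<close> by one constant. The recursive form lets closure under products,
inverses and changes of variable be proved by induction on \<open>k\<close>, with no formula for derivatives of
higher order.\<close>

primrec Ck_bounded :: "nat \<Rightarrow> real \<Rightarrow> (real \<Rightarrow> real) \<Rightarrow> bool" where
  "Ck_bounded 0 B f \<longleftrightarrow> continuous_on UNIV f \<and> (\<forall>x. \<bar>f x\<bar> \<le> B)"
| "Ck_bounded (Suc k) B f \<longleftrightarrow> (\<forall>x. \<bar>f x\<bar> \<le> B) \<and>
     (\<forall>x. (f has_real_derivative deriv f x) (at x)) \<and> Ck_bounded k B (deriv f)"

lemma Ck_bounded_bound: "Ck_bounded k B f \<Longrightarrow> \<bar>f x\<bar> \<le> B"
  by (cases k) auto

lemma Ck_bounded_mono: "Ck_bounded k B f \<Longrightarrow> B \<le> B' \<Longrightarrow> Ck_bounded k B' f"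
  by (induction k arbitrary: f) (auto intro: order.trans)

lemma DERIV_continuous_on_UNIV: "(\<And>x. (f has_real_derivative f' x) (at x)) \<Longrightarrow> continuous_on UNIV f"
  by (meson DERIV_isCont continuous_at_imp_continuous_on)

lemma Ck_bounded_SucD: "Ck_bounded (Suc k) B f \<Longrightarrow> Ck_bounded k B f"
  by (induction k arbitrary: f) (auto intro: DERIV_continuous_on_UNIV)

lemma Ck_bounded_le: "Ck_bounded k B f \<Longrightarrow> j \<le> k \<Longrightarrow> Ck_bounded j B f"
  by (induction k) (use Ck_bounded_SucD in \<open>auto simp: le_Suc_eq simp del: Ck_bounded.simps\<close>)

text \<open>Families serve to keep track of what the constants depend on: a single bound for all members of a
family depends only on the data that define the index set.\<close>

definition uniformly_Ck :: "nat \<Rightarrow> 'i set \<Rightarrow> ('i \<Rightarrow> real \<Rightarrow> real) \<Rightarrow> bool" where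
  "uniformly_Ck k I F \<longleftrightarrow> (\<exists>B. \<forall>i\<in>I. Ck_bounded k B (F i))"

definition uniformly_bounded :: "'i set \<Rightarrow> ('i \<Rightarrow> real \<Rightarrow> real) \<Rightarrow> bool" where
  "uniformly_bounded I F \<longleftrightarrow> (\<exists>B. \<forall>i\<in>I. \<forall>x. \<bar>F i x\<bar> \<le> B)"

lemma uniformly_boundedI: "(\<And>i x. i \<in> I \<Longrightarrow> \<bar>F i x\<bar> \<le> B) \<Longrightarrow> uniformly_bounded I F"
  by (auto simp: uniformly_bounded_def)

lemma uniformly_Ck_bounded: "uniformly_Ck k I F \<Longrightarrow> uniformly_bounded I F"
  unfolding uniformly_Ck_def uniformly_bounded_def by (meson Ck_bounded_bound)

lemma uniformly_Ck_0_iff: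
  "uniformly_Ck 0 I F \<longleftrightarrow> uniformly_bounded I F \<and> (\<forall>i\<in>I. continuous_on UNIV (F i))"
  by (auto simp: uniformly_Ck_def uniformly_bounded_def)

lemma uniformly_Ck_SucD:
  assumes "uniformly_Ck (Suc k) I F"
  shows "uniformly_Ck k I (\<lambda>i. deriv (F i))" "uniformly_Ck k I F"
    "i \<in> I \<Longrightarrow> (F i has_real_derivative deriv (F i) x) (at x)"
  using assms Ck_bounded_SucD unfolding uniformly_Ck_def by (auto) blast+

lemma uniformly_Ck_SucI:
  assumes F: "uniformly_bounded I F" and F': "uniformly_Ck k I F'"
    and D: "\<And>i x. i \<in> I \<Longrightarrow> (F i has_real_derivative F' i x) (at x)"
  shows "uniformly_Ck (Suc k) I F"
proof -
  obtain B B' where B: "\<forall>i\<in>I. \<forall>x. \<bar>F i x\<bar> \<le> B" "\<forall>i\<in>I. Ck_bounded k B' (F' i)"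
    using F F' by (auto simp: uniformly_bounded_def uniformly_Ck_def)
  have "deriv (F i) = F' i" if "i \<in> I" for i using D[OF that] by (auto intro: DERIV_imp_deriv)
  then have "Ck_bounded (Suc k) (max B B') (F i)" if "i \<in> I" for i
    using that B D by (auto intro: Ck_bounded_mono simp: le_max_iff_disj)
  then show ?thesis unfolding uniformly_Ck_def by blast
qed

lemma uniformly_bounded_add:
  assumes "uniformly_bounded I F" "uniformly_bounded I G"
  shows "uniformly_bounded I (\<lambda>i x. F i x + G i x)"
proof -
  obtain A B where "\<forall>i\<in>I. \<forall>x. \<bar>F i x\<bar> \<le> A" "\<forall>i\<in>I. \<forall>x. \<bar>G i x\<bar> \<le> B"
    using assms by (auto simp: uniformly_bounded_def)
  then show ?thesis
    by (intro uniformly_boundedI[of _ _ "A + B"]) (metis abs_triangle_ineq add_mono order.trans)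
qed

lemma uniformly_bounded_mult:
  assumes "uniformly_bounded I F" "uniformly_bounded I G"
  shows "uniformly_bounded I (\<lambda>i x. F i x * G i x)"
proof -
  obtain A B where "\<forall>i\<in>I. \<forall>x. \<bar>F i x\<bar> \<le> A" "\<forall>i\<in>I. \<forall>x. \<bar>G i x\<bar> \<le> B"
    using assms by (auto simp: uniformly_bounded_def)
  then show ?thesis
    by (intro uniformly_boundedI[of _ _ "A * B"]) (auto simp: abs_mult intro: mult_mono')
qed

lemma uniformly_Ck_const:
  assumes "\<And>i. i \<in> I \<Longrightarrow> \<bar>c i\<bar> \<le> B" shows "uniformly_Ck k I (\<lambda>i x. c i)"
proof -
  have zero: "uniformly_Ck j I (\<lambda>i x. 0)" for j
    by (induction j) (auto simp: uniformly_Ck_0_iff uniformly_bounded_def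
        intro!: uniformly_Ck_SucI[where F' = "\<lambda>i x. 0"] exI[of _ 0])
  have "uniformly_bounded I (\<lambda>i x. c i)" using assms by (rule uniformly_boundedI)
  then show ?thesis
    by (cases k) (auto simp: uniformly_Ck_0_iff intro!: uniformly_Ck_SucI[OF _ zero])
qed

lemma uniformly_Ck_add:
  "uniformly_Ck k I F \<Longrightarrow> uniformly_Ck k I G \<Longrightarrow> uniformly_Ck k I (\<lambda>i x. F i x + G i x)"
proof (induction k arbitrary: F G)
  case 0
  then show ?case by (auto simp: uniformly_Ck_0_iff intro!: uniformly_bounded_add continuous_intros)
next
  case (Suc k)
  show ?case
    by (rule uniformly_Ck_SucI[OF uniformly_bounded_add[OF Suc.prems[THEN uniformly_Ck_bounded]]
          Suc.IH[OF Suc.prems[THEN uniformly_Ck_SucD(1)]]])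
       (use Suc.prems uniformly_Ck_SucD(3) in \<open>auto intro!: derivative_intros\<close>)
qed

lemma uniformly_Ck_mult:
  "uniformly_Ck k I F \<Longrightarrow> uniformly_Ck k I G \<Longrightarrow> uniformly_Ck k I (\<lambda>i x. F i x * G i x)"
proof (induction k arbitrary: F G)
  case 0
  then show ?case by (auto simp: uniformly_Ck_0_iff intro!: uniformly_bounded_mult continuous_intros)
next
  case (Suc k)
  note F = uniformly_Ck_SucD[OF Suc.prems(1)] and G = uniformly_Ck_SucD[OF Suc.prems(2)]
  show ?case
    by (rule uniformly_Ck_SucI[OF uniformly_bounded_mult[OF Suc.prems[THEN uniformly_Ck_bounded]]
          uniformly_Ck_add[OF Suc.IH[OF F(1) G(2)] Suc.IH[OF F(2) G(1)]]])
       (auto intro!: derivative_eq_intros F(3) G(3))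
qed

lemma uniformly_Ck_cmult:
  assumes "uniformly_Ck k I F" "\<And>i. i \<in> I \<Longrightarrow> \<bar>c i\<bar> \<le> B"
  shows "uniformly_Ck k I (\<lambda>i x. c i * F i x)"
  using uniformly_Ck_mult[OF uniformly_Ck_const[OF assms(2)] assms(1)] .

lemma uniformly_Ck_minus: "uniformly_Ck k I F \<Longrightarrow> uniformly_Ck k I (\<lambda>i x. - F i x)"
  using uniformly_Ck_cmult[of k I F "\<lambda>_. - 1" 1] by simp

lemma uniformly_Ck_diff:
  "uniformly_Ck k I F \<Longrightarrow> uniformly_Ck k I G \<Longrightarrow> uniformly_Ck k I (\<lambda>i x. F i x - G i x)"
  using uniformly_Ck_add[of k I F "\<lambda>i x. - G i x"] uniformly_Ck_minus[of k I G] by simp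

lemma uniformly_Ck_inverse:
  assumes "c > 0" "\<And>i x. i \<in> I \<Longrightarrow> c \<le> F i x"
  shows "uniformly_Ck k I F \<Longrightarrow> uniformly_Ck k I (\<lambda>i x. inverse (F i x))"
proof (induction k)
  have pos: "F i x > 0" if "i \<in> I" for i x using assms that by (meson less_le_trans)
  have bnd: "uniformly_bounded I (\<lambda>i x. inverse (F i x))"
    using assms pos by (intro uniformly_boundedI[of _ _ "inverse c"]) (auto intro: le_imp_inverse_le simp: less_imp_le)
  {
    case 0
    then show ?case using bnd pos
      by (auto simp: uniformly_Ck_0_iff intro!: continuous_on_inverse) (metis less_irrefl)
  next
    case (Suc k)
    note F = uniformly_Ck_SucD[OF Suc.prems]
    note inv = Suc.IH[OF F(2)]
    show ?case
      by (rule uniformly_Ck_SucI[OF bnd uniformly_Ck_minus[OF uniformly_Ck_mult[OF uniformly_Ck_mult[OF inv F(1)] inv]]])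
         (use pos F(3) in \<open>auto intro!: DERIV_inverse' simp: less_imp_neq[symmetric]\<close>)
  }
qed

lemma uniformly_Ck_sqrt:
  assumes "c > 0" "\<And>i x. i \<in> I \<Longrightarrow> c \<le> F i x"
  shows "uniformly_Ck k I F \<Longrightarrow> uniformly_Ck k I (\<lambda>i x. sqrt (F i x))"
proof (induction k)
  have pos: "F i x > 0" if "i \<in> I" for i x using assms that by (meson less_le_trans)
  have low: "sqrt c \<le> sqrt (F i x)" if "i \<in> I" for i x using assms(2)[OF that] by simp
  have bnd: "uniformly_bounded I (\<lambda>i x. sqrt (F i x))" if b: "uniformly_bounded I F"
  proof -
    obtain B where "\<forall>i\<in>I. \<forall>x. \<bar>F i x\<bar> \<le> B" using b by (auto simp: uniformly_bounded_def)
    then show ?thesis using pos by (intro uniformly_boundedI[of _ _ "sqrt B"]) (force simp: less_imp_le)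
  qed
  {
    case 0
    then show ?case using bnd by (auto simp: uniformly_Ck_0_iff intro!: continuous_intros)
  next
    case (Suc k)
    note F = uniformly_Ck_SucD[OF Suc.prems]
    have inv: "uniformly_Ck k I (\<lambda>i x. inverse (sqrt (F i x)))"
      using assms(1) low by (intro uniformly_Ck_inverse[OF _ _ Suc.IH[OF F(2)], of "sqrt c"]) auto
    have D: "((\<lambda>x. sqrt (F i x)) has_real_derivative 1 / 2 * (inverse (sqrt (F i x)) * deriv (F i) x)) (at x)"
      if i: "i \<in> I" for i x
      using pos[OF i, of x] by (auto intro!: derivative_eq_intros F(3)[OF i] simp: field_simps)
    have "uniformly_Ck k I (\<lambda>i x. 1 / 2 * (inverse (sqrt (F i x)) * deriv (F i) x))"
      by (rule uniformly_Ck_cmult[OF uniformly_Ck_mult[OF inv F(1)], of "\<lambda>_. 1 / 2" 1]) simp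
    from uniformly_Ck_SucI[OF bnd[OF uniformly_Ck_bounded[OF Suc.prems]] this D] show ?case by simp
  }
qed

lemma uniformly_Ck_cos_sin: "uniformly_Ck k I (\<lambda>i. cos)" "uniformly_Ck k I (\<lambda>i. sin)"
proof (induction k)
  case 0
  show "uniformly_Ck 0 I (\<lambda>i. cos)" "uniformly_Ck 0 I (\<lambda>i. sin)"
    by (auto simp: uniformly_Ck_0_iff intro!: continuous_intros uniformly_boundedI[of _ _ 1])
next
  case (Suc k)
  show "uniformly_Ck (Suc k) I (\<lambda>i. cos)"
    by (rule uniformly_Ck_SucI[OF _ uniformly_Ck_minus[OF Suc(2)]])
       (auto intro!: uniformly_boundedI[of _ _ 1] derivative_eq_intros)
  show "uniformly_Ck (Suc k) I (\<lambda>i. sin)"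
    by (rule uniformly_Ck_SucI[OF _ Suc(1)])
       (auto intro!: uniformly_boundedI[of _ _ 1] derivative_eq_intros)
qed

text \<open>Here \<open>h i\<close> is the inverse of a function with derivative \<open>P i\<close>. The derivative of \<open>F i \<circ> h i\<close> is
\<open>(F' i / P i) \<circ> h i\<close>, of the same form, so that the induction applies to \<open>F\<close> alone.\<close>

lemma uniformly_Ck_compose_inverse:
  assumes "c > 0" "\<And>i x. i \<in> I \<Longrightarrow> c \<le> P i x"
    and D: "\<And>i x. i \<in> I \<Longrightarrow> (h i has_real_derivative inverse (P i (h i x))) (at x)"
  shows "uniformly_Ck k I P \<Longrightarrow> uniformly_Ck k I F \<Longrightarrow> uniformly_Ck k I (\<lambda>i x. F i (h i x))"
proof (induction k arbitrary: F)
  have bnd: "uniformly_bounded I (\<lambda>i x. F i (h i x))" if "uniformly_bounded I F" for F :: "'a \<Rightarrow> real \<Rightarrow> real"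
    using that by (auto simp: uniformly_bounded_def)
  {
    case 0
    have "continuous_on UNIV (\<lambda>x. F i (h i x))" if i: "i \<in> I" for i
    proof (rule continuous_on_compose2[where g = "F i" and t = UNIV])
      show "continuous_on UNIV (F i)" using 0 i by (simp add: uniformly_Ck_0_iff)
      show "continuous_on UNIV (h i)" using D[OF i] by (rule DERIV_continuous_on_UNIV)
    qed simp
    then show ?case using 0 bnd by (simp add: uniformly_Ck_0_iff)
  next
    case (Suc k)
    note F = uniformly_Ck_SucD[OF Suc.prems(2)] and P = uniformly_Ck_SucD[OF Suc.prems(1)]
    have "uniformly_Ck k I (\<lambda>i x. deriv (F i) x * inverse (P i x))"
      by (intro uniformly_Ck_mult F(1) uniformly_Ck_inverse[OF assms(1,2)] P(2))
    from Suc.IH[OF P(2) this] show ?case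
      by (rule uniformly_Ck_SucI[OF bnd[OF uniformly_Ck_bounded[OF Suc.prems(2)]]])
         (intro DERIV_chain2 F(3) D)
  }
qed

section \<open>Decay of Fourier coefficients and low modes\<close>

lemma trig_periodic_nat:
  "cos (real k * (t + 2 * pi)) = cos (real k * t)" "sin (real k * (t + 2 * pi)) = sin (real k * t)"
proof -
  have "sin (real k * (t + 2 * pi)) = sin (real k * t) \<and> cos (real k * (t + 2 * pi)) = cos (real k * t)"
    unfolding sin_cos_eq_iff by (rule exI[of _ "int k"]) (simp add: algebra_simps)
  then show "cos (real k * (t + 2 * pi)) = cos (real k * t)" "sin (real k * (t + 2 * pi)) = sin (real k * t)"
    by auto
qed

lemma fourier_by_parts:
  fixes f f' :: "real \<Rightarrow> real" and k :: nat
  assumes D: "\<And>x. (f has_real_derivative f' x) (at x)" and cont: "continuous_on UNIV f'"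
    and per: "\<And>x. f (x + 2 * pi) = f x"
  shows "integral {0..2 * pi} (\<lambda>x. f' x * cos (k * x)) = k * integral {0..2 * pi} (\<lambda>x. f x * sin (k * x))"
    "integral {0..2 * pi} (\<lambda>x. f' x * sin (k * x)) = - (k * integral {0..2 * pi} (\<lambda>x. f x * cos (k * x)))"
proof -
  have cf: "continuous_on UNIV f" using D by (rule DERIV_continuous_on_UNIV)
  have "((\<lambda>x. f x * cos (k * x)) has_real_derivative f' x * cos (k * x) - k * (f x * sin (k * x))) (at x)" for x :: real
    by (auto intro!: derivative_eq_intros D)
  from integral_real_FTC[OF _ this, of 0 "2 * pi"]
  have "integral {0..2 * pi} (\<lambda>x. f' x * cos (k * x) - k * (f x * sin (k * x))) = 0"
    using per[of 0] trig_periodic_nat[of k 0] by simp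
  moreover have "integral {0..2 * pi} (\<lambda>x. f' x * cos (k * x) - k * (f x * sin (k * x)))
     = integral {0..2 * pi} (\<lambda>x. f' x * cos (k * x)) - k * integral {0..2 * pi} (\<lambda>x. f x * sin (k * x))"
    by (subst integral_diff) (auto intro!: cont_integrable continuous_intros cont cf)
  ultimately show "integral {0..2 * pi} (\<lambda>x. f' x * cos (k * x)) = k * integral {0..2 * pi} (\<lambda>x. f x * sin (k * x))"
    by simp
  have "((\<lambda>x. f x * sin (k * x)) has_real_derivative f' x * sin (k * x) + k * (f x * cos (k * x))) (at x)" for x :: real
    by (auto intro!: derivative_eq_intros D)
  from integral_real_FTC[OF _ this, of 0 "2 * pi"]
  have "integral {0..2 * pi} (\<lambda>x. f' x * sin (k * x) + k * (f x * cos (k * x))) = 0"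
    using per[of 0] trig_periodic_nat[of k 0] by simp
  moreover have "integral {0..2 * pi} (\<lambda>x. f' x * sin (k * x) + k * (f x * cos (k * x)))
     = integral {0..2 * pi} (\<lambda>x. f' x * sin (k * x)) + k * integral {0..2 * pi} (\<lambda>x. f x * cos (k * x))"
    by (subst integral_add) (auto intro!: cont_integrable continuous_intros cont cf)
  ultimately show "integral {0..2 * pi} (\<lambda>x. f' x * sin (k * x)) = - (k * integral {0..2 * pi} (\<lambda>x. f x * cos (k * x)))"
    by simp
qed

lemma deriv_periodic:
  fixes f :: "real \<Rightarrow> real"
  assumes D: "\<And>x. (f has_real_derivative f' x) (at x)" and per: "\<And>x. f (x + p) = f x"
  shows "f' (x + p) = f' x"
proof -
  have "((\<lambda>x. f (x + p)) has_real_derivative f' (x + p)) (at x)"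
    using D[of "x + p"] by (simp add: DERIV_shift)
  then show ?thesis using DERIV_unique[OF _ D[of x]] by (simp add: per)
qed

lemma abs_integral_trig_le:
  fixes g :: "real \<Rightarrow> real"
  assumes "continuous_on UNIV g" "\<And>x. \<bar>g x\<bar> \<le> B"
  shows "\<bar>integral {0..2 * pi} (\<lambda>x. g x * cos (c * x))\<bar> \<le> 7 * B"
    "\<bar>integral {0..2 * pi} (\<lambda>x. g x * sin (c * x))\<bar> \<le> 7 * B"
proof -
  have B: "0 \<le> B" using assms(2)[of 0] by simp
  have "(B * 1) * (2 * pi - 0) \<le> B * 7" unfolding mult_1_right
    using B pi_less_4 pi_approx by (intro mult_left_mono) auto
  moreover have "\<bar>integral {0..2 * pi} (\<lambda>x. g x * cos (c * x))\<bar> \<le> (B * 1) * (2 * pi - 0)"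
    "\<bar>integral {0..2 * pi} (\<lambda>x. g x * sin (c * x))\<bar> \<le> (B * 1) * (2 * pi - 0)"
    by (intro abs_integral_le abs_mult_le assms continuous_intros; simp)+
  ultimately show "\<bar>integral {0..2 * pi} (\<lambda>x. g x * cos (c * x))\<bar> \<le> 7 * B"
    "\<bar>integral {0..2 * pi} (\<lambda>x. g x * sin (c * x))\<bar> \<le> 7 * B" by linarith+
qed

lemma fourier_decay:
  fixes f :: "real \<Rightarrow> real" and k :: nat
  assumes "Ck_bounded M B f" "\<And>x. f (x + 2 * pi) = f x"
  shows "real k ^ M * \<bar>integral {0..2 * pi} (\<lambda>x. f x * cos (k * x))\<bar> \<le> 7 * B \<and>
    real k ^ M * \<bar>integral {0..2 * pi} (\<lambda>x. f x * sin (k * x))\<bar> \<le> 7 * B"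
  using assms
proof (induction M arbitrary: f)
  case 0
  then show ?case using abs_integral_trig_le[of f B k] by simp
next
  case (Suc M)
  have a: "Ck_bounded M B (deriv f)" and b: "\<And>x. (f has_real_derivative deriv f x) (at x)"
    using Suc.prems(1) by auto
  have c: "continuous_on UNIV (deriv f)" using Ck_bounded_le[OF a, of 0] by simp
  have d: "deriv f (x + 2 * pi) = deriv f x" for x by (rule deriv_periodic[OF b Suc.prems(2)])
  show ?case using Suc.IH[OF a d] fourier_by_parts[OF b c Suc.prems(2), of k]
    by (simp add: abs_mult mult_ac)
qed

lemma sum_inverse_squares_le: "(\<Sum>k<N. 1 / (real k + 1)\<^sup>2) \<le> 2"
proof -
  have "(\<Sum>k<N. 1 / (real k + 1)\<^sup>2) \<le> 2 - 1 / real N" if "N > 0" for N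
    using that
  proof (induction N)
    case (Suc N)
    show ?case
    proof (cases "N = 0")
      case False
      have "1 / (real N + 1)\<^sup>2 \<le> 1 / real N - 1 / (real N + 1)"

      proof -
        have "1 / real N - 1 / (real N + 1) = 1 / (real N * (real N + 1))" using False by (simp add: field_simps)
        moreover have "1 / (real N + 1)\<^sup>2 \<le> 1 / (real N * (real N + 1))"
          using False unfolding power2_eq_square by (intro divide_left_mono mult_right_mono) auto
        ultimately show ?thesis by simp
      qed
      then show ?thesis using Suc False by (simp add: add.commute)
    qed simp
  qed simp
  from this[of N] show ?thesis by (cases "N = 0") (auto intro: order.trans)
qed

text \<open>For the domain with radius \<open>\<rho>\<close> in polar coordinates: its centroid is the origin, and its second
moments are those of the unit disc. The second moments appear through their sum and through the
angular mode \<open>2\<close>.\<close>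

definition satisfies_moments :: "(real \<Rightarrow> real) \<Rightarrow> bool" where
  "satisfies_moments \<rho> \<longleftrightarrow>
     integral {0..2 * pi} (\<lambda>x. \<rho> x ^ 3 * cos x) = 0 \<and>
     integral {0..2 * pi} (\<lambda>x. \<rho> x ^ 3 * sin x) = 0 \<and>
     integral {0..2 * pi} (\<lambda>x. \<rho> x ^ 4) = 2 * pi \<and>
     integral {0..2 * pi} (\<lambda>x. \<rho> x ^ 4 * cos (2 * x)) = 0 \<and>
     integral {0..2 * pi} (\<lambda>x. \<rho> x ^ 4 * sin (2 * x)) = 0"

lemma trig_integral_zero:
  fixes k :: nat assumes "k > 0"
  shows "integral {0..2 * pi} (\<lambda>x. cos (k * x)) = 0" "integral {0..2 * pi} (\<lambda>x. sin (k * x)) = 0"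
proof -
  have "((\<lambda>x. sin (k * x) / k) has_real_derivative cos (k * x)) (at x)"
    "((\<lambda>x. - cos (k * x) / k) has_real_derivative sin (k * x)) (at x)" for x :: real
    using assms by (auto intro!: derivative_eq_intros)
  from integral_real_FTC[OF _ this(1), of 0 "2 * pi"] integral_real_FTC[OF _ this(2), of 0 "2 * pi"]
  show "integral {0..2 * pi} (\<lambda>x. cos (k * x)) = 0" "integral {0..2 * pi} (\<lambda>x. sin (k * x)) = 0"
    using trig_periodic_nat[of k 0] by simp_all
qed

text \<open>Expanding the moment conditions to first order in \<open>m\<close> says that the modes \<open>0\<close>, \<open>1\<close>, \<open>2\<close> of \<open>m\<close> vanish.
The remainders \<open>r3\<close> and \<open>r4\<close> are quadratic.\<close>

lemma low_modes_small:
  fixes m :: "real \<Rightarrow> real"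
  assumes cont: "continuous_on UNIV m" and small: "\<And>x. \<bar>m x\<bar> \<le> \<epsilon>" and \<epsilon>: "\<epsilon> \<le> 1 / 100"
    and mom: "satisfies_moments (\<lambda>x. 1 + m x)"
  shows "\<bar>integral {0..2 * pi} m\<bar> \<le> 13 * \<epsilon>\<^sup>2"
    and "\<bar>integral {0..2 * pi} (\<lambda>x. m x * cos x)\<bar> \<le> 13 * \<epsilon>\<^sup>2"
    and "\<bar>integral {0..2 * pi} (\<lambda>x. m x * sin x)\<bar> \<le> 13 * \<epsilon>\<^sup>2"
    and "\<bar>integral {0..2 * pi} (\<lambda>x. m x * cos (2 * x))\<bar> \<le> 13 * \<epsilon>\<^sup>2"
    and "\<bar>integral {0..2 * pi} (\<lambda>x. m x * sin (2 * x))\<bar> \<le> 13 * \<epsilon>\<^sup>2"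
proof -
  define r3 where "r3 = (\<lambda>x. 3 * (m x)\<^sup>2 + m x ^ 3)"
  define r4 where "r4 = (\<lambda>x. 6 * (m x)\<^sup>2 + 4 * m x ^ 3 + m x ^ 4)"
  have e0: "0 \<le> \<epsilon>" using small[of 0] by linarith
  have sq: "(m x)\<^sup>2 \<le> \<epsilon>\<^sup>2" for x using small[of x] e0 by (simp add: abs_le_square_iff[symmetric])
  have cube: "\<bar>m x ^ 3\<bar> \<le> (1 / 100) * \<epsilon>\<^sup>2" for x
  proof -
    have "\<bar>m x * (m x)\<^sup>2\<bar> \<le> (1 / 100) * \<epsilon>\<^sup>2" using small[of x] \<epsilon> sq[of x] by (intro abs_mult_le) auto
    then show ?thesis by (simp add: power3_eq_cube power2_eq_square mult.assoc)
  qed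
  have quart: "\<bar>m x ^ 4\<bar> \<le> (1 / 100) * ((1 / 100) * \<epsilon>\<^sup>2)" for x
  proof -
    have "\<bar>m x * m x ^ 3\<bar> \<le> (1 / 100) * ((1 / 100) * \<epsilon>\<^sup>2)" using small[of x] \<epsilon> cube[of x] by (intro abs_mult_le) auto
    then show ?thesis by (simp add: power_numeral_reduce)
  qed
  have r3: "\<bar>r3 x\<bar> \<le> 4 * \<epsilon>\<^sup>2" for x
    using sq[of x] cube[of x] zero_le_power2[of "m x"] zero_le_power2[of \<epsilon>] unfolding r3_def by linarith
  have r4: "\<bar>r4 x\<bar> \<le> 7 * \<epsilon>\<^sup>2" for x
    using sq[of x] cube[of x] quart[of x] zero_le_power2[of "m x"] zero_le_power2[of \<epsilon>] unfolding r4_def by linarith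
  have c3: "continuous_on UNIV r3" and c4: "continuous_on UNIV r4"
    unfolding r3_def r4_def by (intro continuous_intros cont)+
  have p3: "(1 + m x) ^ 3 = 1 + 3 * m x + r3 x" for x
    by (simp add: r3_def power3_eq_cube power2_eq_square algebra_simps)
  have p4: "(1 + m x) ^ 4 = 1 + 4 * m x + r4 x" for x
    by (simp add: r4_def power_numeral_reduce algebra_simps)
  have expand: "integral {0..2 * pi} (\<lambda>x. (1 + a * m x + r x) * w x)
      = integral {0..2 * pi} w + a * integral {0..2 * pi} (\<lambda>x. m x * w x) + integral {0..2 * pi} (\<lambda>x. r x * w x)"
    if "continuous_on UNIV r" "continuous_on UNIV w" for a r w
  proof -
    have "integral {0..2 * pi} (\<lambda>x. (1 + a * m x + r x) * w x)
       = integral {0..2 * pi} (\<lambda>x. (w x + a * (m x * w x)) + r x * w x)"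
      by (simp add: algebra_simps)
    also have "\<dots> = integral {0..2 * pi} (\<lambda>x. w x + a * (m x * w x)) + integral {0..2 * pi} (\<lambda>x. r x * w x)"
      by (intro integral_add cont_integrable continuous_intros cont that)
    also have "integral {0..2 * pi} (\<lambda>x. w x + a * (m x * w x)) = integral {0..2 * pi} w + integral {0..2 * pi} (\<lambda>x. a * (m x * w x))"
      by (intro integral_add cont_integrable continuous_intros cont that)
    finally show ?thesis by simp
  qed
  note b3 = abs_integral_trig_le[OF c3 r3] and b4 = abs_integral_trig_le[OF c4 r4]
  have z1: "integral {0..2 * pi} (\<lambda>x. cos (1 * x)) = 0" "integral {0..2 * pi} (\<lambda>x. sin (1 * x)) = 0"
    using trig_integral_zero[of 1] by (simp_all only: of_nat_1 zero_less_one)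
  have z2: "integral {0..2 * pi} (\<lambda>x. cos (2 * x)) = 0" "integral {0..2 * pi} (\<lambda>x. sin (2 * x)) = 0"
    using trig_integral_zero[of 2] by (simp_all only: of_nat_numeral zero_less_numeral)
  have e2: "0 \<le> \<epsilon>\<^sup>2" by simp
  have cs: "continuous_on UNIV (\<lambda>x. cos (c * x))" "continuous_on UNIV (\<lambda>x. sin (c * x))" for c :: real
    by (intro continuous_intros)+
  from mom have M1: "integral {0..2 * pi} (\<lambda>x. (1 + 3 * m x + r3 x) * cos (1 * x)) = 0"
    and M2: "integral {0..2 * pi} (\<lambda>x. (1 + 3 * m x + r3 x) * sin (1 * x)) = 0"
    and M3: "integral {0..2 * pi} (\<lambda>x. (1 + 4 * m x + r4 x) * cos (0 * x)) = 2 * pi"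
    and M4: "integral {0..2 * pi} (\<lambda>x. (1 + 4 * m x + r4 x) * cos (2 * x)) = 0"
    and M5: "integral {0..2 * pi} (\<lambda>x. (1 + 4 * m x + r4 x) * sin (2 * x)) = 0"
    by (simp_all add: satisfies_moments_def p3 p4)
  have "integral {0..2 * pi} (\<lambda>x. cos (0 * x)) = 2 * pi" by simp
  then have "\<bar>integral {0..2 * pi} (\<lambda>x. m x * cos (0 * x))\<bar> \<le> 13 * \<epsilon>\<^sup>2"
    using M3 expand[OF c4 cs(1)[of 0], of 4] b4(1)[of 0] e2 by linarith
  then show "\<bar>integral {0..2 * pi} m\<bar> \<le> 13 * \<epsilon>\<^sup>2" by simp
  have "\<bar>integral {0..2 * pi} (\<lambda>x. m x * cos (1 * x))\<bar> \<le> 13 * \<epsilon>\<^sup>2"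
    using M1 expand[OF c3 cs(1)[of 1], of 3] b3(1)[of 1] z1 e2 by linarith
  then show "\<bar>integral {0..2 * pi} (\<lambda>x. m x * cos x)\<bar> \<le> 13 * \<epsilon>\<^sup>2" by simp
  have "\<bar>integral {0..2 * pi} (\<lambda>x. m x * sin (1 * x))\<bar> \<le> 13 * \<epsilon>\<^sup>2"
    using M2 expand[OF c3 cs(2)[of 1], of 3] b3(2)[of 1] z1 e2 by linarith
  then show "\<bar>integral {0..2 * pi} (\<lambda>x. m x * sin x)\<bar> \<le> 13 * \<epsilon>\<^sup>2" by simp
  show "\<bar>integral {0..2 * pi} (\<lambda>x. m x * cos (2 * x))\<bar> \<le> 13 * \<epsilon>\<^sup>2"
    using M4 expand[OF c4 cs(1)[of 2], of 4] b4(1)[of 2] z2 e2 by linarith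
  show "\<bar>integral {0..2 * pi} (\<lambda>x. m x * sin (2 * x))\<bar> \<le> 13 * \<epsilon>\<^sup>2"
    using M5 expand[OF c4 cs(2)[of 2], of 4] b4(2)[of 2] z2 e2 by linarith
qed

section \<open>Self-improvement of small deformations\<close>

definition C2_small :: "real \<Rightarrow> (real \<Rightarrow> real) \<Rightarrow> bool" where
  "C2_small \<epsilon> m \<longleftrightarrow> (\<forall>x. \<bar>m x\<bar> \<le> \<epsilon> \<and> \<bar>deriv m x\<bar> \<le> \<epsilon> \<and> \<bar>deriv (deriv m) x\<bar> \<le> \<epsilon>)"

text \<open>The consequence of rational integrability that the analytic part of the proof uses.\<close>

definition orbit_sums_small :: "real \<Rightarrow> (real \<Rightarrow> real) \<Rightarrow> bool" where
  "orbit_sums_small \<epsilon> m \<longleftrightarrow> (\<forall>q :: nat. q \<ge> 3 \<longrightarrow>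
     (\<forall>x. \<bar>\<Sum>k<q. deriv m (x + 2 * pi * k / q)\<bar> \<le> 200 * real q ^ 4 * \<epsilon>\<^sup>2))"

text \<open>If \<open>k\<^sup>6 \<epsilon>\<close> is small, the dynamical bound suffices. Otherwise \<open>\<epsilon>\<close> is at least a multiple of \<open>k\<^sup>-\<^sup>6\<close>, and
the smoothness bound of order \<open>9 = 6 + 2 + 1\<close> wins: two powers of \<open>k\<close> are spent on summability, and the
last one absorbs the constants, because in this case \<open>k\<close> exceeds \<open>X\<close>.\<close>

lemma fourier_threshold:
  fixes k :: nat and c :: real
  assumes k: "3 \<le> k" and \<epsilon>: "0 < \<epsilon>" and B: "0 \<le> B"
    and dyn: "\<bar>c\<bar> \<le> 1400 * real k ^ 4 * \<epsilon>\<^sup>2" and smooth: "real k ^ 9 * \<bar>c\<bar> \<le> 7 * B"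
    and X: "X = 1 + 156800000000 * B" and \<epsilon>0: "\<epsilon> \<le> 1 / (5600000 * X ^ 6)"
  shows "\<bar>c\<bar> \<le> \<epsilon> / 1000 / (real k + 1)\<^sup>2"
proof -
  have k0: "0 < real k" using k by simp
  have "(real k + 1)\<^sup>2 \<le> (2 * real k)\<^sup>2" using k by (intro power_mono) auto
  then have k1: "(real k + 1)\<^sup>2 \<le> 4 * (real k)\<^sup>2" by (simp add: power_mult_distrib)
  have "\<bar>c\<bar> * (4 * (real k)\<^sup>2) \<le> \<epsilon> / 1000"
  proof (cases "5600000 * real k ^ 6 * \<epsilon> \<le> 1")
    case True
    have "\<bar>c\<bar> * (4 * (real k)\<^sup>2) \<le> (1400 * real k ^ 4 * \<epsilon>\<^sup>2) * (4 * (real k)\<^sup>2)"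
      using dyn by (rule mult_right_mono) simp
    also have "\<dots> = (5600000 * real k ^ 6 * \<epsilon>) * (\<epsilon> / 1000)"
      by (simp add: power_numeral_reduce)
    also have "\<dots> \<le> 1 * (\<epsilon> / 1000)" using True \<epsilon> by (intro mult_right_mono) auto
    finally show ?thesis by simp
  next
    case False
    have X1: "1 \<le> X" using X B by simp
    have "\<epsilon> * (5600000 * X ^ 6) \<le> 1" using \<epsilon>0 X1 by (simp add: field_simps)
    also have "1 < \<epsilon> * (5600000 * real k ^ 6)" using False by (simp add: mult_ac)
    finally have "X ^ 6 < real k ^ 6" using \<epsilon> by simp
    then have "X < real k" using X1 by (simp add: power_less_imp_less_base[of X 6 "real k"])
    then have Bk: "156800000000 * B \<le> real k" using X by simp
    have "real k ^ 9 * \<bar>c\<bar> * 22400000000 \<le> 7 * B * 22400000000" using smooth by (rule mult_right_mono) simp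
    also have "\<dots> \<le> real k" using Bk by simp
    finally have "real k * (real k ^ 8 * \<bar>c\<bar> * 22400000000) \<le> real k * 1" by (simp add: power_numeral_reduce mult_ac)
    then have a: "real k ^ 8 * \<bar>c\<bar> * 22400000000 \<le> 1" using k0 by simp
    have "real k ^ 6 * (\<bar>c\<bar> * (4 * (real k)\<^sup>2) * 5600000000) \<le> 1"
      using a by (simp add: power_numeral_reduce mult_ac)
    also have "1 \<le> real k ^ 6 * (\<epsilon> * 5600000)" using False by (simp add: mult_ac)
    finally have "\<bar>c\<bar> * (4 * (real k)\<^sup>2) * 5600000000 \<le> \<epsilon> * 5600000" using k0 by simp
    then show ?thesis by simp
  qed
  moreover have "\<bar>c\<bar> * (real k + 1)\<^sup>2 \<le> \<bar>c\<bar> * (4 * (real k)\<^sup>2)" using k1 by (rule mult_left_mono) simp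
  ultimately have "\<bar>c\<bar> * (real k + 1)\<^sup>2 \<le> \<epsilon> / 1000" by linarith
  then show ?thesis using k0 by (simp add: pos_le_divide_eq)
qed

text \<open>All Fourier coefficients of \<open>m''\<close> are small multiples of \<open>\<epsilon>/(k+1)\<^sup>2\<close>: the low ones by the moments, the
others by \<open>fourier_threshold\<close>. Their sum bounds \<open>m''\<close>. Since \<open>m'\<close> has zeros and the mean of \<open>m\<close> is
quadratically small, \<open>m'\<close> and \<open>m\<close> follow by integration.\<close>

lemma C2_small_halves:
  assumes B: "0 \<le> B"
  shows "\<exists>\<epsilon>0>0. \<epsilon>0 \<le> 1 / 100 \<and> (\<forall>m \<epsilon>. \<epsilon> \<le> \<epsilon>0 \<longrightarrow> (\<forall>x. m (x + 2 * pi) = m x) \<longrightarrow> Ck_bounded 11 B m \<longrightarrow>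
     satisfies_moments (\<lambda>x. 1 + m x) \<longrightarrow> C2_small \<epsilon> m \<longrightarrow>
     orbit_sums_small \<epsilon> m \<longrightarrow>
     C2_small (\<epsilon> / 2) m)"
proof -
  define X where "X = 1 + 156800000000 * B"
  have X1: "1 \<le> X" using B by (simp add: X_def)
  \<comment> \<open>The first bound serves the modes up to \<open>2\<close>, the second is the threshold for all others.\<close>
  define \<epsilon>0 where "\<epsilon>0 = min (1 / 10000000) (1 / (5600000 * X ^ 6))"
  have pos: "0 < \<epsilon>0" using X1 by (simp add: \<epsilon>0_def)
  moreover have "C2_small (\<epsilon> / 2) m" if \<epsilon>\<epsilon>0: "\<epsilon> \<le> \<epsilon>0" and per: "\<And>x. m (x + 2 * pi) = m x"
    and Ck: "Ck_bounded 11 B m" and mom: "satisfies_moments (\<lambda>x. 1 + m x)" and small: "C2_small \<epsilon> m"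
    and orbit: "orbit_sums_small \<epsilon> m"
    for m \<epsilon>
  proof (cases "\<epsilon> \<le> 0")
    case True
    have "0 \<le> \<epsilon>" using small[unfolded C2_small_def, rule_format, of 0] by linarith
    with True small show ?thesis by (simp add: C2_small_def)
  next
    case False
    then have \<epsilon>: "0 < \<epsilon>" by simp
    have \<epsilon>7: "\<epsilon> \<le> 1 / 10000000" and \<epsilon>X: "\<epsilon> \<le> 1 / (5600000 * X ^ 6)" using \<epsilon>\<epsilon>0 by (auto simp: \<epsilon>0_def)
    define m1 where "m1 = deriv m"
    define m2 where "m2 = deriv m1"
    have sm: "\<bar>m x\<bar> \<le> \<epsilon>" "\<bar>m1 x\<bar> \<le> \<epsilon>" "\<bar>m2 x\<bar> \<le> \<epsilon>" for x
      using small by (auto simp: C2_small_def m1_def m2_def)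
    have Ck1: "Ck_bounded 10 B m1" and Ck2: "Ck_bounded 9 B m2" and Ck3: "Ck_bounded 8 B (deriv m2)"
      using Ck by (simp_all add: m1_def m2_def eval_nat_numeral)
    have D: "(m has_real_derivative m1 x) (at x)" "(m1 has_real_derivative m2 x) (at x)"
      "(m2 has_real_derivative deriv m2 x) (at x)" for x
      using Ck by (simp_all add: m1_def m2_def eval_nat_numeral)
    have cont: "continuous_on UNIV m" "continuous_on UNIV m1" "continuous_on UNIV m2"
      by (rule DERIV_continuous_on_UNIV, rule D)+
    have per1: "m1 (x + 2 * pi) = m1 x" for x by (rule deriv_periodic[OF D(1) per])
    have per2: "m2 (x + 2 * pi) = m2 x" for x by (rule deriv_periodic[OF D(2) per1])
    have lip: "\<bar>f x - f y\<bar> \<le> C * \<bar>x - y\<bar>" if "\<And>x. (f has_real_derivative f' x) (at x)" "\<And>x. \<bar>f' x\<bar> \<le> C"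
      for f f' :: "real \<Rightarrow> real" and C x y
      using field_differentiable_bound[of UNIV f f' C x y] that by (auto simp: has_field_derivative_at_within)
    define cc where "cc = (\<lambda>k :: nat. integral {0..2 * pi} (\<lambda>x. m2 x * cos (k * x)))"
    define cs where "cs = (\<lambda>k :: nat. integral {0..2 * pi} (\<lambda>x. m2 x * sin (k * x)))"
    have cc1: "cc k = k * integral {0..2 * pi} (\<lambda>x. m1 x * sin (k * x))"
      and cs1: "cs k = - (k * integral {0..2 * pi} (\<lambda>x. m1 x * cos (k * x)))" for k
      unfolding cc_def cs_def by (rule fourier_by_parts[OF D(2) cont(3) per1])+
    have cc0: "cc k = - (k * (k * integral {0..2 * pi} (\<lambda>x. m x * cos (k * x))))"
      and cs0: "cs k = - (k * (k * integral {0..2 * pi} (\<lambda>x. m x * sin (k * x))))" for k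
      unfolding cc1 cs1 using fourier_by_parts[OF D(1) cont(2) per, of k] by simp_all
    note low = low_modes_small[OF cont(1) sm(1) _ mom]
    have e2: "52 * \<epsilon>\<^sup>2 \<le> \<epsilon> / 9000"
    proof -
      have "\<epsilon> * (52 * \<epsilon>) \<le> \<epsilon> * (1 / 9000)" using \<epsilon> \<epsilon>7 by (intro mult_left_mono) auto
      then show ?thesis by (simp add: power2_eq_square)
    qed
    have coeff: "\<bar>cc k\<bar> \<le> \<epsilon> / 1000 / (real k + 1)\<^sup>2 \<and> \<bar>cs k\<bar> \<le> \<epsilon> / 1000 / (real k + 1)\<^sup>2" for k
    proof -
      consider "k = 0" | "k = 1" | "k = 2" | "k \<ge> 3" by linarith
      then show ?thesis
      proof cases
        case 1
        then show ?thesis using \<epsilon> by (simp add: cc0 cs0)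
      next
        case 2
        then show ?thesis using low(2,3) e2 \<epsilon> \<epsilon>7 by (simp add: cc0 cs0)
      next
        case 3
        then show ?thesis using low(4,5) e2 \<epsilon> \<epsilon>7 by (simp add: cc0 cs0 abs_mult)
      next
        case 4
        have trig: "cos (k * (x + 2 * pi / k)) = cos (k * x)" "sin (k * (x + 2 * pi / k)) = sin (k * x)" for x :: real
          using 4 by (simp_all add: distrib_left)
        have step: "k * \<bar>integral {0..2 * pi} (\<lambda>x. m1 x * w x)\<bar> \<le> 1400 * real k ^ 4 * \<epsilon>\<^sup>2"
          if "continuous_on UNIV w" "\<And>x. w (x + 2 * pi / k) = w x" "\<And>x. \<bar>w x\<bar> \<le> 1" for w
        proof -
          have "k * \<bar>integral {0..2 * pi} (\<lambda>x. m1 x * w x)\<bar> \<le> 2 * pi * (200 * real k ^ 4 * \<epsilon>\<^sup>2)"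
            using 4 that orbit by (intro integral_le_orbit_sum cont per1) (auto simp: m1_def orbit_sums_small_def)
          also have "\<dots> \<le> 7 * (200 * real k ^ 4 * \<epsilon>\<^sup>2)" using pi_approx by (intro mult_right_mono) auto
          finally show ?thesis by simp
        qed
        have dyn: "\<bar>cc k\<bar> \<le> 1400 * real k ^ 4 * \<epsilon>\<^sup>2" "\<bar>cs k\<bar> \<le> 1400 * real k ^ 4 * \<epsilon>\<^sup>2"
          unfolding cc1 cs1 abs_mult abs_minus_cancel abs_of_nat using trig by (intro step continuous_intros; simp)+
        have smooth: "real k ^ 9 * \<bar>cc k\<bar> \<le> 7 * B" "real k ^ 9 * \<bar>cs k\<bar> \<le> 7 * B"
          using fourier_decay[OF Ck2 per2, of k] by (simp_all add: cc_def cs_def)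
        show ?thesis
          using fourier_threshold[OF 4 \<epsilon> B dyn(1) smooth(1) X_def \<epsilon>X]
            fourier_threshold[OF 4 \<epsilon> B dyn(2) smooth(2) X_def \<epsilon>X] by blast
      qed
    qed
    have b2: "\<bar>m2 x\<bar> \<le> \<epsilon> / 500" for x
    proof (rule sup_le_sum_fourier_coefficients[where f = m2 and \<Lambda> = B and s = "\<lambda>k. \<epsilon> / 1000 / (real k + 1)\<^sup>2"])
      show "m2 (x + 2 * pi) = m2 x" for x by (rule per2)
      show "\<bar>m2 x - m2 y\<bar> \<le> B * \<bar>x - y\<bar>" for x y
        by (rule lip[OF D(3)]) (rule Ck_bounded_bound[OF Ck3])
      show "\<bar>integral {0..2 * pi} (\<lambda>t. m2 t * cos (real k * t))\<bar> \<le> \<epsilon> / 1000 / (real k + 1)\<^sup>2" for k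
        using coeff[of k] by (simp add: cc_def)
      show "\<bar>integral {0..2 * pi} (\<lambda>t. m2 t * sin (real k * t))\<bar> \<le> \<epsilon> / 1000 / (real k + 1)\<^sup>2" for k
        using coeff[of k] by (simp add: cs_def)
      show "(\<Sum>k<N. \<epsilon> / 1000 / (real k + 1)\<^sup>2) \<le> \<epsilon> / 500" for N
      proof -
        have "(\<Sum>k<N. \<epsilon> / 1000 / (real k + 1)\<^sup>2) = \<epsilon> / 1000 * (\<Sum>k<N. 1 / (real k + 1)\<^sup>2)"
          by (simp add: sum_distrib_left)
        also have "\<dots> \<le> \<epsilon> / 1000 * 2" using \<epsilon> by (intro mult_left_mono sum_inverse_squares_le) auto
        finally show ?thesis by simp
      qed
    qed
    have b1: "\<bar>m1 x\<bar> \<le> \<epsilon> / 70" for x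
    proof -
      obtain z where z: "x < z" "z < x + 2 * pi" "m (x + 2 * pi) - m x = (x + 2 * pi - x) * m1 z"
        using MVT2[of x "x + 2 * pi" m m1] D(1) by auto
      then have "m1 z = 0" by (simp add: per)
      then have "\<bar>m1 x\<bar> \<le> \<epsilon> / 500 * \<bar>x - z\<bar>" using lip[OF D(2) b2, of x z] by simp
      also have "\<dots> \<le> \<epsilon> / 500 * 7" using z pi_approx \<epsilon> by (intro mult_left_mono) auto
      finally show ?thesis using \<epsilon> by simp
    qed
    have b0: "\<bar>m x\<bar> \<le> \<epsilon> / 2" for x
    proof -
      have "\<bar>integral {x..x + 2 * pi} (\<lambda>t. m x - m t)\<bar> \<le> \<epsilon> / 10 * (x + 2 * pi - x)"
      proof (rule abs_integral_le)
        fix t assume t: "t \<in> {x..x + 2 * pi}"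
        have "\<bar>m x - m t\<bar> \<le> \<epsilon> / 70 * \<bar>x - t\<bar>" by (rule lip[OF D(1) b1])
        also have "\<dots> \<le> \<epsilon> / 70 * 7" using t pi_approx \<epsilon> by (intro mult_left_mono) auto
        finally show "\<bar>m x - m t\<bar> \<le> \<epsilon> / 10" by simp
      qed (auto intro!: continuous_intros cont)
      moreover have "integral {x..x + 2 * pi} (\<lambda>t. m x - m t) = 2 * pi * m x - integral {0..2 * pi} m"
        using integral_periodic_shift(1)[OF cont(1) per, of x]
        by (subst integral_diff) (auto intro!: cont_integrable cont)
      moreover have "\<bar>integral {0..2 * pi} m\<bar> \<le> 13 * \<epsilon>\<^sup>2" using low(1) \<epsilon>7 by simp
      moreover have "x + 2 * pi - x = 2 * pi" by simp
      ultimately have "\<bar>2 * pi * m x\<bar> \<le> \<epsilon> / 10 * (2 * pi) + 13 * \<epsilon>\<^sup>2" by (smt (verit))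
      also have "\<dots> \<le> \<epsilon> / 10 * 7 + \<epsilon> / 10" using e2 \<epsilon> pi_approx by (intro add_mono mult_left_mono) auto
      finally have "2 * pi * \<bar>m x\<bar> \<le> \<epsilon>" by (simp add: abs_mult) (use \<epsilon> in linarith)
      moreover have "6 * \<bar>m x\<bar> \<le> 2 * pi * \<bar>m x\<bar>" using pi_gt3 by (intro mult_right_mono) auto
      ultimately show ?thesis using \<epsilon> by simp
    qed
    have "\<bar>m1 x\<bar> \<le> \<epsilon> / 2" "\<bar>m2 x\<bar> \<le> \<epsilon> / 2" for x using b1[of x] b2[of x] \<epsilon> by linarith+
    then show ?thesis using b0 by (simp add: C2_small_def m1_def m2_def)
  qed
  ultimately show ?thesis by (intro exI[of _ \<epsilon>0]) (auto simp: \<epsilon>0_def)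
qed

lemma C2_small_imp_zero:
  assumes B: "0 \<le> B"
  shows "\<exists>\<epsilon>0>0. \<forall>m. (\<forall>x. m (x + 2 * pi) = m x) \<longrightarrow> Ck_bounded 11 B m \<longrightarrow>
     satisfies_moments (\<lambda>x. 1 + m x) \<longrightarrow> C2_small \<epsilon>0 m \<longrightarrow>
     (\<forall>\<epsilon>\<le>1 / 100. C2_small \<epsilon> m \<longrightarrow> orbit_sums_small \<epsilon> m) \<longrightarrow>
     (\<forall>x. m x = 0)"
proof -
  obtain \<epsilon>0 where \<epsilon>0: "\<epsilon>0 > 0" "\<epsilon>0 \<le> 1 / 100" and halve: "\<And>m \<epsilon>. \<epsilon> \<le> \<epsilon>0 \<Longrightarrow> (\<forall>x. m (x + 2 * pi) = m x) \<Longrightarrow> Ck_bounded 11 B m \<Longrightarrow>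
     satisfies_moments (\<lambda>x. 1 + m x) \<Longrightarrow> C2_small \<epsilon> m \<Longrightarrow>
     orbit_sums_small \<epsilon> m \<Longrightarrow>
     C2_small (\<epsilon> / 2) m"
    using C2_small_halves[OF B] by blast
  have "m x = 0" if per: "\<forall>x. m (x + 2 * pi) = m x" and Ck: "Ck_bounded 11 B m"
    and mom: "satisfies_moments (\<lambda>x. 1 + m x)" and small: "C2_small \<epsilon>0 m"
    and orbit: "\<forall>\<epsilon>\<le>1 / 100. C2_small \<epsilon> m \<longrightarrow> orbit_sums_small \<epsilon> m"
    for m x
  proof -
    have n: "C2_small (\<epsilon>0 * (1 / 2) ^ j) m \<and> \<epsilon>0 * (1 / 2) ^ j \<le> \<epsilon>0" for j
    proof (induction j)
      case (Suc j)
      have "C2_small (\<epsilon>0 * (1 / 2) ^ j / 2) m"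
      proof (intro halve per Ck mom)
        have "\<epsilon>0 * (1 / 2) ^ j \<le> 1 / 100" using Suc \<epsilon>0(2) by linarith
        then show "orbit_sums_small (\<epsilon>0 * (1 / 2) ^ j) m" using orbit Suc by blast
      qed (use Suc in blast)+
      then show ?case using Suc \<epsilon>0 by simp
    qed (use small in simp)
    have "(\<lambda>j. \<epsilon>0 * (1 / 2) ^ j) \<longlonglongrightarrow> \<epsilon>0 * 0" by (intro tendsto_intros LIMSEQ_power_zero) simp
    moreover have "\<bar>m x\<bar> \<le> \<epsilon>0 * (1 / 2) ^ j" for j using n[of j] by (simp add: C2_small_def)
    ultimately have "\<bar>m x\<bar> \<le> \<epsilon>0 * 0" by (intro LIMSEQ_le_const) auto
    then show ?thesis by simp
  qed
  then show ?thesis using \<epsilon>0(1) by blast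
qed

text \<open>The difference quotient over a step \<open>h\<close> is of order \<open>sup \<bar>f\<bar> / h\<close> and differs from \<open>f'\<close> by at most
\<open>K h\<close>.\<close>

lemma derivative_interpolation:
  fixes K \<eta> :: real
  assumes "0 \<le> K" "0 < \<eta>"
  shows "\<exists>\<delta>>0. \<forall>f. Ck_bounded 2 K f \<longrightarrow> (\<forall>x. \<bar>f x\<bar> \<le> \<delta>) \<longrightarrow> (\<forall>x. \<bar>deriv f x\<bar> \<le> \<eta>)"
proof -
  \<comment> \<open>Half of \<open>\<eta>\<close> is left for the error \<open>K h\<close>, the other half for the difference quotient.\<close>
  define h where "h = \<eta> / (2 * (K + 1))"
  have h: "h > 0" using assms by (simp add: h_def)
  have Kh: "K * h \<le> \<eta> / 2"
  proof -
    have "(K + 1) * h = \<eta> / 2" using assms by (simp add: h_def field_simps)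
    then show ?thesis using h by (simp add: algebra_simps)
  qed
  have "\<bar>deriv f x\<bar> \<le> \<eta>" if Ck: "Ck_bounded 2 K f" and small: "\<And>x. \<bar>f x\<bar> \<le> \<eta> * h / 4" for f x
  proof -
    have D: "(f has_real_derivative deriv f x) (at x)" "(deriv f has_real_derivative deriv (deriv f) x) (at x)" for x
      using Ck by (simp_all add: eval_nat_numeral)
    have b: "\<bar>deriv (deriv f) x\<bar> \<le> K" for x using Ck by (auto simp: eval_nat_numeral)
    obtain z where z: "x < z" "z < x + h" "f (x + h) - f x = (x + h - x) * deriv f z"
      using MVT2[of x "x + h" f "deriv f"] D(1) h by auto
    have "h * \<bar>deriv f z\<bar> = \<bar>f (x + h) - f x\<bar>" using z h by (simp add: abs_mult)
    also have "\<dots> \<le> \<eta> * h / 4 + \<eta> * h / 4" using small[of "x + h"] small[of x] by linarith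
    also have "\<dots> = h * (\<eta> / 2)" by simp
    finally have "\<bar>deriv f z\<bar> \<le> \<eta> / 2" using h by simp
    moreover have "\<bar>deriv f x - deriv f z\<bar> \<le> K * \<bar>x - z\<bar>"
      using field_differentiable_bound[of UNIV "deriv f" "deriv (deriv f)" K x z] D(2) b
      by (auto simp: has_field_derivative_at_within)
    moreover have "K * \<bar>x - z\<bar> \<le> K * h" using z assms by (intro mult_left_mono) auto
    ultimately show ?thesis using Kh by linarith
  qed
  then show ?thesis using h assms(2) by (intro exI[of _ "\<eta> * h / 4"]) auto
qed

lemma C2_small_interpolation:
  fixes K \<eta> :: real
  assumes "0 \<le> K" "0 < \<eta>"
  shows "\<exists>\<delta>>0. \<forall>f. Ck_bounded 3 K f \<longrightarrow> (\<forall>x. \<bar>f x\<bar> \<le> \<delta>) \<longrightarrow> C2_small \<eta> f"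
proof -
  obtain \<delta>1 where d1: "\<delta>1 > 0" "\<And>f. Ck_bounded 2 K f \<Longrightarrow> (\<forall>x. \<bar>f x\<bar> \<le> \<delta>1) \<Longrightarrow> (\<forall>x. \<bar>deriv f x\<bar> \<le> \<eta>)"
    using derivative_interpolation[OF assms] by metis
  obtain \<delta>2 where d2: "\<delta>2 > 0" "\<And>f. Ck_bounded 2 K f \<Longrightarrow> (\<forall>x. \<bar>f x\<bar> \<le> \<delta>2) \<Longrightarrow> (\<forall>x. \<bar>deriv f x\<bar> \<le> min \<delta>1 \<eta>)"
    using derivative_interpolation[of K "min \<delta>1 \<eta>"] assms d1(1) by (metis min_less_iff_conj)
  have "C2_small \<eta> f" if Ck: "Ck_bounded 3 K f" and small: "\<forall>x. \<bar>f x\<bar> \<le> min \<delta>2 \<eta>" for f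
  proof -
    have a: "Ck_bounded 2 K f" "Ck_bounded 2 K (deriv f)"
      using Ck_bounded_le[OF Ck, of 2] Ck by (simp_all add: eval_nat_numeral)
    have "\<forall>x. \<bar>deriv f x\<bar> \<le> min \<delta>1 \<eta>" using small by (intro d2(2)[OF a(1)]) auto
    moreover then have "\<forall>x. \<bar>deriv (deriv f) x\<bar> \<le> \<eta>" by (intro d1(2)[OF a(2)]) auto
    ultimately show ?thesis using small by (auto simp: C2_small_def)
  qed
  then show ?thesis using d2(1) assms(2) by (intro exI[of _ "min \<delta>2 \<eta>"]) auto
qed

section \<open>Polar coordinates of curves near the circle\<close>

lemma increasing_diffeo_inverse:
  fixes \<psi> \<psi>' :: "real \<Rightarrow> real"
  assumes D: "\<And>x. (\<psi> has_real_derivative \<psi>' x) (at x)" and pos: "\<And>x. 0 < \<psi>' x"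
    and near: "\<And>x. \<bar>\<psi> x - x\<bar> \<le> 2"
  shows "\<exists>h. (\<forall>x. \<psi> (h x) = x) \<and> (\<forall>x. h (\<psi> x) = x) \<and>
    (\<forall>x. (h has_real_derivative inverse (\<psi>' (h x))) (at x))"
proof -
  have mono: "\<psi> x < \<psi> y" if "x < y" for x y
    using that by (rule DERIV_pos_imp_increasing) (use D pos in blast)
  have inj: "inj \<psi>" by (rule injI) (metis mono less_irrefl linorder_neqE_linordered_idom)
  have cont: "isCont \<psi> x" for x using D DERIV_isCont by blast
  have "\<exists>x. \<psi> x = y" for y
  proof -
    have "\<psi> (y - 2) \<le> y" "y \<le> \<psi> (y + 2)" using near[of "y - 2"] near[of "y + 2"] by linarith+
    then have "\<exists>x\<ge>y - 2. x \<le> y + 2 \<and> \<psi> x = y"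
      by (intro IVT') (auto intro!: continuous_at_imp_continuous_on cont)
    then show ?thesis by blast
  qed
  then have surj: "surj \<psi>" by (metis surjI surj_def)
  define h where "h = inv \<psi>"
  have h: "\<psi> (h x) = x" "h (\<psi> x) = x" for x
    using inj surj by (simp_all add: h_def surj_f_inv_f)
  have hcont: "isCont h x" for x
  proof -
    have "isCont h (\<psi> (h x))" by (rule isCont_inverse_function[where d = 1]) (auto simp: h cont)
    then show ?thesis by (simp add: h)
  qed
  have "(h has_real_derivative inverse (\<psi>' (h x))) (at x)" for x
    using pos[of "h x"]
    by (intro DERIV_inverse_function[where f = \<psi> and a = "x - 1" and b = "x + 1"] D hcont) (auto simp: h)
  then show ?thesis using h by blast
qed

lemma integral_substitution_period:
  fixes g \<psi> \<psi>' :: "real \<Rightarrow> real"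
  assumes cont: "continuous_on UNIV g" and per: "\<And>x. g (x + 2 * pi) = g x"
    and D: "\<And>x. (\<psi> has_real_derivative \<psi>' x) (at x)" and \<psi>: "\<psi> (2 * pi) = \<psi> 0 + 2 * pi"
  shows "integral {0..2 * pi} (\<lambda>x. g (\<psi> x) * \<psi>' x) = integral {0..2 * pi} g"
proof -
  obtain G where G: "\<And>x. (G has_real_derivative g x) (at x)" using continuous_antiderivative[OF cont] by blast
  have "((\<lambda>x. G (\<psi> x)) has_real_derivative g (\<psi> x) * \<psi>' x) (at x)" for x
    using DERIV_chain2[OF G D] .
  then have "integral {0..2 * pi} (\<lambda>x. g (\<psi> x) * \<psi>' x) = G (\<psi> (2 * pi)) - G (\<psi> 0)"
    by (rule integral_real_FTC[rotated]) simp
  also have "\<dots> = integral {\<psi> 0..\<psi> 0 + 2 * pi} g"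
    unfolding \<psi> by (rule integral_real_FTC[symmetric, OF _ G]) simp
  also have "\<dots> = integral {0..2 * pi} g" by (rule integral_periodic_shift(1)[OF cont per]) simp
  finally show ?thesis .
qed

text \<open>The new polar angle \<open>\<psi>\<close> differs from the parameter by the arctangent of the quotient of the tangential
and radial parts of \<open>(U, V)\<close>. Its derivative is \<open>W / R2\<close>, the area form of the curve and its velocity
divided by the squared radius, and it is close to \<open>1\<close>. One order of differentiability is lost, because
\<open>\<psi>'\<close> contains derivatives of \<open>U\<close> and \<open>V\<close>.\<close>

lemma polar_coordinates_of_near_circle:
  fixes U V :: "'i \<Rightarrow> real \<Rightarrow> real"
  assumes Ck: "uniformly_Ck 12 I U" "uniformly_Ck 12 I V"
    and per: "\<And>i x. i \<in> I \<Longrightarrow> U i (x + 2 * pi) = U i x" "\<And>i x. i \<in> I \<Longrightarrow> V i (x + 2 * pi) = V i x"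
    and close: "\<And>i x. i \<in> I \<Longrightarrow> \<bar>U i x - cos x\<bar> \<le> 1 / 25" "\<And>i x. i \<in> I \<Longrightarrow> \<bar>V i x - sin x\<bar> \<le> 1 / 25"
      "\<And>i x. i \<in> I \<Longrightarrow> \<bar>deriv (U i) x + sin x\<bar> \<le> 1 / 25" "\<And>i x. i \<in> I \<Longrightarrow> \<bar>deriv (V i) x - cos x\<bar> \<le> 1 / 25"
  shows "\<exists>B. \<forall>i\<in>I. \<exists>m \<psi> \<psi>'. (\<forall>x. m (x + 2 * pi) = m x) \<and> Ck_bounded 11 B m \<and>
     (\<forall>x. 1 + m (\<psi> x) = sqrt ((U i x)\<^sup>2 + (V i x)\<^sup>2)) \<and> surj \<psi> \<and>
     (\<forall>x. (\<psi> has_real_derivative \<psi>' x) (at x)) \<and> (\<forall>x. \<psi> (x + 2 * pi) = \<psi> x + 2 * pi) \<and>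
     (\<forall>x. U i x = (1 + m (\<psi> x)) * cos (\<psi> x) \<and> V i x = (1 + m (\<psi> x)) * sin (\<psi> x) \<and>
       (1 + m (\<psi> x))\<^sup>2 * \<psi>' x = U i x * deriv (V i) x - V i x * deriv (U i) x)"
proof -
  define U' where "U' = (\<lambda>i. deriv (U i))"
  define V' where "V' = (\<lambda>i. deriv (V i))"
  define R2 where "R2 = (\<lambda>i x. U i x * U i x + V i x * V i x)"
  define W where "W = (\<lambda>i x. U i x * V' i x - V i x * U' i x)"
  define P where "P = (\<lambda>i x. W i x * inverse (R2 i x))"
  have DU: "(U i has_real_derivative U' i x) (at x)" and DV: "(V i has_real_derivative V' i x) (at x)"
    if "i \<in> I" for i x
    using uniformly_Ck_SucD(3)[of 11 I U i x] uniformly_Ck_SucD(3)[of 11 I V i x] Ck that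
    by (simp_all add: U'_def V'_def)
  have est: "\<bar>R2 i x - 1\<bar> \<le> 1 / 5 \<and> \<bar>W i x - 1\<bar> \<le> 1 / 5 \<and> U i x * cos x + V i x * sin x \<ge> 1 / 2"
    if i: "i \<in> I" for i x
  proof -
    define u v u' v' where "u = U i x - cos x" and "v = V i x - sin x" and "u' = U' i x + sin x" and "v' = V' i x - cos x"
    have b: "\<bar>u\<bar> \<le> 1 / 25" "\<bar>v\<bar> \<le> 1 / 25" "\<bar>u'\<bar> \<le> 1 / 25" "\<bar>v'\<bar> \<le> 1 / 25"
      using close[OF i, of x] by (simp_all add: u_def v_def u'_def v'_def U'_def V'_def)
    have cs: "\<bar>cos x\<bar> \<le> 1" "\<bar>sin x\<bar> \<le> 1" by auto
    have one: "cos x * cos x + sin x * sin x = 1" using sin_cos_squared_add[of x] by (simp add: power2_eq_square)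
    have uc: "\<bar>u * cos x\<bar> \<le> 1 / 25 * 1" "\<bar>v * sin x\<bar> \<le> 1 / 25 * 1" "\<bar>u * u\<bar> \<le> 1 / 25 * (1 / 25)" "\<bar>v * v\<bar> \<le> 1 / 25 * (1 / 25)"
      "\<bar>cos x * v'\<bar> \<le> 1 * (1 / 25)" "\<bar>u * v'\<bar> \<le> 1 / 25 * (1 / 25)" "\<bar>sin x * u'\<bar> \<le> 1 * (1 / 25)" "\<bar>v * u'\<bar> \<le> 1 / 25 * (1 / 25)"
      using abs_mult_le[OF b(1) cs(1)] abs_mult_le[OF b(2) cs(2)] abs_mult_le[OF b(1) b(1)] abs_mult_le[OF b(2) b(2)]
        abs_mult_le[OF cs(1) b(4)] abs_mult_le[OF b(1) b(4)] abs_mult_le[OF cs(2) b(3)] abs_mult_le[OF b(2) b(3)] .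
    have eU: "U i x = cos x + u" "V i x = sin x + v" "U' i x = u' - sin x" "V' i x = v' + cos x"
      by (simp_all add: u_def v_def u'_def v'_def)
    have "R2 i x - 1 = 2 * (u * cos x) + 2 * (v * sin x) + u * u + v * v"
      unfolding R2_def eU using one by (simp add: algebra_simps)
    moreover have "W i x - 1 = cos x * v' + u * cos x + u * v' - sin x * u' + v * sin x - v * u'"
      unfolding W_def eU using one by (simp add: algebra_simps)
    moreover have "U i x * cos x + V i x * sin x = 1 + u * cos x + v * sin x"
      unfolding eU using one by (simp add: algebra_simps)
    ultimately show ?thesis using uc unfolding abs_le_iff by (intro conjI; linarith)
  qed
  have R2low: "4 / 5 \<le> R2 i x" if "i \<in> I" for i x using est[OF that, of x] by linarith
  have Plow: "1 / 2 \<le> P i x" if i: "i \<in> I" for i x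
  proof -
    have "R2 i x * (1 / 2) \<le> W i x" "R2 i x > 0" using est[OF i, of x] by linarith+
    then show ?thesis by (simp add: P_def field_simps)
  qed
  define \<psi> where "\<psi> = (\<lambda>i x. x + arctan ((V i x * cos x - U i x * sin x) / (U i x * cos x + V i x * sin x)))"
  define r where "r = (\<lambda>i x. sqrt (R2 i x))"
  have polar: "U i x = r i x * cos (\<psi> i x) \<and> V i x = r i x * sin (\<psi> i x)" if i: "i \<in> I" for i x
  proof -
    define p q where "p = U i x * cos x + V i x * sin x" and "q = V i x * cos x - U i x * sin x"
    have one: "cos x * cos x + sin x * sin x = 1" using sin_cos_squared_add[of x] by (simp add: power2_eq_square)
    have p: "p > 0" using est[OF i, of x] by (simp add: p_def)
    have "R2 i x * (cos x * cos x + sin x * sin x) = p\<^sup>2 + q\<^sup>2"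
      unfolding R2_def p_def q_def by algebra
    then have R: "R2 i x = p\<^sup>2 + q\<^sup>2" by (simp add: one)
    have "1 + (q / p)\<^sup>2 = R2 i x / p\<^sup>2" using p by (simp add: R field_simps)
    then have s: "sqrt (1 + (q / p)\<^sup>2) = r i x / p" using p by (simp add: r_def real_sqrt_divide)
    have r: "r i x > 0" using R2low[OF i, of x] by (simp add: r_def)
    have c: "r i x * cos (arctan (q / p)) = p" and sn: "r i x * sin (arctan (q / p)) = q"
      using p r by (simp_all add: cos_arctan sin_arctan s)
    have \<psi>x: "\<psi> i x = x + arctan (q / p)" by (simp add: \<psi>_def p_def q_def)
    have "r i x * cos (\<psi> i x) = cos x * (r i x * cos (arctan (q / p))) - sin x * (r i x * sin (arctan (q / p)))"
      unfolding \<psi>x cos_add by algebra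
    also have "\<dots> = cos x * p - sin x * q" by (simp only: c sn)
    also have "\<dots> = U i x * (cos x * cos x + sin x * sin x)" unfolding p_def q_def by algebra
    finally have a: "r i x * cos (\<psi> i x) = U i x" by (simp add: one)
    have "r i x * sin (\<psi> i x) = sin x * (r i x * cos (arctan (q / p))) + cos x * (r i x * sin (arctan (q / p)))"
      unfolding \<psi>x sin_add by algebra
    also have "\<dots> = sin x * p + cos x * q" by (simp only: c sn)
    also have "\<dots> = V i x * (cos x * cos x + sin x * sin x)" unfolding p_def q_def by algebra
    finally have b: "r i x * sin (\<psi> i x) = V i x" by (simp add: one)
    show ?thesis using a b by simp
  qed
  have D\<psi>: "(\<psi> i has_real_derivative P i x) (at x)" if i: "i \<in> I" for i x
  proof -
    define p q where "p = U i x * cos x + V i x * sin x" and "q = V i x * cos x - U i x * sin x"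
    define p' q' where "p' = U' i x * cos x + V' i x * sin x + q" and "q' = V' i x * cos x - U' i x * sin x - p"
    have one: "cos x * cos x + sin x * sin x = 1" using sin_cos_squared_add[of x] by (simp add: power2_eq_square)
    have p: "p > 0" using est[OF i, of x] by (simp add: p_def)
    have "R2 i x * (cos x * cos x + sin x * sin x) = p\<^sup>2 + q\<^sup>2"
      unfolding R2_def p_def q_def by algebra
    then have R: "R2 i x = p\<^sup>2 + q\<^sup>2" by (simp add: one)
    have Rpos: "R2 i x > 0" using R2low[OF i, of x] by linarith
    have "((\<lambda>x. U i x * cos x + V i x * sin x) has_real_derivative p') (at x)"
      unfolding p'_def q_def by (auto intro!: derivative_eq_intros DU DV i simp: algebra_simps)
    moreover have "((\<lambda>x. V i x * cos x - U i x * sin x) has_real_derivative q') (at x)"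
      unfolding q'_def p_def by (auto intro!: derivative_eq_intros DU DV i simp: algebra_simps)
    ultimately have d: "((\<lambda>x. (V i x * cos x - U i x * sin x) / (U i x * cos x + V i x * sin x)) has_real_derivative
        (q' * p - q * p') / (p * p)) (at x)"
      using p unfolding p_def q_def by (intro DERIV_divide) auto
    have dd: "(\<psi> i has_real_derivative 1 + inverse (1 + (q / p)\<^sup>2) * ((q' * p - q * p') / (p * p))) (at x)"
      unfolding \<psi>_def by (rule DERIV_add[OF DERIV_ident DERIV_chain2[OF DERIV_arctan d, folded p_def q_def]])
    have "1 + (q / p)\<^sup>2 = R2 i x / (p * p)" using p by (simp add: R field_simps power2_eq_square)
    moreover have "inverse (R / (p * p)) * (z / (p * p)) = z / R" for R z :: real
      using p by (simp add: inverse_divide)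
    ultimately have "1 + inverse (1 + (q / p)\<^sup>2) * ((q' * p - q * p') / (p * p)) = 1 + (q' * p - q * p') / R2 i x"
      by (simp only:)
    note calc = this
    have "1 + (q' * p - q * p') / R2 i x = (R2 i x + (q' * p - q * p')) / R2 i x"
      using Rpos by (simp add: field_simps)
    moreover have "R2 i x + (q' * p - q * p') = W i x"
    proof -
      have "p\<^sup>2 + q\<^sup>2 + (q' * p - q * p') = (V' i x * cos x - U' i x * sin x) * p - q * (U' i x * cos x + V' i x * sin x)"
        unfolding p'_def q'_def by algebra
      also have "\<dots> = W i x * (cos x * cos x + sin x * sin x)"
        unfolding p_def q_def W_def by algebra
      finally show ?thesis by (simp add: R one)
    qed
    ultimately show ?thesis using dd unfolding calc by (simp add: P_def divide_inverse)
  qed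
  have near: "\<bar>\<psi> i x - x\<bar> \<le> 2" for i x
    using arctan_bounded[of "(V i x * cos x - U i x * sin x) / (U i x * cos x + V i x * sin x)"] pi_less_4
    unfolding \<psi>_def by (simp add: abs_le_iff)
  have "\<forall>i\<in>I. \<exists>h. (\<forall>x. \<psi> i (h x) = x) \<and> (\<forall>x. h (\<psi> i x) = x) \<and>
    (\<forall>x. (h has_real_derivative inverse (P i (h x))) (at x))"
  proof
    fix i assume i: "i \<in> I"
    have "0 < P i x" for x using Plow[OF i, of x] by linarith
    then show "\<exists>h. (\<forall>x. \<psi> i (h x) = x) \<and> (\<forall>x. h (\<psi> i x) = x) \<and>
    (\<forall>x. (h has_real_derivative inverse (P i (h x))) (at x))"
      by (intro increasing_diffeo_inverse D\<psi> i near)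
  qed
  then obtain h where h: "\<And>i x. i \<in> I \<Longrightarrow> \<psi> i (h i x) = x" "\<And>i x. i \<in> I \<Longrightarrow> h i (\<psi> i x) = x"
    "\<And>i x. i \<in> I \<Longrightarrow> (h i has_real_derivative inverse (P i (h i x))) (at x)"
    by metis
  have Ck11: "uniformly_Ck 11 I U" "uniformly_Ck 11 I V" "uniformly_Ck 11 I U'" "uniformly_Ck 11 I V'"
    using uniformly_Ck_SucD(1,2)[of 11 I U] uniformly_Ck_SucD(1,2)[of 11 I V] Ck by (simp_all add: U'_def V'_def)
  have R2Ck: "uniformly_Ck 11 I R2" unfolding R2_def by (intro uniformly_Ck_add uniformly_Ck_mult Ck11)
  have PCk: "uniformly_Ck 11 I P" unfolding P_def W_def
    using R2low by (intro uniformly_Ck_mult uniformly_Ck_diff Ck11 uniformly_Ck_inverse[OF _ _ R2Ck, of "4 / 5"]) auto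
  have rCk: "uniformly_Ck 11 I (\<lambda>i x. r i x - 1)" unfolding r_def
    using R2low by (intro uniformly_Ck_diff uniformly_Ck_sqrt[OF _ _ R2Ck, of "4 / 5"] uniformly_Ck_const[of _ _ 1]) auto
  define m where "m = (\<lambda>i x. r i (h i x) - 1)"
  have mCk: "uniformly_Ck 11 I m"
    unfolding m_def by (rule uniformly_Ck_compose_inverse[OF _ Plow h(3) PCk rCk]) simp_all
  then obtain B where B: "\<And>i. i \<in> I \<Longrightarrow> Ck_bounded 11 B (m i)" by (auto simp: uniformly_Ck_def)
  have "(\<forall>x. m i (x + 2 * pi) = m i x) \<and> Ck_bounded 11 B (m i) \<and>
     (\<forall>x. 1 + m i (\<psi> i x) = sqrt ((U i x)\<^sup>2 + (V i x)\<^sup>2)) \<and> surj (\<psi> i) \<and>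
     (\<forall>x. (\<psi> i has_real_derivative P i x) (at x)) \<and> (\<forall>x. \<psi> i (x + 2 * pi) = \<psi> i x + 2 * pi) \<and>
     (\<forall>x. U i x = (1 + m i (\<psi> i x)) * cos (\<psi> i x) \<and> V i x = (1 + m i (\<psi> i x)) * sin (\<psi> i x) \<and>
       (1 + m i (\<psi> i x))\<^sup>2 * P i x = U i x * deriv (V i) x - V i x * deriv (U i) x)" if i: "i \<in> I" for i
  proof -
    have mr: "1 + m i (\<psi> i x) = r i x" for x by (simp add: m_def h(2)[OF i])
    have \<psi>per: "\<psi> i (x + 2 * pi) = \<psi> i x + 2 * pi" for x by (simp add: \<psi>_def per i)
    have hper: "h i (x + 2 * pi) = h i x + 2 * pi" for x
      using h(2)[OF i, of "h i x + 2 * pi"] \<psi>per[of "h i x"] h(1)[OF i, of x] by simp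
    have mper: "m i (x + 2 * pi) = m i x" for x by (simp add: m_def hper r_def R2_def per i)
    have surj: "surj (\<psi> i)" using h(1)[OF i] by (metis surjI)
    have rP: "(r i x)\<^sup>2 * P i x = W i x" for x
    proof -
      have "R2 i x > 0" using R2low[OF i, of x] by linarith
      then show ?thesis by (simp add: r_def P_def)
    qed
    show ?thesis
    proof (intro conjI allI)
      show "1 + m i (\<psi> i x) = sqrt ((U i x)\<^sup>2 + (V i x)\<^sup>2)" for x
        unfolding mr r_def R2_def power2_eq_square ..
      show "(1 + m i (\<psi> i x))\<^sup>2 * P i x = U i x * deriv (V i) x - V i x * deriv (U i) x" for x
        unfolding mr rP W_def U'_def V'_def ..
      show "U i x = (1 + m i (\<psi> i x)) * cos (\<psi> i x)" "V i x = (1 + m i (\<psi> i x)) * sin (\<psi> i x)" for x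
        unfolding mr using polar[OF i, of x] by blast+
    qed (rule mper B[OF i] surj D\<psi>[OF i] \<psi>per)+
  qed
  then show ?thesis by blast
qed

section \<open>Normalization of centroid and inertia\<close>

text \<open>First and second moments as integrals over the boundary curve: the form \<open>X Y' - Y X'\<close> is twice the
area swept from the origin. For the unit circle the values are \<open>0\<close> and \<open>\<pi>\<close>.\<close>

definition unit_moments :: "(real \<Rightarrow> real) \<Rightarrow> (real \<Rightarrow> real) \<Rightarrow> (real \<Rightarrow> real) \<Rightarrow> (real \<Rightarrow> real) \<Rightarrow> bool" where
  "unit_moments X X' Y Y' \<longleftrightarrow>
     ((\<lambda>t. X t * (X t * Y' t - Y t * X' t)) has_integral 0) {0..2 * pi} \<and>
     ((\<lambda>t. Y t * (X t * Y' t - Y t * X' t)) has_integral 0) {0..2 * pi} \<and>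
     ((\<lambda>t. X t * X t * (X t * Y' t - Y t * X' t)) has_integral pi) {0..2 * pi} \<and>
     ((\<lambda>t. X t * Y t * (X t * Y' t - Y t * X' t)) has_integral 0) {0..2 * pi} \<and>
     ((\<lambda>t. Y t * Y t * (X t * Y' t - Y t * X' t)) has_integral pi) {0..2 * pi}"

text \<open>Translating the curve changes the integrand by exact derivatives and by multiples of \<open>I0\<close> and of the
integral of \<open>x y'\<close>, which is half of \<open>I0\<close>. The factor \<open>2/3\<close> relates boundary to area moments.\<close>

lemma centroid_moments:
  fixes x y x' y' :: "real \<Rightarrow> real"
  assumes D: "\<And>t. (x has_real_derivative x' t) (at t)" "\<And>t. (y has_real_derivative y' t) (at t)"
    and per: "x (2 * pi) = x 0" "y (2 * pi) = y 0"
    and I0: "((\<lambda>t. x t * y' t - y t * x' t) has_integral I0) {0..2 * pi}" "I0 \<noteq> 0"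
    and Ix: "((\<lambda>t. x t * (x t * y' t - y t * x' t)) has_integral Ix) {0..2 * pi}"
    and Iy: "((\<lambda>t. y t * (x t * y' t - y t * x' t)) has_integral Iy) {0..2 * pi}"
  defines "c1 \<equiv> 2 * Ix / (3 * I0)" and "c2 \<equiv> 2 * Iy / (3 * I0)"
  shows "((\<lambda>t. (x t - c1) * ((x t - c1) * y' t - (y t - c2) * x' t)) has_integral 0) {0..2 * pi}"
    "((\<lambda>t. (y t - c2) * ((x t - c1) * y' t - (y t - c2) * x' t)) has_integral 0) {0..2 * pi}"
proof -
  have ftc: "(f has_integral 0) {0..2 * pi}"
    if "\<And>t. (F has_real_derivative f t) (at t)" "F (2 * pi) = F 0" for f F :: "real \<Rightarrow> real"
  proof -
    have "(f has_integral (F (2 * pi) - F 0)) {0..2 * pi}"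
      using that(1) by (intro fundamental_theorem_of_calculus)
        (auto simp: has_real_derivative_iff_has_vector_derivative has_vector_derivative_at_within)
    then show ?thesis using that(2) by simp
  qed
  have zx: "(x' has_integral 0) {0..2 * pi}" and zy: "(y' has_integral 0) {0..2 * pi}"
    using ftc[OF D(1) per(1)] ftc[OF D(2) per(2)] .
  have zxx: "((\<lambda>t. x t * x' t) has_integral 0) {0..2 * pi}"
    by (rule ftc[where F = "\<lambda>t. x t * x t / 2"]) (auto intro!: derivative_eq_intros D simp: per)
  have zyy: "((\<lambda>t. y t * y' t) has_integral 0) {0..2 * pi}"
    by (rule ftc[where F = "\<lambda>t. y t * y t / 2"]) (auto intro!: derivative_eq_intros D simp: per)
  have zxy: "((\<lambda>t. x t * y' t + y t * x' t) has_integral 0) {0..2 * pi}"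
    by (rule ftc[where F = "\<lambda>t. x t * y t"]) (auto intro!: derivative_eq_intros D simp: per)
  have hxy: "((\<lambda>t. x t * y' t) has_integral (1 / 2) * (I0 + 0)) {0..2 * pi}"
    using has_integral_mult_right[OF has_integral_add[OF I0(1) zxy], of "1 / 2"] by simp
  have hyx: "((\<lambda>t. y t * x' t) has_integral (1 / 2) * (0 - I0)) {0..2 * pi}"
    using has_integral_mult_right[OF has_integral_diff[OF zxy I0(1)], of "1 / 2"] by (simp add: field_simps)
  have "((\<lambda>t. x t * (x t * y' t - y t * x' t) - c1 * (x t * y' t) + c2 * (x t * x' t)
      - c1 * (x t * y' t - y t * x' t) + c1 * c1 * y' t - c1 * c2 * x' t) has_integral
      (Ix - c1 * (1 / 2 * (I0 + 0)) + c2 * 0 - c1 * I0 + c1 * c1 * 0 - c1 * c2 * 0)) {0..2 * pi}"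
    by (intro has_integral_add has_integral_diff has_integral_mult_right I0(1) Ix hxy zxx zx zy)
  moreover have "Ix - c1 * (1 / 2 * (I0 + 0)) + c2 * 0 - c1 * I0 + c1 * c1 * 0 - c1 * c2 * 0 = 0"
    using I0(2) by (simp add: c1_def field_simps)
  moreover have "(x t - c1) * ((x t - c1) * y' t - (y t - c2) * x' t) = x t * (x t * y' t - y t * x' t) - c1 * (x t * y' t) + c2 * (x t * x' t)
      - c1 * (x t * y' t - y t * x' t) + c1 * c1 * y' t - c1 * c2 * x' t" for t
    by algebra
  ultimately show "((\<lambda>t. (x t - c1) * ((x t - c1) * y' t - (y t - c2) * x' t)) has_integral 0) {0..2 * pi}"
    by (simp only:)
  have "((\<lambda>t. y t * (x t * y' t - y t * x' t) - c1 * (y t * y' t) + c2 * (y t * x' t)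
      - c2 * (x t * y' t - y t * x' t) + c1 * c2 * y' t - c2 * c2 * x' t) has_integral
      (Iy - c1 * 0 + c2 * (1 / 2 * (0 - I0)) - c2 * I0 + c1 * c2 * 0 - c2 * c2 * 0)) {0..2 * pi}"
    by (intro has_integral_add has_integral_diff has_integral_mult_right I0(1) Iy hyx zyy zx zy)
  moreover have "Iy - c1 * 0 + c2 * (1 / 2 * (0 - I0)) - c2 * I0 + c1 * c2 * 0 - c2 * c2 * 0 = 0"
    using I0(2) by (simp add: c2_def field_simps)
  moreover have "(y t - c2) * ((x t - c1) * y' t - (y t - c2) * x' t) = y t * (x t * y' t - y t * x' t) - c1 * (y t * y' t) + c2 * (y t * x' t)
      - c2 * (x t * y' t - y t * x' t) + c1 * c2 * y' t - c2 * c2 * x' t" for t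
    by algebra
  ultimately show "((\<lambda>t. (y t - c2) * ((x t - c1) * y' t - (y t - c2) * x' t)) has_integral 0) {0..2 * pi}"
    by (simp only:)
qed

text \<open>The linear map is a triangular inverse square root of the inertia matrix. Its determinant \<open>1/d\<close> also
multiplies the area form, which is why a fourth root of the determinant of that matrix occurs.\<close>

lemma inertia_moments:
  fixes X Y X' Y' :: "real \<Rightarrow> real" and a b c :: real
  defines "W \<equiv> \<lambda>t. X t * Y' t - Y t * X' t"
  assumes zero: "((\<lambda>t. X t * W t) has_integral 0) {0..2 * pi}" "((\<lambda>t. Y t * W t) has_integral 0) {0..2 * pi}"
    and abc: "((\<lambda>t. X t * X t * W t) has_integral pi * a) {0..2 * pi}"
      "((\<lambda>t. X t * Y t * W t) has_integral pi * b) {0..2 * pi}"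
      "((\<lambda>t. Y t * Y t * W t) has_integral pi * c) {0..2 * pi}"
    and pos: "a > 0" "a * c - b\<^sup>2 > 0"
  defines "d \<equiv> sqrt (sqrt (a * c - b\<^sup>2))"
  defines "e1 \<equiv> sqrt (d / a)" defines "e3 \<equiv> 1 / (d * e1)" defines "e2 \<equiv> e3 * b / a"
  shows "unit_moments (\<lambda>t. e1 * X t) (\<lambda>t. e1 * X' t) (\<lambda>t. e3 * Y t - e2 * X t) (\<lambda>t. e3 * Y' t - e2 * X' t)"
proof -
  have d: "d > 0" using pos(2) by (simp add: d_def)
  have d2: "d\<^sup>2 = sqrt (a * c - b\<^sup>2)" using pos(2) by (simp add: d_def)
  have "(d\<^sup>2)\<^sup>2 = a * c - b\<^sup>2" unfolding d2 using pos(2) by simp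
  then have d4: "d ^ 4 = a * c - b\<^sup>2" by simp
  have e1: "e1 > 0" "e1\<^sup>2 = d / a" using d pos(1) by (simp_all add: e1_def)
  have e3: "e3 > 0" "e1 * e3 = 1 / d" using d e1 by (simp_all add: e3_def)
  have W: "(e1 * X t) * (e3 * Y' t - e2 * X' t) - (e3 * Y t - e2 * X t) * (e1 * X' t) = (1 / d) * W t" for t
    unfolding W_def e3(2)[symmetric] by (simp add: algebra_simps)
  have "((\<lambda>t. (e1 / d) * (X t * W t)) has_integral (e1 / d) * 0) {0..2 * pi}"
    by (intro has_integral_mult_right zero)
  moreover have "((\<lambda>t. (e3 / d) * (Y t * W t) - (e2 / d) * (X t * W t)) has_integral (e3 / d) * 0 - (e2 / d) * 0) {0..2 * pi}"
    by (intro has_integral_diff has_integral_mult_right zero)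
  moreover have "((\<lambda>t. (e1\<^sup>2 / d) * (X t * X t * W t)) has_integral pi) {0..2 * pi}"
  proof -
    have "e1\<^sup>2 / d * (pi * a) = pi" using e1(2) d pos(1) by simp
    then show ?thesis using has_integral_mult_right[OF abc(1), of "e1\<^sup>2 / d"] by (simp only:)
  qed
  moreover have "((\<lambda>t. (e1 * e3 / d) * (X t * Y t * W t) - (e1 * e2 / d) * (X t * X t * W t)) has_integral 0) {0..2 * pi}"
  proof -
    have "e1 * e3 / d * (pi * b) - e1 * e2 / d * (pi * a) = 0" using pos(1) by (simp add: e2_def)
    then show ?thesis
      using has_integral_diff[OF has_integral_mult_right[OF abc(2), of "e1 * e3 / d"]
          has_integral_mult_right[OF abc(1), of "e1 * e2 / d"]] by (simp only:)
  qed
  moreover have "((\<lambda>t. (e3\<^sup>2 / d) * (Y t * Y t * W t) - (2 * e2 * e3 / d) * (X t * Y t * W t) + (e2\<^sup>2 / d) * (X t * X t * W t))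
       has_integral pi) {0..2 * pi}"
  proof -
    have "e3\<^sup>2 = 1 / (d\<^sup>2 * e1\<^sup>2)" by (simp add: e3_def power_divide power_mult_distrib)
    also have "\<dots> = a / d ^ 3" using e1(2) d pos(1) by (simp add: power2_eq_square power3_eq_cube)
    finally have e3sq: "e3\<^sup>2 = a / d ^ 3" .
    have "e3\<^sup>2 / d * (pi * c) - 2 * e2 * e3 / d * (pi * b) + e2\<^sup>2 / d * (pi * a) = pi * e3\<^sup>2 / d * (c - b\<^sup>2 / a)"
      using pos(1) d by (simp add: e2_def power2_eq_square field_simps)
    also have "c - b\<^sup>2 / a = d ^ 4 / a" unfolding d4 using pos(1) by (simp add: field_simps)
    also have "pi * e3\<^sup>2 / d * (d ^ 4 / a) = pi"
      unfolding e3sq using d pos(1) by (simp add: power_numeral_reduce)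
    finally show ?thesis
      using has_integral_add[OF has_integral_diff[OF has_integral_mult_right[OF abc(3), of "e3\<^sup>2 / d"]
          has_integral_mult_right[OF abc(2), of "2 * e2 * e3 / d"]] has_integral_mult_right[OF abc(1), of "e2\<^sup>2 / d"]]
      by (simp only:)
  qed
  ultimately show ?thesis
    unfolding unit_moments_def W by (simp add: algebra_simps power2_eq_square diff_divide_distrib add_divide_distrib)
qed

lemma inertia_factor_continuous:
  assumes "\<eta> > (0 :: real)"
  shows "\<exists>\<sigma>>0. \<sigma> \<le> 1 / 10 \<and> (\<forall>a b c. \<bar>a - 1\<bar> \<le> \<sigma> \<longrightarrow> \<bar>b\<bar> \<le> \<sigma> \<longrightarrow> \<bar>c - 1\<bar> \<le> \<sigma> \<longrightarrow>
     \<bar>sqrt (sqrt (sqrt (a * c - b\<^sup>2)) / a) - 1\<bar> \<le> \<eta> \<and>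
     \<bar>1 / (sqrt (sqrt (a * c - b\<^sup>2)) * sqrt (sqrt (sqrt (a * c - b\<^sup>2)) / a)) - 1\<bar> \<le> \<eta> \<and>
     \<bar>1 / (sqrt (sqrt (a * c - b\<^sup>2)) * sqrt (sqrt (sqrt (a * c - b\<^sup>2)) / a)) * b / a\<bar> \<le> \<eta>)"
proof -
  define d where "d = (\<lambda>z :: real \<times> real \<times> real. sqrt (sqrt (fst z * snd (snd z) - (fst (snd z))\<^sup>2)))"
  define e1 where "e1 = (\<lambda>z. sqrt (d z / fst z))"
  define e3 where "e3 = (\<lambda>z. 1 / (d z * e1 z))"
  define e2 where "e2 = (\<lambda>z. e3 z * fst (snd z) / fst z)"
  have "isCont d (1, 0, 1)" unfolding d_def by (intro continuous_intros)
  then have "isCont e1 (1, 0, 1)" unfolding e1_def by (intro continuous_intros) auto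
  then have "isCont e3 (1, 0, 1)" unfolding e3_def using \<open>isCont d (1, 0, 1)\<close>
    by (intro continuous_intros) (auto simp: d_def e1_def)
  then have "isCont e2 (1, 0, 1)" unfolding e2_def by (intro continuous_intros) auto
  have v: "e1 (1, 0, 1) = 1" "e3 (1, 0, 1) = 1" "e2 (1, 0, 1) = 0" by (auto simp: e1_def e3_def e2_def d_def)
  have "\<exists>r>0. \<forall>z. dist z (1, 0, 1) < r \<longrightarrow> \<bar>F z - F (1, 0, 1)\<bar> < \<eta>" if "isCont F (1, 0, 1)"
    for F :: "real \<times> real \<times> real \<Rightarrow> real"
    using that assms unfolding continuous_at_eps_delta dist_real_def by blast
  then obtain r1 r2 r3 where r: "r1 > 0" "r2 > 0" "r3 > 0"
    and c: "\<And>z. dist z (1, 0, 1) < r1 \<Longrightarrow> \<bar>e1 z - 1\<bar> < \<eta>"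
      "\<And>z. dist z (1, 0, 1) < r2 \<Longrightarrow> \<bar>e3 z - 1\<bar> < \<eta>" "\<And>z. dist z (1, 0, 1) < r3 \<Longrightarrow> \<bar>e2 z\<bar> < \<eta>"
    using \<open>isCont e1 (1, 0, 1)\<close> \<open>isCont e2 (1, 0, 1)\<close> \<open>isCont e3 (1, 0, 1)\<close> v by (metis diff_zero)
  define \<sigma> where "\<sigma> = min (1 / 10) (min r1 (min r2 r3) / 4)"
  have s: "\<sigma> > 0" "\<sigma> \<le> 1 / 10" "3 * \<sigma> < r1" "3 * \<sigma> < r2" "3 * \<sigma> < r3" using r by (auto simp: \<sigma>_def)
  have "\<bar>e1 (a, b, c) - 1\<bar> \<le> \<eta> \<and> \<bar>e3 (a, b, c) - 1\<bar> \<le> \<eta> \<and> \<bar>e2 (a, b, c)\<bar> \<le> \<eta>"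
    if "\<bar>a - 1\<bar> \<le> \<sigma>" "\<bar>b\<bar> \<le> \<sigma>" "\<bar>c - 1\<bar> \<le> \<sigma>" for a b c
  proof -
    have "dist (b, c) (0, 1) \<le> dist b 0 + dist c 1"
      unfolding dist_Pair_Pair by (intro sqrt_sum_squares_le_sum) auto
    moreover have "dist (a, b, c) (1, 0, 1) \<le> dist a 1 + dist (b, c) (0, 1)"
      unfolding dist_Pair_Pair[of a "(b, c)"] by (intro sqrt_sum_squares_le_sum) auto
    ultimately have "dist (a, b, c) (1, 0, 1) \<le> 3 * \<sigma>" using that by (simp add: dist_real_def)
    then show ?thesis using c[of "(a, b, c)"] s by (auto intro: less_imp_le)
  qed
  then show ?thesis using s(1,2) by (intro exI[of _ \<sigma>]) (simp add: e1_def e2_def e3_def d_def)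
qed

lemma mult_close:
  fixes f g f0 g0 :: real
  assumes "\<bar>f\<bar> \<le> F" "\<bar>g0\<bar> \<le> G" "\<bar>f - f0\<bar> \<le> \<alpha>" "\<bar>g - g0\<bar> \<le> \<beta>"
  shows "\<bar>f * g - f0 * g0\<bar> \<le> F * \<beta> + \<alpha> * G"
proof -
  have "f * g - f0 * g0 = f * (g - g0) + (f - f0) * g0" by (simp add: algebra_simps)
  then show ?thesis using abs_mult_le[OF assms(1,4)] abs_mult_le[OF assms(3,2)] by linarith
qed

lemma integral_close:
  fixes f g :: "real \<Rightarrow> real"
  assumes "continuous_on UNIV f" "(g has_integral v) {0..2 * pi}" "continuous_on UNIV g"
    and "\<And>t. \<bar>f t - g t\<bar> \<le> C"
  shows "\<exists>w. (f has_integral w) {0..2 * pi} \<and> \<bar>w - v\<bar> \<le> 7 * C"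
proof -
  have f: "(f has_integral integral {0..2 * pi} f) {0..2 * pi}"
    using cont_integrable[OF assms(1)] by (rule integrable_integral)
  from has_integral_diff[OF f assms(2)]
  have "integral {0..2 * pi} (\<lambda>t. f t - g t) = integral {0..2 * pi} f - v" by (rule integral_unique)
  moreover have "\<bar>integral {0..2 * pi} (\<lambda>t. f t - g t)\<bar> \<le> C * (2 * pi - 0)"
    using assms by (intro abs_integral_le continuous_intros) auto
  moreover have "C * (2 * pi - 0) \<le> C * 7"
    using assms(4)[of 0] pi_approx by (intro mult_left_mono) auto
  ultimately show ?thesis using f by (intro exI[of _ "integral {0..2 * pi} f"]) auto
qed

lemma trig_integrals:
  "(cos has_integral (0 :: real)) {0..2 * pi}" "(sin has_integral (0 :: real)) {0..2 * pi}"
  "((\<lambda>t :: real. cos t * cos t * 1) has_integral pi) {0..2 * pi}" "((\<lambda>t :: real. cos t * sin t * 1) has_integral 0) {0..2 * pi}"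
  "((\<lambda>t :: real. sin t * sin t * 1) has_integral pi) {0..2 * pi}"
proof -
  have ftc: "(f has_integral (F (2 * pi) - F 0)) {0..2 * pi}"
    if "\<And>t. (F has_real_derivative f t) (at t)" for f F :: "real \<Rightarrow> real"
    using that by (intro fundamental_theorem_of_calculus)
      (auto simp: has_real_derivative_iff_has_vector_derivative has_vector_derivative_at_within)
  have sq: "sin t * sin t = 1 - cos t * cos t" for t :: real
    using sin_cos_squared_add[of t] by (simp add: power2_eq_square)
  have "((\<lambda>t :: real. t / 2 + sin t * cos t / 2) has_real_derivative cos t * cos t * 1) (at t)"
    "((\<lambda>t :: real. t / 2 - sin t * cos t / 2) has_real_derivative sin t * sin t * 1) (at t)"
    "((\<lambda>t :: real. sin t * sin t / 2) has_real_derivative cos t * sin t * 1) (at t)" for t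
    by (auto intro!: derivative_eq_intros simp: sq field_simps)
  note D = this[THEN ftc]
  show "((\<lambda>t :: real. cos t * cos t * 1) has_integral pi) {0..2 * pi}" "((\<lambda>t :: real. cos t * sin t * 1) has_integral 0) {0..2 * pi}"
    "((\<lambda>t :: real. sin t * sin t * 1) has_integral pi) {0..2 * pi}"
    using D by simp_all
  have "(sin has_real_derivative cos t) (at t)" "((\<lambda>t. - cos t) has_real_derivative sin t) (at t)" for t :: real
    by (auto intro!: derivative_eq_intros)
  note D = this[THEN ftc]
  show "(cos has_integral (0 :: real)) {0..2 * pi}" "(sin has_integral (0 :: real)) {0..2 * pi}"
    using D by simp_all
qed

text \<open>A small deformation has moments close to those of the circle, so the normalizing affine map is close
to the identity, by continuity of the explicit formulas.\<close>

lemma near_circle_normalization: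
  assumes \<eta>: "0 < \<eta>"
  shows "\<exists>\<delta>>0. \<forall>n n'. (\<forall>t. (n has_real_derivative n' t) (at t)) \<longrightarrow> continuous_on UNIV n' \<longrightarrow>
    (\<forall>t. n (t + 2 * pi) = n t) \<longrightarrow> (\<forall>t. \<bar>n t\<bar> \<le> \<delta> \<and> \<bar>n' t\<bar> \<le> \<delta>) \<longrightarrow>
    (\<exists>c1 c2 e1 e2 e3. \<bar>c1\<bar> \<le> \<eta> \<and> \<bar>c2\<bar> \<le> \<eta> \<and> \<bar>e1 - 1\<bar> \<le> \<eta> \<and> \<bar>e2\<bar> \<le> \<eta> \<and> \<bar>e3 - 1\<bar> \<le> \<eta> \<and>
      unit_moments (\<lambda>t. e1 * ((1 + n t) * cos t - c1)) (\<lambda>t. e1 * (n' t * cos t - (1 + n t) * sin t))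
        (\<lambda>t. e3 * ((1 + n t) * sin t - c2) - e2 * ((1 + n t) * cos t - c1))
        (\<lambda>t. e3 * (n' t * sin t + (1 + n t) * cos t) - e2 * (n' t * cos t - (1 + n t) * sin t)))"
proof -
  obtain \<sigma> where \<sigma>: "\<sigma> > 0" "\<sigma> \<le> 1 / 10" and fac: "\<And>a b c. \<bar>a - 1\<bar> \<le> \<sigma> \<Longrightarrow> \<bar>b\<bar> \<le> \<sigma> \<Longrightarrow> \<bar>c - 1\<bar> \<le> \<sigma> \<Longrightarrow>
     \<bar>sqrt (sqrt (sqrt (a * c - b\<^sup>2)) / a) - 1\<bar> \<le> \<eta> \<and>
     \<bar>1 / (sqrt (sqrt (a * c - b\<^sup>2)) * sqrt (sqrt (sqrt (a * c - b\<^sup>2)) / a)) - 1\<bar> \<le> \<eta> \<and>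
     \<bar>1 / (sqrt (sqrt (a * c - b\<^sup>2)) * sqrt (sqrt (sqrt (a * c - b\<^sup>2)) / a)) * b / a\<bar> \<le> \<eta>"
    using inertia_factor_continuous[OF \<eta>] by blast
  \<comment> \<open>The centroid moves by at most \<open>7\<delta>\<close>, the entries of the inertia matrix, divided by \<open>\<pi>\<close>, by at most \<open>350\<delta>\<close>.\<close>
  define \<delta> where "\<delta> = min (\<sigma> / 350) (\<eta> / 7)"
  have \<delta>: "\<delta> > 0" "350 * \<delta> \<le> \<sigma>" "7 * \<delta> \<le> \<eta>" "\<delta> \<le> 1 / 1000" using \<sigma> \<eta> by (auto simp: \<delta>_def)
  have "\<exists>c1 c2 e1 e2 e3. \<bar>c1\<bar> \<le> \<eta> \<and> \<bar>c2\<bar> \<le> \<eta> \<and> \<bar>e1 - 1\<bar> \<le> \<eta> \<and> \<bar>e2\<bar> \<le> \<eta> \<and> \<bar>e3 - 1\<bar> \<le> \<eta> \<and>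
      unit_moments (\<lambda>t. e1 * ((1 + n t) * cos t - c1)) (\<lambda>t. e1 * (n' t * cos t - (1 + n t) * sin t))
        (\<lambda>t. e3 * ((1 + n t) * sin t - c2) - e2 * ((1 + n t) * cos t - c1))
        (\<lambda>t. e3 * (n' t * sin t + (1 + n t) * cos t) - e2 * (n' t * cos t - (1 + n t) * sin t))"
    if Dn: "\<And>t. (n has_real_derivative n' t) (at t)" and cn': "continuous_on UNIV n'"
      and per: "\<And>t. n (t + 2 * pi) = n t" and small: "\<And>t. \<bar>n t\<bar> \<le> \<delta> \<and> \<bar>n' t\<bar> \<le> \<delta>" for n n'
  proof -
    define x y x' y' where "x = (\<lambda>t. (1 + n t) * cos t)" and "y = (\<lambda>t. (1 + n t) * sin t)"
      and "x' = (\<lambda>t. n' t * cos t - (1 + n t) * sin t)" and "y' = (\<lambda>t. n' t * sin t + (1 + n t) * cos t)"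
    have cn: "continuous_on UNIV n" using Dn by (rule DERIV_continuous_on_UNIV)
    have D: "(x has_real_derivative x' t) (at t)" "(y has_real_derivative y' t) (at t)" for t
      unfolding x_def y_def x'_def y'_def by (auto intro!: derivative_eq_intros Dn)
    have cont: "continuous_on UNIV x" "continuous_on UNIV y" "continuous_on UNIV x'" "continuous_on UNIV y'"
      unfolding x_def y_def x'_def y'_def by (intro continuous_intros cn cn')+
    have pxy: "x (2 * pi) = x 0" "y (2 * pi) = y 0" using per[of 0] by (simp_all add: x_def y_def)
    have cs: "\<bar>cos t\<bar> \<le> 1" "\<bar>sin t\<bar> \<le> 1" for t :: real by auto
    have one: "cos t * cos t + sin t * sin t = 1" for t :: real
      using sin_cos_squared_add[of t] by (simp add: power2_eq_square)
    have xc: "\<bar>x t - cos t\<bar> \<le> \<delta>" "\<bar>y t - sin t\<bar> \<le> \<delta>" for t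
      using abs_mult_le[OF conjunct1[OF small[of t]] cs(1)[of t]] abs_mult_le[OF conjunct1[OF small[of t]] cs(2)[of t]]
      by (simp_all add: x_def y_def algebra_simps)
    have xb: "\<bar>x t\<bar> \<le> 2" "\<bar>y t\<bar> \<le> 2" for t using xc[of t] cs[of t] \<delta>(4) by linarith+
    have x'b: "\<bar>x' t\<bar> \<le> 2" "\<bar>y' t\<bar> \<le> 2" for t
    proof -
      have "\<bar>n' t\<bar> \<le> 1 / 2" "\<bar>1 + n t\<bar> \<le> 3 / 2" using small[of t] \<delta>(4) by linarith+
      note b = abs_mult_le[OF this(1) cs(1)[of t]] abs_mult_le[OF this(1) cs(2)[of t]]
        abs_mult_le[OF this(2) cs(1)[of t]] abs_mult_le[OF this(2) cs(2)[of t]]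
      show "\<bar>x' t\<bar> \<le> 2" "\<bar>y' t\<bar> \<le> 2" unfolding x'_def y'_def using b by linarith+
    qed
    define \<omega> where "\<omega> = (\<lambda>t. x t * y' t - y t * x' t)"
    have c\<omega>: "continuous_on UNIV \<omega>" unfolding \<omega>_def by (intro continuous_intros cont)
    have "\<omega> t = (1 + n t) * (1 + n t) * (cos t * cos t + sin t * sin t)" for t
      unfolding \<omega>_def x_def y_def x'_def y'_def by algebra
    then have \<omega>n: "\<omega> t = (1 + n t) * (1 + n t)" for t by (simp add: one)
    have \<omega>1: "\<bar>\<omega> t - 1\<bar> \<le> 3 * \<delta>" for t
    proof -
      have "\<omega> t - 1 = 2 * n t + n t * n t" by (simp add: \<omega>n algebra_simps)
      moreover have "\<bar>n t * n t\<bar> \<le> \<delta> * 1" using small[of t] \<delta>(4) by (intro abs_mult_le) auto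
      ultimately show ?thesis using small[of t] by linarith
    qed
    have "((\<lambda>t :: real. 1) has_integral 2 * pi) {0..2 * pi}"
      using has_integral_const_real[of "1 :: real" 0 "2 * pi"] by simp
    from integral_close[OF c\<omega> this _ \<omega>1]
    obtain I0 where I0: "(\<omega> has_integral I0) {0..2 * pi}" "\<bar>I0 - 2 * pi\<bar> \<le> 7 * (3 * \<delta>)" by auto
    have I05: "I0 \<ge> 5" using I0(2) pi_gt3 \<delta>(4) by linarith
    have ccs: "continuous_on UNIV (cos :: real \<Rightarrow> real)" "continuous_on UNIV (sin :: real \<Rightarrow> real)"
      by (rule continuous_at_imp_continuous_on, simp)+
    have first: "\<bar>z t * \<omega> t - z0 t * 1\<bar> \<le> 7 * \<delta>" if "\<bar>z t\<bar> \<le> 2" "\<bar>z t - z0 t\<bar> \<le> \<delta>" for z z0 :: "real \<Rightarrow> real" and t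
      using mult_close[OF that(1) _ that(2) \<omega>1[of t], of 1] by simp
    have "continuous_on UNIV (\<lambda>t. x t * \<omega> t)" by (intro continuous_intros cont c\<omega>)
    from integral_close[OF this trig_integrals(1) ccs(1), of "7 * \<delta>"] first[of x _ cos] xb xc
    obtain Ix where Ix: "((\<lambda>t. x t * \<omega> t) has_integral Ix) {0..2 * pi}" "\<bar>Ix\<bar> \<le> 49 * \<delta>"
      by auto
    have "continuous_on UNIV (\<lambda>t. y t * \<omega> t)" by (intro continuous_intros cont c\<omega>)
    from integral_close[OF this trig_integrals(2) ccs(2), of "7 * \<delta>"] first[of y _ sin] xb xc
    obtain Iy where Iy: "((\<lambda>t. y t * \<omega> t) has_integral Iy) {0..2 * pi}" "\<bar>Iy\<bar> \<le> 49 * \<delta>"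
      by auto
    define c1 c2 where "c1 = 2 * Ix / (3 * I0)" and "c2 = 2 * Iy / (3 * I0)"
    have "\<bar>2 * I / (3 * I0)\<bar> \<le> 7 * \<delta>" if "\<bar>I\<bar> \<le> 49 * \<delta>" for I
    proof -
      have "2 * \<bar>I\<bar> \<le> 7 * \<delta> * (3 * 5)" using that \<delta>(1) by linarith
      also have "\<dots> \<le> 7 * \<delta> * (3 * I0)" using I05 \<delta>(1) by (intro mult_left_mono) auto
      finally show ?thesis using I05 by (simp add: abs_divide abs_mult pos_divide_le_eq)
    qed
    then have c: "\<bar>c1\<bar> \<le> 7 * \<delta>" "\<bar>c2\<bar> \<le> 7 * \<delta>" using Ix Iy by (simp_all add: c1_def c2_def)
    define X Y where "X = (\<lambda>t. x t - c1)" and "Y = (\<lambda>t. y t - c2)"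
    define W where "W = (\<lambda>t. X t * y' t - Y t * x' t)"
    note cen = centroid_moments[OF D pxy I0(1)[unfolded \<omega>_def] _ Ix(1)[unfolded \<omega>_def] Iy(1)[unfolded \<omega>_def],
        folded c1_def c2_def]
    have zero: "((\<lambda>t. X t * W t) has_integral 0) {0..2 * pi}" "((\<lambda>t. Y t * W t) has_integral 0) {0..2 * pi}"
      using cen I05 by (auto simp: X_def Y_def W_def)
    have cXY: "continuous_on UNIV X" "continuous_on UNIV Y" "continuous_on UNIV W"
      unfolding W_def X_def Y_def by (intro continuous_intros cont)+
    have Xc: "\<bar>X t - cos t\<bar> \<le> 8 * \<delta>" "\<bar>Y t - sin t\<bar> \<le> 8 * \<delta>" for t
      using xc[of t] c by (auto simp: X_def Y_def abs_le_iff)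
    have Xb: "\<bar>X t\<bar> \<le> 2" "\<bar>Y t\<bar> \<le> 2" for t using Xc[of t] cs[of t] \<delta>(4) by linarith+
    have W1: "\<bar>W t - 1\<bar> \<le> 31 * \<delta>" for t
    proof -
      have "W t - 1 = (\<omega> t - 1) - c1 * y' t + c2 * x' t"
        unfolding W_def X_def Y_def \<omega>_def by algebra
      then show ?thesis using \<omega>1[of t] abs_mult_le[OF c(1) x'b(2)[of t]] abs_mult_le[OF c(2) x'b(1)[of t]]
        by linarith
    qed
    have second: "\<bar>Z1 * Z2 * W t - z1 * z2 * 1\<bar> \<le> 4 * (31 * \<delta>) + (2 * (8 * \<delta>) + 8 * \<delta> * 1) * 1"
      if "\<bar>Z1\<bar> \<le> 2" "\<bar>Z2\<bar> \<le> 2" "\<bar>Z1 - z1\<bar> \<le> 8 * \<delta>" "\<bar>Z2 - z2\<bar> \<le> 8 * \<delta>" "\<bar>z2\<bar> \<le> 1" for Z1 Z2 z1 z2 t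
    proof (rule mult_close[OF _ _ _ W1])
      show "\<bar>Z1 * Z2\<bar> \<le> 4" using abs_mult_le[OF that(1,2)] by simp
      show "\<bar>Z1 * Z2 - z1 * z2\<bar> \<le> 2 * (8 * \<delta>) + 8 * \<delta> * 1" by (rule mult_close) (use that in auto)
    qed simp
    have cc: "continuous_on UNIV (\<lambda>t. X t * X t * W t)" "continuous_on UNIV (\<lambda>t. X t * Y t * W t)"
      "continuous_on UNIV (\<lambda>t. Y t * Y t * W t)" by (intro continuous_intros cXY)+
    define C where "C = 4 * (31 * \<delta>) + (2 * (8 * \<delta>) + 8 * \<delta> * 1) * 1"
    have c7: "7 * C / 3 \<le> 350 * \<delta>" using \<delta>(1) by (simp add: C_def)
    have quot: "\<exists>a. ((f :: real \<Rightarrow> real) has_integral pi * a) {0..2 * pi} \<and> \<bar>a - v\<bar> \<le> 350 * \<delta>"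
      if "(f has_integral w) {0..2 * pi}" "\<bar>w - pi * v\<bar> \<le> 7 * C" for f w v
    proof (intro exI conjI)
      show "(f has_integral pi * (w / pi)) {0..2 * pi}" using that(1) by simp
      have "w / pi - v = (w - pi * v) / pi" by (simp add: field_simps)
      then have "\<bar>w / pi - v\<bar> = \<bar>w - pi * v\<bar> / pi" by (simp add: abs_divide)
      also have "\<dots> \<le> 7 * C / 3" using that(2) pi_gt3 by (intro frac_le) auto
      finally show "\<bar>w / pi - v\<bar> \<le> 350 * \<delta>" using c7 by linarith
    qed
    have "\<exists>w. ((\<lambda>t. X t * X t * W t) has_integral w) {0..2 * pi} \<and> \<bar>w - pi\<bar> \<le> 7 * C"
      unfolding C_def by (rule integral_close[OF cc(1) trig_integrals(3)], intro continuous_intros,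
          rule second[OF Xb(1) Xb(1) Xc(1) Xc(1) cs(1)])
    then obtain a where a: "((\<lambda>t. X t * X t * W t) has_integral pi * a) {0..2 * pi}" "\<bar>a - 1\<bar> \<le> 350 * \<delta>"
      using quot[of "\<lambda>t. X t * X t * W t" _ 1] by auto
    have "\<exists>w. ((\<lambda>t. X t * Y t * W t) has_integral w) {0..2 * pi} \<and> \<bar>w - 0\<bar> \<le> 7 * C"
      unfolding C_def by (rule integral_close[OF cc(2) trig_integrals(4)], intro continuous_intros,
          rule second[OF Xb(1) Xb(2) Xc(1) Xc(2) cs(2)])
    then obtain b where b: "((\<lambda>t. X t * Y t * W t) has_integral pi * b) {0..2 * pi}" "\<bar>b\<bar> \<le> 350 * \<delta>"
      using quot[of "\<lambda>t. X t * Y t * W t" _ 0] by auto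
    have "\<exists>w. ((\<lambda>t. Y t * Y t * W t) has_integral w) {0..2 * pi} \<and> \<bar>w - pi\<bar> \<le> 7 * C"
      unfolding C_def by (rule integral_close[OF cc(3) trig_integrals(5)], intro continuous_intros,
          rule second[OF Xb(2) Xb(2) Xc(2) Xc(2) cs(2)])
    then obtain d where d: "((\<lambda>t. Y t * Y t * W t) has_integral pi * d) {0..2 * pi}" "\<bar>d - 1\<bar> \<le> 350 * \<delta>"
      using quot[of "\<lambda>t. Y t * Y t * W t" _ 1] by auto
    have abd: "\<bar>a - 1\<bar> \<le> \<sigma>" "\<bar>b\<bar> \<le> \<sigma>" "\<bar>d - 1\<bar> \<le> \<sigma>" using a b d \<delta>(2) by linarith+
    have a0: "a \<ge> 9 / 10" "d \<ge> 9 / 10" "\<bar>b\<bar> \<le> 1 / 10" using abd \<sigma>(2) by linarith+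
    have "9 / 10 * (9 / 10) \<le> a * d" using a0 by (intro mult_mono) auto
    moreover have "\<bar>b * b\<bar> \<le> 1 / 10 * (1 / 10)" using a0 by (intro abs_mult_le)
    ultimately have pos: "a > 0" "a * d - b\<^sup>2 > 0" using a0 by (auto simp: power2_eq_square)
    note M = inertia_moments[OF zero[unfolded W_def] a(1)[unfolded W_def] b(1)[unfolded W_def] d(1)[unfolded W_def] pos]
    define e1 where "e1 = sqrt (sqrt (sqrt (a * d - b\<^sup>2)) / a)"
    define e3 where "e3 = 1 / (sqrt (sqrt (a * d - b\<^sup>2)) * e1)"
    define e2 where "e2 = e3 * b / a"
    have "\<bar>e1 - 1\<bar> \<le> \<eta> \<and> \<bar>e3 - 1\<bar> \<le> \<eta> \<and> \<bar>e2\<bar> \<le> \<eta>"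
      using fac[OF abd] by (simp only: e1_def e2_def e3_def)
    moreover have "unit_moments (\<lambda>t. e1 * ((1 + n t) * cos t - c1)) (\<lambda>t. e1 * (n' t * cos t - (1 + n t) * sin t))
        (\<lambda>t. e3 * ((1 + n t) * sin t - c2) - e2 * ((1 + n t) * cos t - c1))
        (\<lambda>t. e3 * (n' t * sin t + (1 + n t) * cos t) - e2 * (n' t * cos t - (1 + n t) * sin t))"
      using M by (simp only: e1_def e2_def e3_def X_def Y_def x_def y_def x'_def y'_def)
    moreover have "\<bar>c1\<bar> \<le> \<eta>" "\<bar>c2\<bar> \<le> \<eta>" using c \<delta>(3) by linarith+
    ultimately show ?thesis by blast
  qed
  then show ?thesis using \<delta>(1) by blast
qed

section \<open>The normal form of a small deformation\<close>

text \<open>The boundary moments are invariant under the change of parameter \<open>\<psi>\<close>, since \<open>\<rho>\<^sup>2 \<psi>'\<close> is the area form of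
the curve.\<close>

lemma moments_of_polar_curve:
  fixes m \<psi> \<psi>' U V U' V' :: "real \<Rightarrow> real"
  assumes M: "unit_moments U U' V V'"
    and cont: "continuous_on UNIV m" and per: "\<And>x. m (x + 2 * pi) = m x"
    and D: "\<And>x. (\<psi> has_real_derivative \<psi>' x) (at x)" and \<psi>: "\<And>x. \<psi> (x + 2 * pi) = \<psi> x + 2 * pi"
    and U: "\<And>x. U x = (1 + m (\<psi> x)) * cos (\<psi> x)" and V: "\<And>x. V x = (1 + m (\<psi> x)) * sin (\<psi> x)"
    and W: "\<And>x. (1 + m (\<psi> x))\<^sup>2 * \<psi>' x = U x * V' x - V x * U' x"
  shows "satisfies_moments (\<lambda>x. 1 + m x)"
proof -
  define \<rho> where "\<rho> = (\<lambda>x. 1 + m x)"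
  have c\<rho>: "continuous_on UNIV \<rho>" unfolding \<rho>_def by (intro continuous_intros cont)
  have p\<rho>: "\<rho> (x + 2 * pi) = \<rho> x" for x by (simp add: \<rho>_def per)
  have one: "sin x * sin x = 1 - cos x * cos x" for x :: real
    using sin_cos_squared_add[of x] by (simp add: power2_eq_square)
  have subst: "integral {0..2 * pi} g = v"
    if "continuous_on UNIV g" "\<And>x. g (x + 2 * pi) = g x" "\<And>x. F x = g (\<psi> x) * \<psi>' x" "(F has_integral v) {0..2 * pi}"
    for g F v
  proof -
    have "F = (\<lambda>x. g (\<psi> x) * \<psi>' x)" using that(3) by blast
    then have "integral {0..2 * pi} (\<lambda>x. g (\<psi> x) * \<psi>' x) = v" using that(4) by (simp add: integral_unique)
    then show ?thesis using integral_substitution_period[OF that(1,2) D] \<psi>[of 0] by simp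
  qed
  have W': "U x * V' x - V x * U' x = \<rho> (\<psi> x) * \<rho> (\<psi> x) * \<psi>' x"
    and U': "U x = \<rho> (\<psi> x) * cos (\<psi> x)" and V': "V x = \<rho> (\<psi> x) * sin (\<psi> x)" for x
    using W[of x] U[of x] V[of x] by (simp_all add: \<rho>_def power2_eq_square)
  note M' = M[unfolded unit_moments_def W']
  have h3: "\<rho> x ^ 3 = \<rho> x * \<rho> x * \<rho> x" and h4: "\<rho> x ^ 4 = \<rho> x * \<rho> x * \<rho> x * \<rho> x" for x
    by (simp_all add: power_numeral_reduce)
  have k2: "cos (2 * (x + 2 * pi)) = cos (2 * x)" "sin (2 * (x + 2 * pi)) = sin (2 * x)" for x :: real
    using trig_periodic_nat[of 2 x] by simp_all
  have "integral {0..2 * pi} (\<lambda>x. \<rho> x ^ 3 * cos x) = 0"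
    by (rule subst[OF _ _ _ M'[THEN conjunct1]])
       (auto intro!: continuous_intros c\<rho> simp: p\<rho> U' h3)
  moreover have "integral {0..2 * pi} (\<lambda>x. \<rho> x ^ 3 * sin x) = 0"
    by (rule subst[OF _ _ _ M'[THEN conjunct2, THEN conjunct1]])
       (auto intro!: continuous_intros c\<rho> simp: p\<rho> V' h3)
  moreover have "integral {0..2 * pi} (\<lambda>x. \<rho> x ^ 4) = pi + pi"
  proof (rule subst[OF _ _ _ has_integral_add[OF M'[THEN conjunct2, THEN conjunct2, THEN conjunct1]
          M'[THEN conjunct2, THEN conjunct2, THEN conjunct2, THEN conjunct2]]])
    show "U x * U x * (\<rho> (\<psi> x) * \<rho> (\<psi> x) * \<psi>' x) + V x * V x * (\<rho> (\<psi> x) * \<rho> (\<psi> x) * \<psi>' x) = \<rho> (\<psi> x) ^ 4 * \<psi>' x" for x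
    proof -
      have "U x * U x * (\<rho> (\<psi> x) * \<rho> (\<psi> x) * \<psi>' x) + V x * V x * (\<rho> (\<psi> x) * \<rho> (\<psi> x) * \<psi>' x)
          = (cos (\<psi> x) * cos (\<psi> x) + sin (\<psi> x) * sin (\<psi> x)) * (\<rho> (\<psi> x) ^ 4 * \<psi>' x)"
        unfolding U' V' by algebra
      then show ?thesis by (simp add: one)
    qed
  qed (auto intro!: continuous_intros c\<rho> simp: p\<rho>)
  moreover have "integral {0..2 * pi} (\<lambda>x. \<rho> x ^ 4 * cos (2 * x)) = pi - pi"
  proof (rule subst[OF _ _ _ has_integral_diff[OF M'[THEN conjunct2, THEN conjunct2, THEN conjunct1]
          M'[THEN conjunct2, THEN conjunct2, THEN conjunct2, THEN conjunct2]]])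
    show "U x * U x * (\<rho> (\<psi> x) * \<rho> (\<psi> x) * \<psi>' x) - V x * V x * (\<rho> (\<psi> x) * \<rho> (\<psi> x) * \<psi>' x) = \<rho> (\<psi> x) ^ 4 * cos (2 * \<psi> x) * \<psi>' x" for x
      unfolding U' V' cos_double by algebra
    show "\<rho> (x + 2 * pi) ^ 4 * cos (2 * (x + 2 * pi)) = \<rho> x ^ 4 * cos (2 * x)" for x
      by (simp only: p\<rho> k2)
  qed (intro continuous_intros c\<rho>)
  moreover have "integral {0..2 * pi} (\<lambda>x. \<rho> x ^ 4 * sin (2 * x)) = 0 + 0"
  proof (rule subst[OF _ _ _ has_integral_add[OF M'[THEN conjunct2, THEN conjunct2, THEN conjunct2, THEN conjunct1]
          M'[THEN conjunct2, THEN conjunct2, THEN conjunct2, THEN conjunct1]]])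
    show "U x * V x * (\<rho> (\<psi> x) * \<rho> (\<psi> x) * \<psi>' x) + U x * V x * (\<rho> (\<psi> x) * \<rho> (\<psi> x) * \<psi>' x) = \<rho> (\<psi> x) ^ 4 * sin (2 * \<psi> x) * \<psi>' x" for x
      unfolding U' V' sin_double by algebra
    show "\<rho> (x + 2 * pi) ^ 4 * sin (2 * (x + 2 * pi)) = \<rho> x ^ 4 * sin (2 * x)" for x
      by (simp only: p\<rho> k2)
  qed (intro continuous_intros c\<rho>)
  ultimately show ?thesis by (simp add: satisfies_moments_def \<rho>_def)
qed

text \<open>After an affine map that is triangular in the frame, the deformed circle is a radial graph \<open>1 + m\<close> with
normalized moments. The bound \<open>B\<close> on the derivatives of \<open>m\<close> is separate from the size \<open>\<eta>\<close> of \<open>m\<close>.\<close>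

definition has_normal_form :: "real \<Rightarrow> real \<Rightarrow> (real \<Rightarrow> real) \<Rightarrow> bool" where
  "has_normal_form B \<eta> n \<longleftrightarrow> (\<exists>c1 c2 e1 e2 e3 m. e1 > 0 \<and> e3 > 0 \<and> (\<forall>x. m (x + 2 * pi) = m x) \<and> Ck_bounded 11 B m \<and>
     (\<forall>x. \<bar>m x\<bar> \<le> \<eta>) \<and> satisfies_moments (\<lambda>x. 1 + m x) \<and>
     range (\<lambda>t. Complex (e1 * ((1 + n t) * cos t - c1)) (e3 * ((1 + n t) * sin t - c2) - e2 * ((1 + n t) * cos t - c1)))
       = range (\<lambda>\<psi>. of_real (1 + m \<psi>) * cis \<psi>))"

text \<open>The bound \<open>B\<close> is chosen before \<open>\<eta>'\<close>. This is possible because the normalized curves form one family,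
indexed by the deformation and the entries of the affine map, to which
\<open>polar_coordinates_of_near_circle\<close> applies uniformly.\<close>

lemma normalized_deformation:
  assumes K: "0 \<le> K"
  shows "\<exists>B\<ge>0. \<forall>\<eta>'>0. \<exists>\<delta>>0. \<forall>n. (\<forall>x. n (x + 2 * pi) = n x) \<longrightarrow> Ck_bounded 12 K n \<longrightarrow>
    (\<forall>x. \<bar>n x\<bar> \<le> \<delta> \<and> \<bar>deriv n x\<bar> \<le> \<delta>) \<longrightarrow>
    has_normal_form B \<eta>' n"
proof -
  define N :: "(real \<Rightarrow> real) \<times> real \<times> real \<times> real \<times> real \<times> real \<Rightarrow> real \<Rightarrow> real" where "N = fst"
  define C1 C2 E1 E2 E3 :: "(real \<Rightarrow> real) \<times> real \<times> real \<times> real \<times> real \<times> real \<Rightarrow> real"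
    where "C1 = (\<lambda>i. fst (snd i))" and "C2 = (\<lambda>i. fst (snd (snd i)))" and "E1 = (\<lambda>i. fst (snd (snd (snd i))))"
      and "E2 = (\<lambda>i. fst (snd (snd (snd (snd i)))))" and "E3 = (\<lambda>i. snd (snd (snd (snd (snd i)))))"
  define I where "I = {i. (\<forall>x. N i (x + 2 * pi) = N i x) \<and> Ck_bounded 12 K (N i) \<and>
     (\<forall>x. \<bar>N i x\<bar> \<le> 1 / 1000 \<and> \<bar>deriv (N i) x\<bar> \<le> 1 / 1000) \<and> \<bar>C1 i\<bar> \<le> 1 / 1000 \<and> \<bar>C2 i\<bar> \<le> 1 / 1000 \<and>
     \<bar>E1 i - 1\<bar> \<le> 1 / 1000 \<and> \<bar>E2 i\<bar> \<le> 1 / 1000 \<and> \<bar>E3 i - 1\<bar> \<le> 1 / 1000}"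
  define U where "U = (\<lambda>i t. E1 i * ((1 + N i t) * cos t - C1 i))"
  define V where "V = (\<lambda>i t. E3 i * ((1 + N i t) * sin t - C2 i) - E2 i * ((1 + N i t) * cos t - C1 i))"
  define U' where "U' = (\<lambda>i t. E1 i * (deriv (N i) t * cos t - (1 + N i t) * sin t))"
  define V' where "V' = (\<lambda>i t. E3 i * (deriv (N i) t * sin t + (1 + N i t) * cos t) - E2 i * (deriv (N i) t * cos t - (1 + N i t) * sin t))"
  have NCk: "uniformly_Ck 12 I N" unfolding uniformly_Ck_def I_def by blast
  have cb: "\<bar>C1 i\<bar> \<le> 2" "\<bar>C2 i\<bar> \<le> 2" "\<bar>E1 i\<bar> \<le> 2" "\<bar>E2 i\<bar> \<le> 2" "\<bar>E3 i\<bar> \<le> 2" if "i \<in> I" for i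
  proof -
    have "\<bar>C1 i\<bar> \<le> 1 / 1000" "\<bar>C2 i\<bar> \<le> 1 / 1000" "\<bar>E1 i - 1\<bar> \<le> 1 / 1000" "\<bar>E2 i\<bar> \<le> 1 / 1000"
      "\<bar>E3 i - 1\<bar> \<le> 1 / 1000" using that unfolding I_def by blast+
    then show "\<bar>C1 i\<bar> \<le> 2" "\<bar>C2 i\<bar> \<le> 2" "\<bar>E1 i\<bar> \<le> 2" "\<bar>E2 i\<bar> \<le> 2" "\<bar>E3 i\<bar> \<le> 2" by linarith+
  qed
  have c1: "uniformly_Ck 12 I (\<lambda>i x. C1 i)" and c2: "uniformly_Ck 12 I (\<lambda>i x. C2 i)"
    and one: "uniformly_Ck 12 I (\<lambda>i x. 1)"
    by (rule uniformly_Ck_const, erule cb) (rule uniformly_Ck_const, erule cb, rule uniformly_Ck_const[of _ _ 1], simp)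
  have X: "uniformly_Ck 12 I (\<lambda>i x. (1 + N i x) * cos x - C1 i)"
    by (rule uniformly_Ck_diff[OF uniformly_Ck_mult[OF uniformly_Ck_add[OF one NCk] uniformly_Ck_cos_sin(1)] c1])
  have Y: "uniformly_Ck 12 I (\<lambda>i x. (1 + N i x) * sin x - C2 i)"
    by (rule uniformly_Ck_diff[OF uniformly_Ck_mult[OF uniformly_Ck_add[OF one NCk] uniformly_Ck_cos_sin(2)] c2])
  have UCk: "uniformly_Ck 12 I U" unfolding U_def
    by (rule uniformly_Ck_cmult[OF X]) (erule cb)
  have VCk: "uniformly_Ck 12 I V" unfolding V_def
    by (rule uniformly_Ck_diff[OF uniformly_Ck_cmult[OF Y] uniformly_Ck_cmult[OF X]]) (erule cb)+
  have DN: "(N i has_real_derivative deriv (N i) x) (at x)" if "i \<in> I" for i x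
    using that by (auto simp: I_def eval_nat_numeral)
  have DU: "deriv (U i) = U' i" and DV: "deriv (V i) = V' i" if i: "i \<in> I" for i
  proof -
    show "deriv (U i) = U' i"
      by (rule ext, rule DERIV_imp_deriv) (auto simp: U_def U'_def algebra_simps intro!: derivative_eq_intros DN i)
    show "deriv (V i) = V' i"
      by (rule ext, rule DERIV_imp_deriv) (auto simp: V_def V'_def algebra_simps intro!: derivative_eq_intros DN i)
  qed
  have close: "\<bar>U i t - cos t\<bar> \<le> 5 * \<eta> \<and> \<bar>V i t - sin t\<bar> \<le> 5 * \<eta> \<and> \<bar>U' i t + sin t\<bar> \<le> 5 * \<eta> \<and> \<bar>V' i t - cos t\<bar> \<le> 5 * \<eta>"
    if \<eta>: "\<eta> \<le> 1 / 500" and b: "\<bar>N i t\<bar> \<le> \<eta> / 2 \<and> \<bar>deriv (N i) t\<bar> \<le> \<eta> / 2" "\<bar>C1 i\<bar> \<le> \<eta>" "\<bar>C2 i\<bar> \<le> \<eta>"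
      "\<bar>E1 i - 1\<bar> \<le> \<eta>" "\<bar>E2 i\<bar> \<le> \<eta>" "\<bar>E3 i - 1\<bar> \<le> \<eta>" for i t \<eta>
  proof -
    have cs: "\<bar>cos t\<bar> \<le> 1" "\<bar>sin t\<bar> \<le> 1" by auto
    note nb = conjunct1[OF b(1)] conjunct2[OF b(1)]
    note prods = abs_mult_le[OF nb(1) cs(1)] abs_mult_le[OF nb(1) cs(2)] abs_mult_le[OF nb(2) cs(1)] abs_mult_le[OF nb(2) cs(2)]
    have x1: "\<bar>((1 + N i t) * cos t - C1 i) - cos t\<bar> \<le> 3 / 2 * \<eta>" "\<bar>((1 + N i t) * sin t - C2 i) - sin t\<bar> \<le> 3 / 2 * \<eta>"
      "\<bar>(deriv (N i) t * cos t - (1 + N i t) * sin t) - (- sin t)\<bar> \<le> 3 / 2 * \<eta>"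
      "\<bar>(deriv (N i) t * sin t + (1 + N i t) * cos t) - cos t\<bar> \<le> 3 / 2 * \<eta>"
      unfolding distrib_right mult_1_left using prods b(2,3) by linarith+
    have lin: "\<bar>e * x - x0\<bar> \<le> 11 / 4 * \<eta>" if "\<bar>e - 1\<bar> \<le> \<eta>" "\<bar>x - x0\<bar> \<le> 3 / 2 * \<eta>" "\<bar>x0\<bar> \<le> 1" for e x x0
    proof -
      have "\<bar>e\<bar> \<le> 501 / 500" using that(1) \<eta> by linarith
      from mult_close[OF this that(3,1,2)] show ?thesis using that(1) \<eta> by simp
    qed
    have off: "\<bar>E2 i * x\<bar> \<le> \<eta> * 2" if "\<bar>x - x0\<bar> \<le> 3 / 2 * \<eta>" "\<bar>x0\<bar> \<le> 1" for x x0
      using that \<eta> by (intro abs_mult_le b(5)) linarith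
    have ms: "\<bar>- sin t\<bar> \<le> 1" by simp
    note fin = lin[OF b(4) x1(1) cs(1)] lin[OF b(4) x1(3) ms] lin[OF b(6) x1(2) cs(2)] lin[OF b(6) x1(4) cs(1)]
      off[OF x1(1) cs(1)] off[OF x1(3) ms]
    have e0: "0 \<le> \<eta>" using b(2) by linarith
    show ?thesis unfolding U_def V_def U'_def V'_def using fin e0 unfolding abs_le_iff by (intro conjI; linarith)
  qed
  have closeI: "\<bar>U i t - cos t\<bar> \<le> 1 / 25 \<and> \<bar>V i t - sin t\<bar> \<le> 1 / 25 \<and> \<bar>U' i t + sin t\<bar> \<le> 1 / 25 \<and> \<bar>V' i t - cos t\<bar> \<le> 1 / 25"
    if i: "i \<in> I" for i t
  proof -
    have b: "\<bar>N i t\<bar> \<le> 1 / 1000 \<and> \<bar>deriv (N i) t\<bar> \<le> 1 / 1000" "\<bar>C1 i\<bar> \<le> 1 / 1000" "\<bar>C2 i\<bar> \<le> 1 / 1000"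
      "\<bar>E1 i - 1\<bar> \<le> 1 / 1000" "\<bar>E2 i\<bar> \<le> 1 / 1000" "\<bar>E3 i - 1\<bar> \<le> 1 / 1000"
      using i unfolding I_def by blast+
    have half: "x \<le> 1 / 1000 \<Longrightarrow> x \<le> 1 / 500" for x :: real by simp
    from b have "\<bar>N i t\<bar> \<le> 1 / 500 / 2 \<and> \<bar>deriv (N i) t\<bar> \<le> 1 / 500 / 2" by simp
    moreover have "\<bar>C1 i\<bar> \<le> 1 / 500" "\<bar>C2 i\<bar> \<le> 1 / 500" "\<bar>E1 i - 1\<bar> \<le> 1 / 500" "\<bar>E2 i\<bar> \<le> 1 / 500"
      "\<bar>E3 i - 1\<bar> \<le> 1 / 500"
      using b(2-6)[THEN half] .
    ultimately have "\<bar>U i t - cos t\<bar> \<le> 5 * (1 / 500) \<and> \<bar>V i t - sin t\<bar> \<le> 5 * (1 / 500) \<and>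
      \<bar>U' i t + sin t\<bar> \<le> 5 * (1 / 500) \<and> \<bar>V' i t - cos t\<bar> \<le> 5 * (1 / 500)"
      by (intro close) auto
    then show ?thesis by auto
  qed
  have per: "U i (x + 2 * pi) = U i x" "V i (x + 2 * pi) = V i x" if "i \<in> I" for i x
    using that by (auto simp: U_def V_def I_def)
  have "\<exists>B. \<forall>i\<in>I. \<exists>m \<psi> \<psi>'. (\<forall>x. m (x + 2 * pi) = m x) \<and> Ck_bounded 11 B m \<and>
     (\<forall>x. 1 + m (\<psi> x) = sqrt ((U i x)\<^sup>2 + (V i x)\<^sup>2)) \<and> surj \<psi> \<and>
     (\<forall>x. (\<psi> has_real_derivative \<psi>' x) (at x)) \<and> (\<forall>x. \<psi> (x + 2 * pi) = \<psi> x + 2 * pi) \<and>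
     (\<forall>x. U i x = (1 + m (\<psi> x)) * cos (\<psi> x) \<and> V i x = (1 + m (\<psi> x)) * sin (\<psi> x) \<and>
       (1 + m (\<psi> x))\<^sup>2 * \<psi>' x = U i x * deriv (V i) x - V i x * deriv (U i) x)" (is "\<exists>B. \<forall>i\<in>I. ?P B i")
    by (rule polar_coordinates_of_near_circle[OF UCk VCk per]) (simp_all only: closeI DU DV)
  then obtain B where B: "\<forall>i\<in>I. ?P B i" ..
  have "\<exists>\<delta>>0. \<forall>n. (\<forall>x. n (x + 2 * pi) = n x) \<longrightarrow> Ck_bounded 12 K n \<longrightarrow>
    (\<forall>x. \<bar>n x\<bar> \<le> \<delta> \<and> \<bar>deriv n x\<bar> \<le> \<delta>) \<longrightarrow>
    has_normal_form (max 0 B) \<eta>' n" if \<eta>': "\<eta>' > 0" for \<eta>'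
  proof -
    \<comment> \<open>Both coordinates of the normalized curve will be within \<open>5\<eta>\<close> of those of the circle.\<close>
    define \<eta> where "\<eta> = min (1 / 1000) (\<eta>' / 10)"
    have \<eta>: "\<eta> > 0" "\<eta> \<le> 1 / 1000" "10 * \<eta> \<le> \<eta>'" using \<eta>' by (auto simp: \<eta>_def)
    obtain \<delta>1 where \<delta>1: "\<delta>1 > 0" and norm: "\<forall>n n'. (\<forall>t. (n has_real_derivative n' t) (at t)) \<longrightarrow> continuous_on UNIV n' \<longrightarrow>
    (\<forall>t. n (t + 2 * pi) = n t) \<longrightarrow> (\<forall>t. \<bar>n t\<bar> \<le> \<delta>1 \<and> \<bar>n' t\<bar> \<le> \<delta>1) \<longrightarrow>
    (\<exists>c1 c2 e1 e2 e3. \<bar>c1\<bar> \<le> \<eta> \<and> \<bar>c2\<bar> \<le> \<eta> \<and> \<bar>e1 - 1\<bar> \<le> \<eta> \<and> \<bar>e2\<bar> \<le> \<eta> \<and> \<bar>e3 - 1\<bar> \<le> \<eta> \<and>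
      unit_moments (\<lambda>t. e1 * ((1 + n t) * cos t - c1)) (\<lambda>t. e1 * (n' t * cos t - (1 + n t) * sin t))
        (\<lambda>t. e3 * ((1 + n t) * sin t - c2) - e2 * ((1 + n t) * cos t - c1))
        (\<lambda>t. e3 * (n' t * sin t + (1 + n t) * cos t) - e2 * (n' t * cos t - (1 + n t) * sin t)))"
      using near_circle_normalization[OF \<eta>(1)] by (elim exE conjE) (rule that)
    define \<delta> where "\<delta> = min \<delta>1 (\<eta> / 2)"
    have "has_normal_form (max 0 B) \<eta>' n"
      if pn: "\<forall>x. n (x + 2 * pi) = n x" and Ck: "Ck_bounded 12 K n" and small: "\<forall>x. \<bar>n x\<bar> \<le> \<delta> \<and> \<bar>deriv n x\<bar> \<le> \<delta>" for n
    proof -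
      have Dn: "\<forall>t. (n has_real_derivative deriv n t) (at t)" using Ck by (simp add: eval_nat_numeral)
      have "Ck_bounded 11 K (deriv n)" using Ck by (simp add: eval_nat_numeral)
      then have cn': "continuous_on UNIV (deriv n)" using Ck_bounded_le[of 11 K "deriv n" 0] by simp
      have s1: "\<forall>t. \<bar>n t\<bar> \<le> \<delta>1 \<and> \<bar>deriv n t\<bar> \<le> \<delta>1" and s2: "\<bar>n t\<bar> \<le> \<eta> / 2 \<and> \<bar>deriv n t\<bar> \<le> \<eta> / 2" for t
        using small by (auto simp: \<delta>_def)
      obtain c1 c2 e1 e2 e3 where b: "\<bar>c1\<bar> \<le> \<eta>" "\<bar>c2\<bar> \<le> \<eta>" "\<bar>e1 - 1\<bar> \<le> \<eta>" "\<bar>e2\<bar> \<le> \<eta>" "\<bar>e3 - 1\<bar> \<le> \<eta>"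
        and M: "unit_moments (\<lambda>t. e1 * ((1 + n t) * cos t - c1)) (\<lambda>t. e1 * (deriv n t * cos t - (1 + n t) * sin t))
        (\<lambda>t. e3 * ((1 + n t) * sin t - c2) - e2 * ((1 + n t) * cos t - c1))
        (\<lambda>t. e3 * (deriv n t * sin t + (1 + n t) * cos t) - e2 * (deriv n t * cos t - (1 + n t) * sin t))"
        using norm[THEN spec, THEN spec, THEN mp, THEN mp, THEN mp, THEN mp, OF Dn cn' pn s1]
        by (elim exE conjE) (rule that)
      define i where "i = (n, c1, c2, e1, e2, e3)"
      have proj: "N i = n" "C1 i = c1" "C2 i = c2" "E1 i = e1" "E2 i = e2" "E3 i = e3"
        by (simp_all add: i_def N_def C1_def C2_def E1_def E2_def E3_def)
      have "\<bar>n t\<bar> \<le> 1 / 1000 \<and> \<bar>deriv n t\<bar> \<le> 1 / 1000" for t using s2[of t] \<eta>(1,2) by linarith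
      moreover have "\<bar>c1\<bar> \<le> 1 / 1000" "\<bar>c2\<bar> \<le> 1 / 1000" "\<bar>e1 - 1\<bar> \<le> 1 / 1000" "\<bar>e2\<bar> \<le> 1 / 1000" "\<bar>e3 - 1\<bar> \<le> 1 / 1000"
        using b \<eta>(2) by linarith+
      ultimately have iI: "i \<in> I" unfolding I_def mem_Collect_eq proj using pn Ck by blast
      obtain m \<psi> \<psi>' where m: "\<forall>x. m (x + 2 * pi) = m x" "Ck_bounded 11 B m"
        and r: "\<forall>x. 1 + m (\<psi> x) = sqrt ((U i x)\<^sup>2 + (V i x)\<^sup>2)" and surj: "surj \<psi>"
        and D\<psi>': "\<forall>x. (\<psi> has_real_derivative \<psi>' x) (at x)" and \<psi>p': "\<forall>x. \<psi> (x + 2 * pi) = \<psi> x + 2 * pi"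
        and UV': "\<forall>x. U i x = (1 + m (\<psi> x)) * cos (\<psi> x) \<and> V i x = (1 + m (\<psi> x)) * sin (\<psi> x) \<and>
          (1 + m (\<psi> x))\<^sup>2 * \<psi>' x = U i x * deriv (V i) x - V i x * deriv (U i) x"
        using bspec[OF B iI] by (elim exE conjE) (rule that)
      note D\<psi> = D\<psi>'[THEN spec] and \<psi>p = \<psi>p'[THEN spec]
      note UV = UV'[THEN spec, THEN conjunct1] UV'[THEN spec, THEN conjunct2, THEN conjunct1]
        UV'[THEN spec, THEN conjunct2, THEN conjunct2]
      have cm: "continuous_on UNIV m" using Ck_bounded_le[OF m(2), of 0] by simp
      have "unit_moments (U i) (U' i) (V i) (V' i)"
        using M unfolding U_def V_def U'_def V'_def proj .
      from moments_of_polar_curve[OF this cm _ D\<psi> \<psi>p UV(1,2) UV(3)[unfolded DU[OF iI] DV[OF iI]]] m(1)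
      have mom: "satisfies_moments (\<lambda>x. 1 + m x)" by blast
      have msmall: "\<bar>m y\<bar> \<le> \<eta>'" for y
      proof -
        obtain x where y: "y = \<psi> x" using surj by (metis surjD)
        have cl: "\<bar>U i x - cos x\<bar> \<le> 5 * \<eta> \<and> \<bar>V i x - sin x\<bar> \<le> 5 * \<eta>"
          using close[of \<eta> i x, unfolded proj, OF _ s2 b] \<eta>(2) by simp
        have "m y = cmod (Complex (U i x) (V i x)) - cmod (cis x)" using r y by (simp add: cmod_def) (metis add_diff_cancel_left')
        also have "\<bar>\<dots>\<bar> \<le> cmod (Complex (U i x) (V i x) - cis x)" by (rule norm_triangle_ineq3)
        also have "\<dots> \<le> \<bar>U i x - cos x\<bar> + \<bar>V i x - sin x\<bar>"
          using cmod_le[of "Complex (U i x) (V i x) - cis x"] by simp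
        finally show ?thesis using cl \<eta>(3) by linarith
      qed
      have "range (\<lambda>t. Complex (U i t) (V i t)) = range (\<lambda>t. of_real (1 + m (\<psi> t)) * cis (\<psi> t))"
        by (rule arg_cong[where f = range]) (auto simp: fun_eq_iff complex_eq_iff UV)
      also have "\<dots> = (\<lambda>\<psi>. of_real (1 + m \<psi>) * cis \<psi>) ` range \<psi>" by (simp only: image_image)
      finally have "range (\<lambda>t. Complex (U i t) (V i t)) = range (\<lambda>\<psi>. of_real (1 + m \<psi>) * cis \<psi>)" by (simp only: surj)
      then have "range (\<lambda>t. Complex (e1 * ((1 + n t) * cos t - c1)) (e3 * ((1 + n t) * sin t - c2) - e2 * ((1 + n t) * cos t - c1)))
         = range (\<lambda>\<psi>. of_real (1 + m \<psi>) * cis \<psi>)" by (simp only: U_def V_def proj)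
      moreover have "e1 > 0" "e3 > 0" using b \<eta>(2) by linarith+
      moreover have "Ck_bounded 11 (max 0 B) m" using m(2) by (rule Ck_bounded_mono) simp
      ultimately show ?thesis using m(1) msmall mom unfolding has_normal_form_def
        by (intro exI[of _ c1] exI[of _ c2] exI[of _ e1] exI[of _ e2] exI[of _ e3] exI[of _ m] conjI) simp_all
    qed
    moreover have "\<delta> > 0" using \<delta>1 \<eta>(1) by (simp add: \<delta>_def)
    ultimately show ?thesis by (intro exI[of _ \<delta>] conjI allI impI)
  qed
  then have "\<forall>\<eta>'>0. \<exists>\<delta>>0. \<forall>n. (\<forall>x. n (x + 2 * pi) = n x) \<longrightarrow> Ck_bounded 12 K n \<longrightarrow>
    (\<forall>x. \<bar>n x\<bar> \<le> \<delta> \<and> \<bar>deriv n x\<bar> \<le> \<delta>) \<longrightarrow> has_normal_form (max 0 B) \<eta>' n" by blast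
  moreover have "0 \<le> max 0 B" by simp
  ultimately show ?thesis by blast
qed

section \<open>Ellipses, frames and orbit sums\<close>

lemma arctan_abs_le: "\<bar>arctan x\<bar> \<le> \<bar>x\<bar>"
proof -
  have "\<bar>arctan x - arctan 0\<bar> \<le> 1 * \<bar>x - 0\<bar>"
    using field_differentiable_bound[of UNIV arctan "\<lambda>x. inverse (1 + x\<^sup>2)" 1 x 0]
    by (auto simp: has_field_derivative_at_within DERIV_arctan inverse_le_1_iff)
  then show ?thesis by simp
qed

context polar_table
begin

lemma critical_equation:
  "Im (cnj (polar_deriv b) * (polar c' - polar a)) =
     \<rho> c' * (\<rho>' b * sin (c' - b) - \<rho> b * cos (c' - b)) + \<rho> a * (\<rho>' b * sin (b - a) + \<rho> b * cos (b - a))"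
proof -
  have s: "cnj (polar_deriv b) * polar t = of_real (\<rho> t) * (Complex (\<rho>' b) (- \<rho> b) * cis (t - b))" for t
  proof -
    have "cnj (polar_deriv b) * polar t = of_real (\<rho> t) * (Complex (\<rho>' b) (- \<rho> b) * (cis (- b) * cis t))"
      by (simp add: polar_deriv_def polar_def complex_cnj mult_ac cis_cnj)
    then show ?thesis by (simp add: cis_mult)
  qed
  have "Im (cnj (polar_deriv b) * polar t) = \<rho> t * (\<rho>' b * sin (t - b) - \<rho> b * cos (t - b))" for t
    unfolding s by simp
  then have "Im (cnj (polar_deriv b) * (polar c' - polar a)) =
     \<rho> c' * (\<rho>' b * sin (c' - b) - \<rho> b * cos (c' - b)) - \<rho> a * (\<rho>' b * sin (a - b) - \<rho> b * cos (a - b))"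
    by (simp only: right_diff_distrib minus_complex.simps)
  moreover have "sin (a - b) = - sin (b - a)" "cos (a - b) = cos (b - a)"
    by (metis minus_diff_eq sin_minus) (metis minus_diff_eq cos_minus)
  ultimately show ?thesis by (simp add: algebra_simps)
qed

text \<open>Consecutive tangent angles differ by less than \<open>\<pi>\<close>, and the tilt is small. So the steps of the polygon
exceed \<open>\<pi>\<close> by at most \<open>1/10\<close>, as \<open>polygon_sum_estimate\<close> requires.\<close>

lemma rational_curve_orbit_sums:
  fixes q :: nat
  assumes q: "q \<ge> 3" and C: "invariant_curve \<gamma> C"
    and rot: "\<forall>z\<in>C. has_rotation_number \<gamma> z (1 / real q)"
    and per: "\<forall>z\<in>C. (symplectic_billiard \<gamma> ^^ q) z = z"
    and \<epsilon>: "0 \<le> \<epsilon>" "\<epsilon> \<le> 1 / 100" and small: "\<And>x. \<bar>\<rho> x - 1\<bar> \<le> \<epsilon>" "\<And>x. \<bar>\<rho>' x\<bar> \<le> \<epsilon>" "\<And>x. \<bar>\<rho>'' x\<bar> \<le> \<epsilon>"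
  shows "\<bar>\<Sum>k<q. \<rho>' (a + 2 * pi * k / q)\<bar> \<le> 200 * real q ^ 4 * \<epsilon>\<^sup>2"
proof -
  obtain \<psi> where \<psi>: "\<psi> 0 = a" "\<forall>k. \<psi> k < \<psi> (Suc k)" "\<forall>k. \<psi> (k + q) = \<psi> k + 2 * pi"
    and crit: "\<forall>k. Im (cnj (polar_deriv (\<psi> (Suc k))) * (polar (\<psi> (Suc (Suc k))) - polar (\<psi> k))) = 0"
    and gap: "\<forall>k. tangent_angle (\<psi> (Suc k)) - tangent_angle (\<psi> k) < pi"
    using periodic_polygon[OF _ C rot per, of a] q by auto
  have tilt: "\<bar>tilt x\<bar> \<le> 1 / 20" for x
  proof -
    have "\<bar>\<rho>' x\<bar> \<le> 1 / 100" "\<rho> x \<ge> 99 / 100" using small[of x] \<epsilon> by linarith+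
    then have "\<bar>\<rho>' x / \<rho> x\<bar> \<le> (1 / 100) / (99 / 100)" unfolding abs_divide by (intro frac_le) auto
    then show ?thesis using arctan_abs_le[of "\<rho>' x / \<rho> x"] by (simp add: tilt_def)
  qed
  have "\<psi> (Suc k) - \<psi> k \<le> pi + 1 / 10" for k
    using gap[rule_format, of k] tilt[of "\<psi> k"] tilt[of "\<psi> (Suc k)"] unfolding tangent_angle_def by linarith
  then have "\<bar>\<Sum>k<q. \<rho>' (\<psi> 0 + 2 * pi * k / q)\<bar> \<le> 200 * real q ^ 4 * \<epsilon>\<^sup>2"
    using \<psi> crit unfolding critical_equation
    by (intro polygon_sum_estimate[where \<rho> = \<rho> and \<rho>'' = \<rho>''] q \<epsilon> small radius_deriv2 radius_periodic radius_deriv_periodic) blast+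
  then show ?thesis by (simp add: \<psi>(1))
qed

end

lemma range_periodic:
  fixes F :: "real \<Rightarrow> 'a" assumes per: "\<And>x. F (x + p) = F x" and p: "p > 0"
  shows "F ` {0..p} = range F"
proof
  show "range F \<subseteq> F ` {0..p}"
  proof
    fix y assume "y \<in> range F"
    then obtain x where y: "y = F x" by blast
    define j where "j = \<lfloor>x / p\<rfloor>"
    have "of_int j \<le> x / p" "x / p < of_int j + 1" unfolding j_def by linarith+
    then have "0 \<le> x - p * of_int j" "x - p * of_int j \<le> p" using p by (simp_all add: field_simps)
    moreover have "F (x - p * of_int j) = F x" using periodic_int[where f = F, OF per, of "x - p * of_int j" j] by simp
    ultimately show "y \<in> F ` {0..p}" using y by (intro image_eqI[of _ _ "x - p * of_int j"]) auto
  qed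
qed auto

lemma ellipse_plus_range:
  assumes ab: "a > 0" "b > 0" and per: "\<And>t. n (t + 2 * pi * ellipse_scale a b) = n t"
  shows "ellipse_plus p u v a b n = range (\<lambda>\<theta>. p + (1 + n (ellipse_scale a b * \<theta>)) *\<^sub>R ((a * cos \<theta>) *\<^sub>R u + (b * sin \<theta>) *\<^sub>R v))"
proof -
  define S where "S = ellipse_scale a b"
  have S: "S > 0" using ab by (simp add: S_def ellipse_scale_def)
  define F where "F = (\<lambda>t. p + (1 + n t) *\<^sub>R ellipse_param u v a b t)"
  have "F (t + 2 * pi * S) = F t" for t
  proof -
    have "(t + 2 * pi * S) / S = t / S + 2 * pi" using S by (simp add: field_simps)
    then show ?thesis using per[of t] by (simp add: F_def ellipse_param_def S_def[symmetric])
  qed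
  then have "F ` {0..2 * pi * S} = range F" using S by (intro range_periodic) auto
  also have "range F = range (\<lambda>\<theta>. F (S * \<theta>))"
  proof -
    have "range (\<lambda>\<theta>. S * \<theta>) = UNIV" using S by (intro surjI[where f = "\<lambda>x. x / S"]) auto
    then show ?thesis by (metis image_image)
  qed
  also have "(\<lambda>\<theta>. F (S * \<theta>)) = (\<lambda>\<theta>. p + (1 + n (S * \<theta>)) *\<^sub>R ((a * cos \<theta>) *\<^sub>R u + (b * sin \<theta>) *\<^sub>R v))"
    using S by (auto simp: F_def ellipse_param_def S_def[symmetric])
  finally show ?thesis by (simp add: ellipse_plus_def F_def S_def)
qed

text \<open>Rotating the frame by a quarter turn exchanges the two conjugate directions up to a sign, so their
inner product vanishes for some rotation angle. At that angle they are the axes.\<close>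

lemma affine_image_of_circle_is_ellipse:
  assumes fg: "area_form f g \<noteq> 0"
  shows "is_ellipse (range (\<lambda>\<psi>. frame_point c f g (cis \<psi>)))"
proof -
  define f' g' where "f' = (\<lambda>\<alpha>. cos \<alpha> *\<^sub>R f + sin \<alpha> *\<^sub>R g)" and "g' = (\<lambda>\<alpha>. (- sin \<alpha>) *\<^sub>R f + cos \<alpha> *\<^sub>R g)"
  define h where "h = (\<lambda>\<alpha>. f' \<alpha> \<bullet> g' \<alpha>)"
  have "h (pi / 2) = - h 0" by (simp add: h_def f'_def g'_def inner_commute)
  have cont: "continuous_on S h" for S unfolding h_def f'_def g'_def by (intro continuous_intros)
  have "\<exists>\<alpha>. h \<alpha> = 0"
  proof (cases "h 0 \<le> 0")
    case True
    then have "\<exists>\<alpha>\<ge>0. \<alpha> \<le> pi / 2 \<and> h \<alpha> = 0" using \<open>h (pi / 2) = - h 0\<close> by (intro IVT' cont) auto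
    then show ?thesis by blast
  next
    case False
    then have "\<exists>\<alpha>\<ge>0. \<alpha> \<le> pi / 2 \<and> h \<alpha> = 0" using \<open>h (pi / 2) = - h 0\<close> by (intro IVT2' cont) auto
    then show ?thesis by blast
  qed
  then obtain \<alpha> where orth: "f' \<alpha> \<bullet> g' \<alpha> = 0" by (auto simp: h_def)
  have "area_form (f' \<alpha>) (g' \<alpha>) = (cos \<alpha> * cos \<alpha> + sin \<alpha> * sin \<alpha>) * area_form f g"
    unfolding f'_def g'_def area_form_def vector_add_component vector_scaleR_component real_scaleR_def
    by algebra
  also have "\<dots> = area_form f g" using sin_cos_squared_add[of \<alpha>] by (simp add: power2_eq_square)
  finally have ar: "area_form (f' \<alpha>) (g' \<alpha>) \<noteq> 0" using fg by simp
  define a b where "a = norm (f' \<alpha>)" and "b = norm (g' \<alpha>)"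
  define u v where "u = f' \<alpha> /\<^sub>R a" and "v = g' \<alpha> /\<^sub>R b"
  have "f' \<alpha> \<noteq> 0" "g' \<alpha> \<noteq> 0" using ar by (auto simp: area_form.zero_left area_form.zero_right)
  then have ab: "a > 0" "b > 0" by (simp_all add: a_def b_def)
  have uv: "norm u = 1" "norm v = 1" "u \<bullet> v = 0" "a *\<^sub>R u = f' \<alpha>" "b *\<^sub>R v = g' \<alpha>"
    using ab orth by (simp_all add: u_def v_def a_def b_def)
  have param: "c + (a * cos t) *\<^sub>R u + (b * sin t) *\<^sub>R v = frame_point c f g (cis (t + \<alpha>))" for t
  proof -
    have "c + (a * cos t) *\<^sub>R u + (b * sin t) *\<^sub>R v = c + cos t *\<^sub>R f' \<alpha> + sin t *\<^sub>R g' \<alpha>"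
      by (simp add: uv(4,5)[symmetric] mult.commute)
    then show ?thesis
      by (simp add: f'_def g'_def frame_point_def frame_vec_def cos_add sin_add algebra_simps)
  qed
  have "ellipse_plus c u v a b (\<lambda>_. 0) = range (\<lambda>t. frame_point c f g (cis (t + \<alpha>)))"
    using ellipse_plus_range[OF ab, of "\<lambda>_. 0" c u v] param by (simp add: add.assoc)
  also have "\<dots> = range (\<lambda>\<psi>. frame_point c f g (cis \<psi>))"
  proof -
    have "range (\<lambda>t. t + \<alpha>) = UNIV" by (intro surjI[where f = "\<lambda>x. x - \<alpha>"]) auto
    then show ?thesis by (metis image_image)
  qed
  finally have "ellipse_with_axes (range (\<lambda>\<psi>. frame_point c f g (cis \<psi>))) c u v a b"
    using uv ab by (simp add: ellipse_with_axes_def)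
  then show ?thesis unfolding is_ellipse_def by blast
qed

text \<open>The constants of the theorem may depend on the curve \<open>E\<close> only, while its description by axes is not
unique. The axes are controlled by the diameter of \<open>E\<close>.\<close>

lemma ellipse_scale_bounded:
  assumes "is_ellipse E"
  shows "\<exists>M\<ge>1. \<forall>p u v a b. ellipse_with_axes E p u v a b \<longrightarrow> ellipse_scale a b \<le> M"
proof -
  have rep: "E = range (\<lambda>\<theta>. p + ((a * cos \<theta>) *\<^sub>R u + (b * sin \<theta>) *\<^sub>R v))"
    if "ellipse_with_axes E p u v a b" for p u v a b
    using that ellipse_plus_range[of a b "\<lambda>_. 0" p u v] by (simp add: ellipse_with_axes_def)
  obtain p0 u0 v0 a0 b0 where E0: "ellipse_with_axes E p0 u0 v0 a0 b0" using assms by (auto simp: is_ellipse_def)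
  have "bounded E"
  proof (rule boundedI)
    fix x assume "x \<in> E"
    then obtain \<theta> where x: "x = p0 + ((a0 * cos \<theta>) *\<^sub>R u0 + (b0 * sin \<theta>) *\<^sub>R v0)" using rep[OF E0] by auto
    have "norm x \<le> norm p0 + (norm ((a0 * cos \<theta>) *\<^sub>R u0) + norm ((b0 * sin \<theta>) *\<^sub>R v0))"
      using norm_triangle_ineq[of p0 "(a0 * cos \<theta>) *\<^sub>R u0 + (b0 * sin \<theta>) *\<^sub>R v0"]
        norm_triangle_ineq[of "(a0 * cos \<theta>) *\<^sub>R u0" "(b0 * sin \<theta>) *\<^sub>R v0"] unfolding x by linarith
    also have "\<dots> \<le> norm p0 + (\<bar>a0\<bar> * 1 + \<bar>b0\<bar> * 1)"
      using E0 unfolding norm_scaleR abs_mult ellipse_with_axes_def by (intro add_mono order.refl) (auto intro!: mult_left_mono mult_left_le)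
    finally show "norm x \<le> norm p0 + (\<bar>a0\<bar> * 1 + \<bar>b0\<bar> * 1)" .
  qed
  then obtain R where R: "\<And>x. x \<in> E \<Longrightarrow> norm x \<le> R" by (auto simp: bounded_iff)
  have "ellipse_scale a b \<le> max 1 (root 3 (R * R))" if E: "ellipse_with_axes E p u v a b" for p u v a b
  proof -
    have e: "norm u = 1" "norm v = 1" "a > 0" "b > 0" using E by (auto simp: ellipse_with_axes_def)
    have mem: "p + ((a * cos \<theta>) *\<^sub>R u + (b * sin \<theta>) *\<^sub>R v) \<in> E" for \<theta> using rep[OF E] by blast
    have "norm ((p + a *\<^sub>R u) - (p - a *\<^sub>R u)) \<le> R + R"
      using R[OF mem[of 0]] R[OF mem[of pi]] by (intro order.trans[OF norm_triangle_ineq4 add_mono]) auto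
    also have "(p + a *\<^sub>R u) - (p - a *\<^sub>R u) = (2 * a) *\<^sub>R u" by (simp add: scaleR_2 flip: scaleR_scaleR)
    finally have aR: "a \<le> R" using e by simp
    have "norm ((p + b *\<^sub>R v) - (p - b *\<^sub>R v)) \<le> R + R"
      using R[OF mem[of "pi / 2"]] R[OF mem[of "- (pi / 2)"]] by (intro order.trans[OF norm_triangle_ineq4 add_mono]) auto
    also have "(p + b *\<^sub>R v) - (p - b *\<^sub>R v) = (2 * b) *\<^sub>R v" by (simp add: scaleR_2 flip: scaleR_scaleR)
    finally have bR: "b \<le> R" using e by simp
    have "a * b \<le> R * R" using aR bR e by (intro mult_mono) auto
    then show ?thesis by (simp add: ellipse_scale_def le_max_iff_disj)
  qed
  then show ?thesis by (intro exI[of _ "max 1 (root 3 (R * R))"]) auto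
qed

section \<open>Rigidity of ellipses\<close>

lemma nderiv_Suc_deriv: "nderiv (Suc j) (f :: real \<Rightarrow> real) = nderiv j (deriv f)"
proof -
  have "(\<lambda>t. vector_derivative f (at t)) = deriv f"
    by (rule ext) (rule field_derivative_eq_vector_derivative[symmetric])
  then show ?thesis by (simp add: nderiv_def funpow_Suc_right del: funpow.simps)
qed

lemma is_Ck_imp_Ck_bounded:
  fixes f :: "real \<Rightarrow> real"
  assumes "is_Ck k f" "\<And>j t. j \<le> k \<Longrightarrow> \<bar>nderiv j f t\<bar> \<le> C"
  shows "Ck_bounded k C f"
  using assms
proof (induction k arbitrary: f)
  case 0
  have "nderiv 0 f = f" by (simp add: nderiv_def)
  then show ?case using 0(1) 0(2)[of 0] by (simp add: is_Ck_def)
next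
  case (Suc k)
  have f0: "nderiv 0 f = f" by (simp add: nderiv_def)
  have "f differentiable (at t)" for t using Suc.prems(1) f0 unfolding is_Ck_def by (metis zero_less_Suc)
  then have "(f has_real_derivative deriv f t) (at t)" for t
    by (simp add: DERIV_deriv_iff_real_differentiable)
  moreover have "is_Ck k (deriv f)"
    using Suc.prems(1) unfolding is_Ck_def nderiv_Suc_deriv[symmetric] by (metis Suc_less_eq)
  then have "Ck_bounded k C (deriv f)"
    by (rule Suc.IH) (use Suc.prems(2)[of "Suc _"] in \<open>simp add: nderiv_Suc_deriv\<close>)
  moreover have "\<bar>f t\<bar> \<le> C" for t using Suc.prems(2)[of 0 t] f0 by simp
  ultimately show ?case by simp
qed

lemma nderiv_periodic:
  fixes f :: "real \<Rightarrow> real"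
  assumes "\<And>x. f (x + p) = f x" shows "nderiv j f (x + p) = nderiv j f x"
  using assms
proof (induction j arbitrary: f x)
  case 0
  then show ?case by (simp add: nderiv_def)
next
  case (Suc j)
  have "deriv f (x + p) = deriv f x" for x
  proof -
    have "(f has_field_derivative D) (at (x + p)) \<longleftrightarrow> (f has_field_derivative D) (at x)" for D
      using DERIV_shift[of f D x p] Suc.prems by simp
    then show ?thesis by (simp add: deriv_def)
  qed
  then show ?case unfolding nderiv_Suc_deriv by (rule Suc.IH)
qed

lemma Ck_close_via_bounded:
  assumes close: "Ck_close_via k C p u v a b n \<Omega>" and ab: "a > 0" "b > 0"
  shows "Ck_bounded k C n"
proof (rule is_Ck_imp_Ck_bounded)
  define L where "L = 2 * pi * ellipse_scale a b"
  have L: "L > 0" using ab by (simp add: L_def ellipse_scale_def)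
  have per: "n (t + L) = n t" for t using close by (simp add: Ck_close_via_def L_def)
  show Ck: "is_Ck k n" using close by (simp add: Ck_close_via_def)
  have norm: "(\<Sum>j\<le>k. SUP t\<in>{0..L}. \<bar>nderiv j n t\<bar>) \<le> C"
    using close by (simp add: Ck_close_via_def Ck_norm_def L_def)
  have cont: "continuous_on UNIV (nderiv j n)" if "j \<le> k" for j
  proof (cases "j = k")
    case False
    then have "\<forall>t. nderiv j n differentiable (at t)" using that Ck by (auto simp: is_Ck_def)
    then show ?thesis by (auto intro!: continuous_at_imp_continuous_on differentiable_imp_continuous_within)
  qed (use Ck in \<open>simp add: is_Ck_def\<close>)
  have bdd: "bdd_above ((\<lambda>t. \<bar>nderiv j n t\<bar>) ` {0..L})" if "j \<le> k" for j
  proof -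
    have "compact ((\<lambda>t. \<bar>nderiv j n t\<bar>) ` {0..L})"
      by (intro compact_continuous_image continuous_intros continuous_on_subset[OF cont[OF that]]) auto
    then show ?thesis by (intro bounded_imp_bdd_above compact_imp_bounded)
  qed
  have le_SUP: "\<bar>nderiv j n t\<bar> \<le> (SUP t\<in>{0..L}. \<bar>nderiv j n t\<bar>)" if "j \<le> k" "t \<in> {0..L}" for j t
    using that bdd by (intro cSUP_upper)
  have nonneg: "0 \<le> (SUP t\<in>{0..L}. \<bar>nderiv j n t\<bar>)" if "j \<le> k" for j
    using le_SUP[OF that, of 0] L by (intro order.trans[OF abs_ge_zero]) auto
  fix j t assume j: "j \<le> k"
  have "nderiv j n ` {0..L} = range (nderiv j n)"
    by (rule range_periodic[where F = "nderiv j n" and p = L, OF nderiv_periodic[where f = n and p = L, OF per] L])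
  then obtain s where s: "s \<in> {0..L}" "nderiv j n t = nderiv j n s" by (metis imageE rangeI)
  have "\<bar>nderiv j n t\<bar> \<le> (SUP t\<in>{0..L}. \<bar>nderiv j n t\<bar>)" using le_SUP[OF j s(1)] s(2) by simp
  also have "\<dots> \<le> (\<Sum>j\<le>k. SUP t\<in>{0..L}. \<bar>nderiv j n t\<bar>)"
    using j nonneg by (intro member_le_sum) auto
  finally show "\<bar>nderiv j n t\<bar> \<le> C" using norm by simp
qed

lemma Ck_bounded_scale:
  assumes "Ck_bounded k C f" "\<bar>s\<bar> \<le> M" "1 \<le> M" "\<bar>r\<bar> \<le> R"
  shows "Ck_bounded k (R * C * M ^ k) (\<lambda>x. r * f (s * x))"
  using assms(1,4)
proof (induction k arbitrary: f r R)
  case 0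
  then show ?case
    by (auto intro!: continuous_intros abs_mult_le continuous_on_compose2[where g = f and t = UNIV])
next
  case (Suc k)
  have D: "(f has_real_derivative deriv f x) (at x)" for x using Suc.prems(1) by simp
  have D': "((\<lambda>x. r * f (s * x)) has_real_derivative (r * s) * deriv f (s * x)) (at x)" for x
    by (auto intro!: derivative_eq_intros DERIV_chain2[OF D])
  then have "deriv (\<lambda>x. r * f (s * x)) = (\<lambda>x. (r * s) * deriv f (s * x))"
    by (intro ext DERIV_imp_deriv)
  moreover have "Ck_bounded k ((R * M) * C * M ^ k) (\<lambda>x. (r * s) * deriv f (s * x))"
    using Suc.prems assms(2) by (intro Suc.IH abs_mult_le) auto
  moreover have "\<bar>r * f (s * x)\<bar> \<le> R * C * M ^ Suc k" for x
  proof -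
    have b: "\<bar>f (s * x)\<bar> \<le> C" using Suc.prems(1) by simp
    have "0 \<le> R * C" using b Suc.prems(2) by (intro mult_nonneg_nonneg order.trans[OF abs_ge_zero])
    then have "R * C * 1 \<le> R * C * M ^ Suc k" using assms(3) by (intro mult_left_mono one_le_power)
    then show ?thesis using abs_mult_le[OF Suc.prems(2) b] by simp
  qed
  ultimately show ?case using D' by (simp add: mult_ac)
qed

lemma rational_integrability_orbit_sums:
  assumes dom: "smooth_convex_domain \<Omega>" and rat: "rationally_integrable \<Omega>"
    and fr: "frontier \<Omega> = range (\<lambda>\<psi>. frame_point c f g (of_real (1 + m \<psi>) * cis \<psi>))"
    and fg: "area_form f g > 0" and per: "\<forall>x. m (x + 2 * pi) = m x" and Ck: "Ck_bounded 11 B m"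
    and small: "C2_small (1 / 100) m" and \<epsilon>: "\<epsilon> \<le> 1 / 100" "C2_small \<epsilon> m"
  shows "orbit_sums_small \<epsilon> m"
proof -
  obtain \<gamma> where \<gamma>: "boundary_param \<Omega> \<gamma>" and curves: "\<And>q::nat. q \<ge> 3 \<Longrightarrow>
         (\<exists>C. invariant_curve \<gamma> C \<and>
              (\<forall>z\<in>C. has_rotation_number \<gamma> z (1 / real q)) \<and>
              (\<forall>z\<in>C. (symplectic_billiard \<gamma> ^^ q) z = z))"
    using rat by (auto simp: rationally_integrable_def)
  have D: "(m has_real_derivative deriv m x) (at x)" "(deriv m has_real_derivative deriv (deriv m) x) (at x)" for x
    using Ck by (simp_all add: eval_nat_numeral)
  have s: "\<bar>m x\<bar> \<le> 1 / 100" "\<bar>deriv m x\<bar> \<le> 1 / 100" "\<bar>deriv (deriv m) x\<bar> \<le> 1 / 100" for x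
    using small unfolding C2_small_def by blast+
  interpret polar_table \<Omega> c f g "\<lambda>x. 1 + m x" "deriv m" "deriv (deriv m)" \<gamma>
  proof
    show "area_form f g > 0" "boundary_param \<Omega> \<gamma>" by fact+
    show "open \<Omega>" "convex \<Omega>" using dom by (auto simp: smooth_convex_domain_def)
    show "frontier \<Omega> = range (\<lambda>\<psi>. frame_point c f g (of_real (1 + m \<psi>) * cis \<psi>))" by fact
    show "1 + m (\<psi> + 2 * pi) = 1 + m \<psi>" for \<psi> using per by simp
    show "((\<lambda>x. 1 + m x) has_real_derivative deriv m \<psi>) (at \<psi>)" for \<psi>
      by (auto intro!: derivative_eq_intros D)
    show "(deriv m has_real_derivative deriv (deriv m) \<psi>) (at \<psi>)" for \<psi> by (rule D)
    show "0 < 1 + m \<psi>" "\<bar>deriv m \<psi>\<bar> < 1 + m \<psi>" for \<psi> using s[of \<psi>] by linarith+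
    show "deriv (deriv m) \<psi> * (1 + m \<psi>) - (deriv m \<psi>)\<^sup>2 < (1 + m \<psi>)\<^sup>2 + (deriv m \<psi>)\<^sup>2" for \<psi>
    proof -
      have "deriv (deriv m) \<psi> * (1 + m \<psi>) < (1 + m \<psi>) * (1 + m \<psi>)"
        using s[of \<psi>] by (intro mult_strict_right_mono) linarith+
      then show ?thesis using zero_le_power2[of "deriv m \<psi>"] unfolding power2_eq_square by linarith
    qed
  qed
  have \<epsilon>0: "0 \<le> \<epsilon>" and sm: "\<bar>m x\<bar> \<le> \<epsilon>" "\<bar>deriv m x\<bar> \<le> \<epsilon>" "\<bar>deriv (deriv m) x\<bar> \<le> \<epsilon>" for x
    using \<epsilon>(2) unfolding C2_small_def by (blast | metis abs_ge_zero order.trans)+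
  show ?thesis unfolding orbit_sums_small_def
  proof (intro allI impI)
    fix q :: nat and x assume q: "q \<ge> 3"
    obtain C where C: "invariant_curve \<gamma> C" "\<forall>z\<in>C. has_rotation_number \<gamma> z (1 / real q)"
      "\<forall>z\<in>C. (symplectic_billiard \<gamma> ^^ q) z = z" using curves[OF q] by blast
    show "\<bar>\<Sum>k<q. deriv m (x + 2 * pi * k / q)\<bar> \<le> 200 * real q ^ 4 * \<epsilon>\<^sup>2"
      using rational_curve_orbit_sums[OF q C \<epsilon>0 \<epsilon>(1), of x] sm by simp
  qed
qed

text \<open>The axis directions may form a negatively oriented frame. In that case the second axis and the
parameter are reversed, which gives \<open>s\<close> its sign.\<close>

lemma frame_of_deformed_ellipse:
  assumes E: "ellipse_with_axes E p u v a b" and per: "\<And>t. n (t + 2 * pi * ellipse_scale a b) = n t"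
  shows "\<exists>f g s. area_form f g > 0 \<and> \<bar>s\<bar> = ellipse_scale a b \<and>
    ellipse_plus p u v a b n = range (\<lambda>\<theta>. frame_point p f g (of_real (1 + n (s * \<theta>)) * cis \<theta>))"
proof -
  define S where "S = ellipse_scale a b"
  have e: "norm u = 1" "norm v = 1" "u \<bullet> v = 0" "a > 0" "b > 0" using E by (auto simp: ellipse_with_axes_def)
  have S: "S > 0" using e by (simp add: S_def ellipse_scale_def)
  have "area_form u v \<noteq> 0"
  proof
    assume z: "area_form u v = 0"
    have "u \<noteq> 0" using e(1) by auto
    then obtain r where r: "v = r *\<^sub>R u" using area_form_zero_parallel[OF z] by blast
    then have "r * (u \<bullet> u) = 0" using e(3) by simp
    then have "v = 0" using r \<open>u \<noteq> 0\<close> by simp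
    then show False using e(2) by simp
  qed
  define j where "j = sgn (area_form u v)"
  have j: "j = 1 \<or> j = - 1" "j * area_form u v > 0"
    using \<open>area_form u v \<noteq> 0\<close> by (auto simp: j_def sgn_if)
  define f g where "f = a *\<^sub>R u" and "g = (j * b) *\<^sub>R v"
  have "area_form f g = (a * b) * (j * area_form u v)"
    by (simp add: f_def g_def area_form.scaleR_left area_form.scaleR_right)
  then have fg: "area_form f g > 0" using e j(2) by simp
  define F where "F = (\<lambda>\<theta>. p + (1 + n (S * \<theta>)) *\<^sub>R ((a * cos \<theta>) *\<^sub>R u + (b * sin \<theta>) *\<^sub>R v))"
  have "frame_point p f g (of_real (1 + n (S * j * \<theta>)) * cis \<theta>) = F (j * \<theta>)" for \<theta>
    using j(1) by (auto simp: F_def frame_point_def frame_vec_def f_def g_def algebra_simps)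
  moreover have "range (\<lambda>\<theta>. F (j * \<theta>)) = range F"
  proof -
    have "range (\<lambda>\<theta>. j * \<theta>) = UNIV" using j(1) by (intro surjI[where f = "\<lambda>x. j * x"]) auto
    then show ?thesis by (metis image_image)
  qed
  moreover have "ellipse_plus p u v a b n = range F"
    unfolding F_def S_def by (rule ellipse_plus_range[where n = n, OF e(4,5) per])
  moreover have "\<bar>S * j\<bar> = S" using j(1) S by auto
  ultimately show ?thesis using fg by (intro exI[of _ f] exI[of _ g] exI[of _ "S * j"]) (auto simp: S_def)
qed

text \<open>Absorbs the normalizing affine map into the frame.\<close>

lemma frame_point_change:
  fixes c f g :: "real^2" and z :: complex and e1 e2 e3 c1 c2 :: real
  assumes "e1 > 0" "e3 > 0"
  defines "f' \<equiv> (1 / e1) *\<^sub>R f + (e2 / (e1 * e3)) *\<^sub>R g" and "g' \<equiv> (1 / e3) *\<^sub>R g"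
  shows "frame_point c f g z =
    frame_point (c + c1 *\<^sub>R f + c2 *\<^sub>R g) f' g' (Complex (e1 * (Re z - c1)) (e3 * (Im z - c2) - e2 * (Re z - c1)))"
    "area_form f' g' = area_form f g / (e1 * e3)"
proof -
  have "(e1 * x) *\<^sub>R f' + (e3 * y - e2 * x) *\<^sub>R g' = x *\<^sub>R f + y *\<^sub>R g" for x y
  proof -
    have "(e1 * x) *\<^sub>R f' + (e3 * y - e2 * x) *\<^sub>R g' =
       (e1 * x * (1 / e1)) *\<^sub>R f + (e1 * x * (e2 / (e1 * e3)) + (e3 * y - e2 * x) * (1 / e3)) *\<^sub>R g"
      by (simp add: f'_def g'_def algebra_simps)
    also have "e1 * x * (1 / e1) = x" using assms(1) by simp
    also have "e1 * x * (e2 / (e1 * e3)) + (e3 * y - e2 * x) * (1 / e3) = y" using assms(1,2) by (simp add: field_simps)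
    finally show ?thesis .
  qed
  from this[of "Re z - c1" "Im z - c2"]
  show "frame_point c f g z =
    frame_point (c + c1 *\<^sub>R f + c2 *\<^sub>R g) f' g' (Complex (e1 * (Re z - c1)) (e3 * (Im z - c2) - e2 * (Re z - c1)))"
    by (simp add: frame_point_def frame_vec_def algebra_simps)
  show "area_form f' g' = area_form f g / (e1 * e3)"
    by (simp add: f'_def g'_def area_form.add_left area_form.scaleR_left area_form.scaleR_right)
qed

theorem theorem1:
  fixes E :: "(real^2) set" and K :: real
  assumes "is_ellipse E" and "K > 0"
  shows "\<exists>\<epsilon>>0. \<forall>\<Omega> p u v a b n.
    smooth_convex_domain \<Omega> \<longrightarrow>
    ellipse_with_axes E p u v a b \<longrightarrow>
    Ck_close_via 127 K p u v a b n \<Omega> \<longrightarrow>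
    Ck_close_via 1 \<epsilon> p u v a b n \<Omega> \<longrightarrow>
    rationally_integrable \<Omega> \<longrightarrow>
    is_ellipse (frontier \<Omega>)"
proof -
  obtain M where M: "M \<ge> 1" "\<And>p u v a b. ellipse_with_axes E p u v a b \<Longrightarrow> ellipse_scale a b \<le> M"
    using ellipse_scale_bounded[OF assms(1)] by blast
  \<comment> \<open>Passing from \<open>t\<close> to the polar angle multiplies the \<open>j\<close>-th derivative of \<open>n\<close> by at most \<open>M ^ j\<close>.\<close>
  define K' where "K' = K * M ^ 12"
  have K': "0 \<le> K'" using assms(2) M(1) by (simp add: K'_def)
  obtain B where B: "B \<ge> 0" and normalize: "\<And>\<eta>'. \<eta>' > 0 \<Longrightarrow> \<exists>\<delta>>0. \<forall>n. (\<forall>x. n (x + 2 * pi) = n x) \<longrightarrow> Ck_bounded 12 K' n \<longrightarrow>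
    (\<forall>x. \<bar>n x\<bar> \<le> \<delta> \<and> \<bar>deriv n x\<bar> \<le> \<delta>) \<longrightarrow>
    has_normal_form B \<eta>' n"
    using normalized_deformation[OF K'] by blast
  obtain \<epsilon>0 where \<epsilon>0: "\<epsilon>0 > 0" and rigid: "\<And>m. (\<forall>x. m (x + 2 * pi) = m x) \<Longrightarrow> Ck_bounded 11 B m \<Longrightarrow>
     satisfies_moments (\<lambda>x. 1 + m x) \<Longrightarrow> C2_small \<epsilon>0 m \<Longrightarrow>
     (\<forall>\<epsilon>\<le>1 / 100. C2_small \<epsilon> m \<longrightarrow> orbit_sums_small \<epsilon> m) \<Longrightarrow> (\<forall>x. m x = 0)"
    using C2_small_imp_zero[OF B] by blast
  have "min \<epsilon>0 (1 / 100) > 0" using \<epsilon>0 by simp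
  from C2_small_interpolation[OF B this]
  obtain \<eta>' where \<eta>': "\<eta>' > 0" and interp: "\<And>f. Ck_bounded 3 B f \<Longrightarrow> (\<forall>x. \<bar>f x\<bar> \<le> \<eta>') \<Longrightarrow> C2_small (min \<epsilon>0 (1 / 100)) f"
    by blast
  obtain \<delta> where \<delta>: "\<delta> > 0" and norm\<delta>: "\<And>n. (\<forall>x. n (x + 2 * pi) = n x) \<Longrightarrow> Ck_bounded 12 K' n \<Longrightarrow>
    (\<forall>x. \<bar>n x\<bar> \<le> \<delta> \<and> \<bar>deriv n x\<bar> \<le> \<delta>) \<Longrightarrow>
    has_normal_form B \<eta>' n"
    using normalize[OF \<eta>'] by metis
  have "is_ellipse (frontier \<Omega>)"
    if dom: "smooth_convex_domain \<Omega>" and E: "ellipse_with_axes E p u v a b"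
      and close127: "Ck_close_via 127 K p u v a b n \<Omega>" and close1: "Ck_close_via 1 (\<delta> / M) p u v a b n \<Omega>"
      and rat: "rationally_integrable \<Omega>" for \<Omega> p u v a b n
  proof -
    have ab: "a > 0" "b > 0" using E by (auto simp: ellipse_with_axes_def)
    have per: "n (t + 2 * pi * ellipse_scale a b) = n t" for t using close127 by (simp add: Ck_close_via_def)
    obtain f g s where fg: "area_form f g > 0" and s: "\<bar>s\<bar> = ellipse_scale a b"
      and fr: "ellipse_plus p u v a b n = range (\<lambda>\<theta>. frame_point p f g (of_real (1 + n (s * \<theta>)) * cis \<theta>))"
      using frame_of_deformed_ellipse[where n = n, OF E per] by blast
    have sM: "\<bar>s\<bar> \<le> M" using s M(2)[OF E] by simp
    define N where "N = (\<lambda>\<theta>. n (s * \<theta>))"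
    have perN: "\<forall>x. N (x + 2 * pi) = N x"
    proof
      fix x
      have "n (t + s * (2 * pi)) = n t" for t
      proof (cases "s \<ge> 0")
        case True
        then show ?thesis using per[of t] s by (simp add: mult.commute)
      next
        case False
        then have "t + s * (2 * pi) + 2 * pi * ellipse_scale a b = t" using s by (simp flip: s add: algebra_simps)
        then show ?thesis using per[of "t + s * (2 * pi)"] by (simp only:)
      qed
      then show "N (x + 2 * pi) = N x" by (simp add: N_def distrib_left)
    qed
    have "Ck_bounded 12 K n" by (rule Ck_bounded_le[OF Ck_close_via_bounded[OF close127 ab]]) simp
    from Ck_bounded_scale[OF this sM M(1), of 1 1]
    have CkN: "Ck_bounded 12 K' N" by (simp add: K'_def N_def)
    have "Ck_bounded 1 (1 * (\<delta> / M) * M ^ 1) (\<lambda>x. 1 * n (s * x))"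
      by (rule Ck_bounded_scale[OF Ck_close_via_bounded[OF close1 ab] sM M(1)]) simp
    then have "Ck_bounded (Suc 0) \<delta> N" using M(1) by (simp add: N_def)
    then have smallN: "\<forall>x. \<bar>N x\<bar> \<le> \<delta> \<and> \<bar>deriv N x\<bar> \<le> \<delta>" by simp
    obtain c1 c2 e1 e2 e3 m where e: "e1 > 0" "e3 > 0" and m: "\<forall>x. m (x + 2 * pi) = m x" "Ck_bounded 11 B m"
       "\<forall>x. \<bar>m x\<bar> \<le> \<eta>'" "satisfies_moments (\<lambda>x. 1 + m x)"
      and img: "range (\<lambda>t. Complex (e1 * ((1 + N t) * cos t - c1)) (e3 * ((1 + N t) * sin t - c2) - e2 * ((1 + N t) * cos t - c1)))
         = range (\<lambda>\<psi>. of_real (1 + m \<psi>) * cis \<psi>)"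
      using norm\<delta>[OF perN CkN smallN] unfolding has_normal_form_def by (elim exE conjE) (rule that)
    define f' where "f' = (1 / e1) *\<^sub>R f + (e2 / (e1 * e3)) *\<^sub>R g"
    define g' where "g' = (1 / e3) *\<^sub>R g"
    define c where "c = p + c1 *\<^sub>R f + c2 *\<^sub>R g"
    note change = frame_point_change[OF e, where f = f and g = g and ?e2.0 = e2, folded f'_def g'_def]
    have fg': "area_form f' g' > 0" unfolding change(2) using fg e by simp
    have "frontier \<Omega> = range (\<lambda>\<theta>. frame_point p f g (of_real (1 + N \<theta>) * cis \<theta>))"
      using fr close127 by (simp add: Ck_close_via_def N_def)
    also have "\<dots> = frame_point c f' g' ` range (\<lambda>t. Complex (e1 * ((1 + N t) * cos t - c1)) (e3 * ((1 + N t) * sin t - c2) - e2 * ((1 + N t) * cos t - c1)))"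
      unfolding image_image c_def by (subst change(1)[where ?c1.0 = c1 and ?c2.0 = c2]) simp
    also have "\<dots> = range (\<lambda>\<psi>. frame_point c f' g' (of_real (1 + m \<psi>) * cis \<psi>))"
      unfolding img image_image ..
    finally have frm: "frontier \<Omega> = range (\<lambda>\<psi>. frame_point c f' g' (of_real (1 + m \<psi>) * cis \<psi>))" .
    have "C2_small (min \<epsilon>0 (1 / 100)) m" by (rule interp[OF Ck_bounded_le[OF m(2)] m(3)]) simp
    then have small: "C2_small \<epsilon>0 m" "C2_small (1 / 100) m" by (auto simp: C2_small_def)
    have "\<forall>\<epsilon>\<le>1 / 100. C2_small \<epsilon> m \<longrightarrow> orbit_sums_small \<epsilon> m"
      using rational_integrability_orbit_sums[OF dom rat frm fg' m(1,2) small(2)] by blast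
    from rigid[OF m(1,2,4) small(1) this]
    have "frontier \<Omega> = range (\<lambda>\<psi>. frame_point c f' g' (cis \<psi>))" unfolding frm by simp
    then show ?thesis using affine_image_of_circle_is_ellipse[of f' g' c] fg' by simp
  qed
  moreover have "\<delta> / M > 0" using \<delta> M(1) by simp
  ultimately show ?thesis by blast
qed

end
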